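(* Let $N,Q\in\mathbb{N}$ with $Q\le N$, let $g_Q:\mathbb{N}\to\mathbb{C}$ have Eratosthenes Transform $g_Q'$ vanishing outside $[1,Q]$, put $\widehat{g_Q}(\ell)=\sum_{d\le Q,\ \ell\mid d} g_Q'(d)/d$, and assume $\widehat{g_Q}$ is supported on square-free numbers. Let $f:\mathbb{N}\to\mathbb{C}$ be supported on primes. Define, for $a\in\mathbb{N}$, $$\mathcal{P}_{f,g_Q}(N,a)=\sum_{q\le Q}\mu(q)\widehat{g_Q}(q)\sum_{m\mid q}\mu(m)\,m\sum_{\substack{p\le N\\ (p,m)=1\\ -p\equiv a\ (\mathrm{mod}\ m)}} f(p),$$ and its IPPification $\widetilde{\mathcal{P}_{f,g_Q}}(N,a)=\mathcal{P}_{f,g_Q}(N,\kappa(a))$. Then for every $\ell\in\mathbb{N}$, $$\mathrm{Win}_\ell\,\widetilde{\mathcal{P}_{f,g_Q}}=\frac{\widehat{g_Q}(\ell)}{\varphi(\ell)}\sum_{p\le N} f(p)c_\ell(p)+\frac{\mu(\ell)\widehat{g_Q}(\ell)}{\varphi(\ell)}\sum_{p\mid \ell} f(p)\varphi(p)-\frac{\mu(\ell)}{\varphi(\ell)}\sum_{p\nmid \ell} f(p)\,\widehat{g_Q}(p\ell).$$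
   Context: $p$ always denotes a prime. $\mu$ is the Möbius function, $\varphi$ Euler's totient, $\kappa(a)=\prod_{p\mid a}p$ the square-free kernel. The Eratosthenes Transform of $h:\mathbb{N}\to\mathbb{C}$ is $h'(d)=\sum_{t\mid d}h(t)\mu(d/t)$. The Ramanujan sum is $c_\ell(m)=\sum_{1\le j\le \ell,\ (j,\ell)=1}e^{2\pi i jm/\ell}$. For $F:\mathbb{N}\to\mathbb{C}$ (here a function of $a$ with $N$ fixed), the $\ell$-th Wintner coefficient is $\mathrm{Win}_\ell F=\sum_{d\ge1,\ \ell\mid d} F'(d)/d$ (series in increasing $d$). *)

theory Defs
  imports "HOL-Analysis.Analysis" "HOL-Number_Theory.Number_Theory"
    "HOL-Computational_Algebra.Squarefree"
begin

text \<open>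
  Arithmetic functions live on the positive integers. They are rendered as functions on
  \<^typ>\<open>nat\<close>; values at 0 are never used, because all divisors, moduli and summation
  indices below are positive.
\<close>

definition mob :: "nat \<Rightarrow> int" where
  "mob n = (if squarefree n then (-1) ^ card (prime_factors n) else 0)"

definition sqfree_kernel :: "nat \<Rightarrow> nat" where
  "sqfree_kernel a = (\<Prod>p | prime p \<and> p dvd a. p)"

definition eratosthenes :: "(nat \<Rightarrow> complex) \<Rightarrow> nat \<Rightarrow> complex" where
  "eratosthenes h d = (\<Sum>t | t dvd d. h t * of_int (mob (d div t)))"

definition ramanujan_sum :: "nat \<Rightarrow> nat \<Rightarrow> complex" where
  "ramanujan_sum l m =
     (\<Sum>j | 1 \<le> j \<and> j \<le> l \<and> coprime j l.
        exp (2 * of_real pi * \<i> * of_nat j * of_nat m / of_nat l))"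

text \<open>
  The series runs over the positive integers in increasing order, the index \<^term>\<open>n\<close>
  standing for \<^term>\<open>d = Suc n\<close>; indices that are not multiples of \<^term>\<open>l\<close> contribute
  the term 0. The series need not converge absolutely, so the order matters.
\<close>

definition wintner_term :: "(nat \<Rightarrow> complex) \<Rightarrow> nat \<Rightarrow> nat \<Rightarrow> complex" where
  "wintner_term F l n =
     (if l dvd Suc n then eratosthenes F (Suc n) / of_nat (Suc n) else 0)"

definition wintner :: "(nat \<Rightarrow> complex) \<Rightarrow> nat \<Rightarrow> complex" where
  "wintner F l = (\<Sum>n. wintner_term F l n)"

definition g_hat :: "nat \<Rightarrow> (nat \<Rightarrow> complex) \<Rightarrow> nat \<Rightarrow> complex" where
  "g_hat Q g l = (\<Sum>d | 1 \<le> d \<and> d \<le> Q \<and> l dvd d. eratosthenes g d / of_nat d)"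

definition P_corr ::
  "(nat \<Rightarrow> complex) \<Rightarrow> (nat \<Rightarrow> complex) \<Rightarrow> nat \<Rightarrow> nat \<Rightarrow> nat \<Rightarrow> complex" where
  "P_corr f g Q N a =
     (\<Sum>q = 1..Q. of_int (mob q) * g_hat Q g q *
        (\<Sum>m | m dvd q. of_int (mob m) * of_nat m *
           (\<Sum>p | prime p \<and> p \<le> N \<and> coprime p m \<and> [- int p = int a] (mod int m). f p)))"

definition IPPification :: "(nat \<Rightarrow> complex) \<Rightarrow> nat \<Rightarrow> complex" where
  "IPPification F a = F (sqfree_kernel a)"

end

theory Submission
  imports Defs "HOL-Complex_Analysis.Complex_Analysis"
begin

text \<open>
  By linearity it suffices to treat the functions \<open>a \<mapsto> [\<kappa>(a) \<equiv> b (mod m)]\<close> with \<open>m\<close> square-free and \<open>b\<close>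
  coprime to \<open>m\<close>. Their Eratosthenes transforms live on square-free \<open>d\<close>, and splitting \<open>d = e k\<close> with
  \<open>e = gcd(d, M)\<close>, where \<open>M = lcm(l, m)\<close>, reduces the coefficient to sums over \<open>k\<close> coprime to \<open>M\<close>. There all
  classes \<open>b\<close> contribute equally, each \<open>1/\<phi>(m)\<close>, because the corresponding series for a zero-mean
  \<open>M\<close>-periodic function \<open>\<alpha>\<close> tends to 0: up to an absolutely convergent Dirichlet factor
  supported on squareful numbers, it is the Dirichlet product of \<open>\<alpha>(n)/n\<close>, whose sum converges, with
  \<open>\<mu>(n)/n\<close>, whose sum is 0. The latter fact has the strength of the prime number theorem; it
  is derived from Newman's contour argument and the non-vanishing of zeta on the line of real part one. The
  convergence is only conditional, and Axer's theorem handles the product.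
\<close>

section \<open>The function mob and divisor sums\<close>

text \<open>The transform at a square-free \<open>d\<close> is a signed count of the divisors of
  \<open>d\<close> in one residue class, and nothing makes the series over \<open>d\<close> converge
  absolutely. Dirichlet products are therefore cut at \<open>d * k \<le> N\<close> throughout, and
  at most one conditionally convergent pair is handled at a time. Characters and L-functions do not
  occur: two classes are compared directly, through a unit modulo \<open>M\<close> that carries one
  into the other, and all classes together give the constant 1, whose transform lives at 1. In terms
  of Dirichlet series the periodic function stands in the numerator and zeta in the denominator,
  which is why only zeta has to be free of zeros. The limit \<open>1/\<phi>(m)\<close> meets the
  finite sum of \<open>mob x / x\<close> over the multiples \<open>x\<close> of \<open>l\<close>
  dividing \<open>m\<close>, which supplies \<open>\<phi>(m) / (m * \<phi>(l))\<close> up to sign;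
  so the class \<open>b\<close>, the factor \<open>\<phi>(m)\<close> and the weight \<open>m\<close>
  in \<open>P_corr\<close> all disappear. What remains is a Moebius identity that retains only
  \<open>q = l\<close> and \<open>q = p * l\<close>, the origin of the two values of
  \<open>g_hat\<close> in the formula.\<close>

lemma sum_divisors_coprime_mult:
  fixes f :: "nat \<Rightarrow> 'a::comm_monoid_add"
  assumes "coprime a b" "a > 0" "b > 0"
  shows "(\<Sum>d | d dvd a * b. f d) = (\<Sum>x | x dvd a. \<Sum>y | y dvd b. f (x * y))"
proof -
  have inj: "inj_on (\<lambda>(x, y). x * y) ({x. x dvd a} \<times> {y. y dvd b})"
  proof (rule inj_onI, clarsimp)
    fix x y x' y' assume *: "x dvd a" "y dvd b" "x' dvd a" "y' dvd b" "x * y = x' * y'"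
    then have c: "coprime x y'" "coprime x' y"
      using assms(1) by (meson coprime_divisors)+
    have "x dvd x' * y'" "x' dvd x * y" using *(5) by (metis dvd_triv_left)+
    then have "x dvd x'" "x' dvd x" using c coprime_dvd_mult_left_iff by blast+
    then have "x = x'" by (simp add: dvd_antisym)
    with * assms show "x = x' \<and> y = y'" by auto
  qed
  have img: "{d. d dvd a * b} = (\<lambda>(x, y). x * y) ` ({x. x dvd a} \<times> {y. y dvd b})"
    by (auto elim: dvd_productE intro: mult_dvd_mono)
  show ?thesis
    unfolding img by (subst sum.reindex[OF inj])
      (simp add: sum.cartesian_product case_prod_unfold comp_def)
qed

lemma coprime_iff_no_common_prime:
  "coprime a b \<longleftrightarrow> (\<forall>p. prime p \<longrightarrow> p dvd a \<longrightarrow> \<not> p dvd b)" for a b :: nat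
proof
  show "\<forall>p. prime p \<longrightarrow> p dvd a \<longrightarrow> \<not> p dvd b \<Longrightarrow> coprime a b"
    using coprime_iff_gcd_eq_1[of a b] prime_factor_nat[of "gcd a b"] by (metis gcd_dvd1 gcd_dvd2 dvd_trans)
  show "\<forall>p. prime p \<longrightarrow> p dvd a \<longrightarrow> \<not> p dvd b" if "coprime a b"
    using that by (metis coprime_common_divisor not_prime_unit)
qed

lemma of_nat_eq_mult_div:
  "d dvd n \<Longrightarrow> (of_nat n :: 'a::comm_semiring_1) = of_nat d * of_nat (n div d)"
  by (simp flip: of_nat_mult)

lemma sum_divisors_multiples:
  fixes h :: "nat \<Rightarrow> 'a::comm_monoid_add"
  assumes "l > 0" "k > 0"
  shows "(\<Sum>x | x dvd l * k. if l dvd x then h x else 0) = (\<Sum>v | v dvd k. h (l * v))"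
proof -
  have "(\<Sum>x | x dvd l * k. if l dvd x then h x else 0) = (\<Sum>x | x \<in> {x. x dvd l * k} \<and> l dvd x. h x)"
    using assms by (subst sum.inter_filter) auto
  also have "\<dots> = (\<Sum>v | v dvd k. h (l * v))"
    using assms by (intro sum.reindex_bij_witness[where i = "\<lambda>v. l * v" and j = "\<lambda>x. x div l"]) auto
  finally show ?thesis .
qed

lemma bij_betw_mult_mod:
  assumes "coprime c M" "M > (0::nat)"
  shows "bij_betw (\<lambda>n. c * n mod M) {..<M} {..<M}"
proof -
  have "inj_on (\<lambda>n. c * n mod M) {..<M}"
  proof (rule inj_onI)
    fix x y assume "x \<in> {..<M}" "y \<in> {..<M}" "c * x mod M = c * y mod M"
    then have "[c * x = c * y] (mod M)" "x < M" "y < M"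
      by (auto simp: unique_euclidean_semiring_class.cong_def)
    then show "x = y" using assms(1) by (simp add: cong_mult_lcancel_nat cong_less_modulus_unique_nat)
  qed
  moreover have "(\<lambda>n. c * n mod M) ` {..<M} \<subseteq> {..<M}" using assms(2) by auto
  ultimately show ?thesis by (simp add: bij_betw_def endo_inj_surj)
qed

lemma mob_1 [simp]: "mob 1 = 1" "mob (Suc 0) = 1"
  by (simp_all add: mob_def)

lemma abs_mob_le: "\<bar>mob n\<bar> \<le> 1"
  by (simp add: mob_def)

lemma norm_mob_le: "norm (of_int (mob n) :: complex) \<le> 1"
  using abs_mob_le[of n] by (simp add: norm_of_int)

lemma mob_mult_coprime:
  assumes "coprime a b"
  shows "mob (a * b) = mob a * mob b"
proof (cases "squarefree a \<and> squarefree b")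
  case True
  then have nz: "a \<noteq> 0" "b \<noteq> 0" by (metis not_squarefree_0)+
  have sq: "squarefree (a * b)" using True assms by (simp add: squarefree_mult_coprime)
  have "prime_factors (a * b) = prime_factors a \<union> prime_factors b"
    using nz by (simp add: prime_factors_product)
  moreover have "prime_factors a \<inter> prime_factors b = {}"
    using assms by (auto simp: in_prime_factors_iff)
       (meson coprime_common_divisor not_prime_unit)
  ultimately show ?thesis
    using True sq by (simp add: mob_def card_Un_disjoint power_add)
next
  case False
  then have "\<not> squarefree (a * b)" using squarefree_multD by blast
  then show ?thesis using False by (auto simp: mob_def)
qed

lemma mob_prime: "prime p \<Longrightarrow> mob p = -1"
  by (simp add: mob_def squarefree_prime prime_factorization_prime)

lemma mob_prime_power: "prime p \<Longrightarrow> k \<ge> 2 \<Longrightarrow> mob (p ^ k) = 0"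
  by (auto simp: mob_def squarefree_power_iff)

lemma sum_prime_power_divisors:
  fixes f :: "nat \<Rightarrow> 'a::comm_monoid_add"
  assumes "prime (p::nat)"
  shows "(\<Sum>d | d dvd p ^ k. f d) = (\<Sum>i\<le>k. f (p ^ i))"
proof -
  have "{d. d dvd p ^ k} = (\<lambda>i. p ^ i) ` {..k}"
    using divides_primepow_nat[OF assms(1)] by auto
  moreover have "inj_on (\<lambda>i. p ^ i) {..k}"
    using assms(1) by (auto intro!: inj_onI simp: prime_gt_Suc_0_nat)
  ultimately show ?thesis by (simp add: sum.reindex)
qed

lemma sum_mob_prime_power:
  assumes "prime p" "k > 0"
  shows "(\<Sum>d | d dvd p ^ k. mob d) = 0"
proof -
  have "(\<Sum>d | d dvd p ^ k. mob d) = (\<Sum>i\<le>k. mob (p ^ i))"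
    by (rule sum_prime_power_divisors[OF assms(1)])
  also have "\<dots> = (\<Sum>i\<in>{0, 1}. mob (p ^ i))"
    using assms by (intro sum.mono_neutral_right) (auto intro!: mob_prime_power)
  also have "\<dots> = 0" using assms by (simp add: mob_prime)
  finally show ?thesis .
qed

lemma prime_power_split:
  fixes n :: nat
  assumes "n > 1"
  obtains p k n' where "prime p" "k > 0" "\<not> p dvd n'" "n = p ^ k * n'" "n' > 0" "n' < n" "coprime (p ^ k) n'"
proof -
  obtain p where p: "prime p" "p dvd n" using assms prime_factor_nat[of n] by auto
  define k where "k = multiplicity p n"
  have k: "k > 0" using p assms by (simp add: k_def prime_multiplicity_gt_zero_iff)
  obtain n' where n': "n = p ^ k * n'" "\<not> p dvd n'"
    by (rule multiplicity_decompose'[of n p]) (use p assms in \<open>auto simp: k_def\<close>)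
  have "n' > 0" using n' assms by (cases n') auto
  moreover have "n' < n"
    using n'(1) \<open>n' > 0\<close> k one_less_power[OF prime_gt_1_nat[OF p(1)], of k] by simp
  moreover have "coprime (p ^ k) n'" using p n' by (simp add: prime_imp_coprime)
  ultimately show ?thesis using that p k n' by blast
qed

lemma sum_mob:
  assumes "n > 0"
  shows "(\<Sum>d | d dvd n. mob d) = (if n = 1 then 1 else 0)"
proof (cases "n = 1")
  case False
  then have "n > 1" using assms by simp
  then obtain p k n' where *: "prime p" "k > 0" "n = p ^ k * n'" "n' > 0" "coprime (p ^ k) n'"
    by (rule prime_power_split)
  have "(\<Sum>d | d dvd n. mob d) = (\<Sum>x | x dvd p ^ k. \<Sum>y | y dvd n'. mob (x * y))"
    using * by (simp add: sum_divisors_coprime_mult prime_gt_0_nat)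
  also have "\<dots> = (\<Sum>x | x dvd p ^ k. \<Sum>y | y dvd n'. mob x * mob y)"
    by (intro sum.cong refl mob_mult_coprime) (auto intro: coprime_divisors[OF _ _ *(5)])
  also have "\<dots> = (\<Sum>x | x dvd p ^ k. mob x) * (\<Sum>y | y dvd n'. mob y)"
    by (simp add: sum_product)
  finally show ?thesis using * False by (simp add: sum_mob_prime_power)
qed auto

text \<open>Partial sums of a Dirichlet convolution: the condition \<open>d * k \<le> N\<close> is
  kept as the inner cutoff \<open>N div d\<close>, the form in which conditionally convergent
  factors can be handled.\<close>

lemma sum_sum_divisors:
  fixes g :: "nat \<Rightarrow> nat \<Rightarrow> 'a::comm_monoid_add"
  shows "(\<Sum>n=1..N. \<Sum>d | d dvd n. g d (n div d)) = (\<Sum>d=1..N. \<Sum>k=1..N div d. g d k)"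
proof -
  have bound: "0 < b" "b \<le> N" if "b dvd a" "0 < a" "a \<le> N" for a b
    using that dvd_pos_nat dvd_imp_le[of b a] by auto
  have "(\<Sum>n=1..N. \<Sum>d | d dvd n. g d (n div d)) = (\<Sum>(n,d)\<in>(SIGMA n:{1..N}. {d. d dvd n}). g d (n div d))"
    by (intro sum.Sigma) (auto intro: finite_divisors_nat)
  also have "\<dots> = (\<Sum>(d,k)\<in>(SIGMA d:{1..N}. {1..N div d}). g d k)"
    by (rule sum.reindex_bij_witness[where i = "\<lambda>(d,k). (d * k, d)" and j = "\<lambda>(n,d). (d, n div d)"])
       (auto simp: less_eq_div_iff_mult_less_eq mult.commute div_le_mono Suc_le_eq dest: bound)
  also have "\<dots> = (\<Sum>d=1..N. \<Sum>k=1..N div d. g d k)"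
    by (intro sum.Sigma[symmetric]) auto
  finally show ?thesis .
qed

lemma sum_div_swap:
  fixes g :: "nat \<Rightarrow> nat \<Rightarrow> 'a::comm_monoid_add"
  shows "(\<Sum>d=1..N. \<Sum>k=1..N div d. g d k) = (\<Sum>k=1..N. \<Sum>d=1..N div k. g d k)"
proof -
  have le: "b \<le> N" if "a * b \<le> N" "0 < a" for a b :: nat
    using that by (cases a) auto
  have "(\<Sum>d=1..N. \<Sum>k=1..N div d. g d k) = (\<Sum>(d,k)\<in>(SIGMA d:{1..N}. {1..N div d}). g d k)"
    by (intro sum.Sigma) auto
  also have "\<dots> = (\<Sum>(k,d)\<in>(SIGMA k:{1..N}. {1..N div k}). g d k)"
    by (rule sum.reindex_bij_witness[where i = "\<lambda>(k,d). (d, k)" and j = "\<lambda>(d,k). (k, d)"])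
       (auto simp: less_eq_div_iff_mult_less_eq mult.commute Suc_le_eq intro: le)
  also have "\<dots> = (\<Sum>k=1..N. \<Sum>d=1..N div k. g d k)"
    by (intro sum.Sigma[symmetric]) auto
  finally show ?thesis .
qed

text \<open>The analogue for Dirichlet products of Mertens' theorem on Cauchy products: one factor
  converges absolutely, of the other only the limit of the partial sums \<open>s\<close> is known.
  Since \<open>N div k\<close> tends to infinity for each fixed \<open>k\<close> and
  \<open>s\<close> is bounded, Tannery's theorem allows passing to the limit term by term.\<close>

lemma sum_div_tendsto:
  fixes b s :: "nat \<Rightarrow> 'a::{real_normed_field, banach}"
  assumes b: "summable (\<lambda>n. norm (b (Suc n)))" and s: "s \<longlonglongrightarrow> A"
  shows "(\<lambda>N. \<Sum>k=1..N. b k * s (N div k)) \<longlonglongrightarrow> (\<Sum>n. b (Suc n)) * A"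
proof -
  obtain C where C: "\<And>n. norm (s n) \<le> C"
    using convergent_imp_Bseq[OF convergentI[OF s]] by (auto simp: Bseq_def)
  \<comment> \<open>Cutting off at \<open>k < N\<close> turns the finite sum into a series over a
    fixed index set; beyond the cutoff the factor would be \<open>s 0\<close>, which need not
    vanish.\<close>
  define a where "a k N = (if k < N then b (Suc k) * s (N div Suc k) else 0)" for k N
  have lim: "((\<lambda>N. a k N) \<longlongrightarrow> b (Suc k) * A) sequentially" for k
  proof -
    have "filterlim (\<lambda>N. N div Suc k) at_top sequentially"
      by (rule filterlim_at_top_div_const_nat) simp
    then have "(\<lambda>N. s (N div Suc k)) \<longlonglongrightarrow> A" by (rule filterlim_compose[OF s])
    then have "(\<lambda>N. b (Suc k) * s (N div Suc k)) \<longlonglongrightarrow> b (Suc k) * A" by (intro tendsto_intros)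
    moreover have "eventually (\<lambda>N. a k N = b (Suc k) * s (N div Suc k)) sequentially"
      using eventually_gt_at_top[of k] by eventually_elim (simp add: a_def)
    ultimately show ?thesis by (simp add: tendsto_cong)
  qed
  have C0: "C \<ge> 0" using order_trans[OF norm_ge_zero C[of 0]] .
  have "(\<lambda>N. suminf (\<lambda>k. a k N)) \<longlonglongrightarrow> (\<Sum>k. b (Suc k) * A)"
  proof (rule tannerys_theorem[THEN conjunct2, THEN conjunct2])
    show "\<And>k. (\<lambda>N. a k N) \<longlonglongrightarrow> b (Suc k) * A" by (rule lim)
    show "\<forall>\<^sub>F (k, n) in sequentially \<times>\<^sub>F sequentially. norm (a k n) \<le> norm (b (Suc k)) * C"
      by (rule always_eventually) (auto simp: a_def norm_mult C C0 intro!: mult_left_mono)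
    show "summable (\<lambda>k. norm (b (Suc k)) * C)" by (intro summable_mult2 b)
  qed auto
  moreover have "suminf (\<lambda>k. a k N) = (\<Sum>k=1..N. b k * s (N div k))" for N
  proof -
    have "suminf (\<lambda>k. a k N) = (\<Sum>k\<in>{..<N}. a k N)"
      by (intro suminf_finite) (auto simp: a_def)
    then show ?thesis by (simp add: a_def sum.atLeast1_atMost_eq)
  qed
  moreover have "(\<Sum>k. b (Suc k) * A) = (\<Sum>k. b (Suc k)) * A"
    using summable_norm_cancel[OF b] by (rule suminf_mult2[symmetric])
  ultimately show ?thesis by simp
qed

section \<open>The zeta function on the line of real part one\<close>

definition dirichlet_series :: "(nat \<Rightarrow> complex) \<Rightarrow> complex \<Rightarrow> complex" where
  "dirichlet_series a s = (\<Sum>n. a (Suc n) * of_nat (Suc n) powr (-s))"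

text \<open>
  The term is \<open>s - 1\<close> times the difference between the summand \<open>x powr -s\<close> at \<open>x = n + 1\<close> and its integral
  over \<open>[n + 1, n + 2]\<close>; the sum thus continues \<open>(s - 1) * zeta s\<close> to positive real part.
\<close>
definition zeta_term :: "nat \<Rightarrow> complex \<Rightarrow> complex" where
  "zeta_term n s = (s - 1) * of_nat (Suc n) powr (-s) + of_nat (Suc (Suc n)) powr (1 - s)
     - of_nat (Suc n) powr (1 - s)"

definition zeta_reg :: "complex \<Rightarrow> complex" where
  "zeta_reg s = 1 + (\<Sum>n. zeta_term n s)"

lemma norm_nat_powr: "norm (of_nat (Suc n) powr s :: complex) = real (Suc n) powr Re s"
  by (subst norm_powr_real_powr) auto

lemma nat_mult_powr: "(of_nat (m * n) :: complex) powr s = of_nat m powr s * of_nat n powr s"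
  by (simp add: powr_times_real)

lemma closed_segment_of_real_real:
  assumes "z \<in> closed_segment (of_real a) (of_real b :: complex)" "a \<le> b"
  obtains t where "z = of_real t" "a \<le> t" "t \<le> b"
proof -
  have "z \<in> of_real ` closed_segment a b"
    using assms(1) by (simp add: closed_segment_of_real)
  then show ?thesis using assms(2) that by (auto simp: closed_segment_eq_real_ivl)
qed

lemma norm_powr_diff_le:
  fixes s :: complex
  assumes "0 < a" "a \<le> x" "Re s > 0"
  shows "norm (of_real x powr (-s) - of_real a powr (-s)) \<le> norm s * a powr (-Re s - 1) * (x - a)"
proof -
  have "norm ((of_real x :: complex) powr (-s) - of_real a powr (-s)) \<le>
      (norm s * a powr (-Re s - 1)) * norm (of_real x - of_real a :: complex)"
  proof (rule field_differentiable_bound[where S = "closed_segment (of_real a) (of_real x)"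
        and f' = "\<lambda>z. -s * z powr (-s - 1)"])
    fix z :: complex assume "z \<in> closed_segment (of_real a) (of_real x)"
    then obtain t where t: "z = of_real t" "a \<le> t" "t \<le> x"
      using assms by (elim closed_segment_of_real_real) auto
    then have "z \<notin> \<real>\<^sub>\<le>\<^sub>0" using assms by auto
    then show "((\<lambda>z. z powr (-s)) has_field_derivative -s * z powr (-s - 1))
        (at z within closed_segment (of_real a) (of_real x))"
      by (intro has_field_derivative_at_within[OF has_field_derivative_powr])
    have "t powr (-Re s - 1) \<le> a powr (-Re s - 1)"
      using t assms by (intro powr_mono2') auto
    then show "norm (-s * z powr (-s - 1)) \<le> norm s * a powr (-Re s - 1)"
      using t assms by (simp add: norm_mult norm_powr_real_powr mult_left_mono)
  qed auto
  also have "norm (of_real x - of_real a :: complex) = x - a"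
    using assms by (metis norm_of_real of_real_diff abs_of_nonneg diff_ge_0_iff_ge)
  finally show ?thesis .
qed

lemma norm_zeta_term_le:
  assumes "Re s > 0"
  shows "norm (zeta_term n s) \<le> norm (s - 1) * norm s * real (Suc n) powr (-Re s - 1)"
proof -
  define a where "a = real (Suc n)"
  have a: "a > 0" by (simp add: a_def)
  \<comment> \<open>The linear term makes the derivative of \<open>h\<close> vanish at the left end
    \<open>a\<close>, while the increment over \<open>[a, a + 1]\<close> is exactly
    \<open>zeta_term n s\<close>. Bounding that derivative by \<open>norm_powr_diff_le\<close> gains
    a factor of order \<open>1 / a\<close>, enough for summability when
    \<open>Re s > 0\<close>.\<close>
  define h where "h = (\<lambda>z. z powr (1 - s) + (s - 1) * of_real a powr (-s) * z)"
  have "norm (h (of_real (a + 1)) - h (of_real a)) \<le>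
      (norm (s - 1) * norm s * a powr (-Re s - 1)) * norm (of_real (a + 1) - of_real a :: complex)"
  proof (rule field_differentiable_bound[where S = "closed_segment (of_real a) (of_real (a + 1))"
        and f' = "\<lambda>z. (1 - s) * z powr (1 - s - 1) + (s - 1) * of_real a powr (-s)"])
    fix z :: complex assume "z \<in> closed_segment (of_real a) (of_real (a + 1))"
    then obtain t where t: "z = of_real t" "a \<le> t" "t \<le> a + 1"
      by (elim closed_segment_of_real_real) auto
    then have "z \<notin> \<real>\<^sub>\<le>\<^sub>0" using a by auto
    then have "((\<lambda>z. z powr (1 - s)) has_field_derivative (1 - s) * z powr (1 - s - 1)) (at z)"
      by (rule has_field_derivative_powr)
    then have "(h has_field_derivative (1 - s) * z powr (1 - s - 1) + (s - 1) * of_real a powr (-s)) (at z)"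
      unfolding h_def by (rule DERIV_cong[OF DERIV_add[OF _ DERIV_cmult[OF DERIV_ident]]]) simp
    then show "(h has_field_derivative (1 - s) * z powr (1 - s - 1) + (s - 1) * of_real a powr (-s))
        (at z within closed_segment (of_real a) (of_real (a + 1)))"
      by (rule has_field_derivative_at_within)
    have "(1 - s) * z powr (1 - s - 1) + (s - 1) * of_real a powr (-s) =
        (1 - s) * (of_real t powr (-s) - of_real a powr (-s))"
      by (simp add: t algebra_simps)
    also have "norm \<dots> \<le> norm (s - 1) * (norm s * a powr (-Re s - 1) * (t - a))"
      unfolding norm_mult using norm_powr_diff_le[OF a t(2) assms]
      by (intro mult_mono) (auto simp: norm_minus_commute)
    also have "\<dots> \<le> norm (s - 1) * (norm s * a powr (-Re s - 1) * 1)"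
      using t by (intro mult_left_mono) auto
    finally show "norm ((1 - s) * z powr (1 - s - 1) + (s - 1) * of_real a powr (-s)) \<le>
        norm (s - 1) * norm s * a powr (-Re s - 1)" by (simp add: mult.assoc)
  qed auto
  moreover have "h (of_real (a + 1)) - h (of_real a) = zeta_term n s"
    by (simp add: h_def zeta_term_def a_def algebra_simps)
  ultimately show ?thesis by (simp add: a_def)
qed

lemma summable_Suc_powr:
  assumes "c < -1"
  shows "summable (\<lambda>n. real (Suc n) powr c)"
  using summable_Suc_iff[of "\<lambda>n. real n powr c"] summable_real_powr_iff[of c] assms by simp

lemma zeta_term_has_deriv:
  "(zeta_term n has_field_derivative deriv (zeta_term n) s) (at s)"
proof -
  have "zeta_term n holomorphic_on UNIV"
    unfolding zeta_term_def[abs_def] by (intro holomorphic_intros)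
  then show ?thesis by (rule holomorphic_derivI) auto
qed

lemma zeta_reg_sums_holomorphic:
  shows zeta_reg_sums: "\<And>s. Re s > 0 \<Longrightarrow> (\<lambda>n. zeta_term n s) sums (zeta_reg s - 1)"
    and zeta_reg_holomorphic: "zeta_reg holomorphic_on {s. Re s > 0}"
proof -
  have "\<exists>g g'. \<forall>x\<in>{s. Re s > 0}. ((\<lambda>n. zeta_term n x) sums g x) \<and>
      ((\<lambda>n. deriv (zeta_term n) x) sums g' x) \<and> (g has_field_derivative g' x) (at x)"
  proof (rule series_and_derivative_comparison_complex)
    show "open {s. Re s > 0}" by (simp add: open_halfspace_Re_gt)
    fix x assume "x \<in> {s. Re s > 0}"
    then have x: "Re x > 0" by simp
    \<comment> \<open>On the disc of radius \<open>d\<close> the real part stays above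
      \<open>d\<close>, so one majorant with exponent \<open>-d - 1\<close> serves all its points;
      \<open>C\<close> bounds the factor \<open>norm (y - 1) * norm y\<close> there.\<close>
    define d where "d = Re x / 2"
    define C where "C = (norm x + d + 1) * (norm x + d)"
    define h where "h = (\<lambda>n. complex_of_real (C * real (Suc n) powr (-d - 1)))"
    have C: "C \<ge> 0" using x by (simp add: C_def d_def)
    have "summable (\<lambda>n. C * real (Suc n) powr (-d - 1))"
      using x by (intro summable_mult summable_Suc_powr) (simp add: d_def)
    then have "summable h" unfolding h_def by (rule summable_of_real)
    moreover have "norm (zeta_term n y) \<le> norm (h n)" if "y \<in> ball x d" for n y
    proof -
      have xy: "norm (x - y) < d" using that by (simp add: dist_norm)
      then have "\<bar>Re (x - y)\<bar> < d" using abs_Re_le_cmod[of "x - y"] by linarith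
      then have "Re x - Re y < d" by simp
      then have ry: "Re y > d" by (simp add: d_def)
      then have ry0: "Re y > 0" using x by (simp add: d_def)
      have ny: "norm y \<le> norm x + d" using xy norm_triangle_ineq3[of x y] by linarith
      have "norm (zeta_term n y) \<le> norm (y - 1) * norm y * real (Suc n) powr (-Re y - 1)"
        by (rule norm_zeta_term_le[OF ry0])
      also have "\<dots> \<le> C * real (Suc n) powr (-d - 1)"
        unfolding C_def using ny ry norm_triangle_ineq4[of y 1]
        using order_trans[OF norm_ge_zero ny]
        by (intro mult_mono powr_mono mult_nonneg_nonneg) auto
      finally show ?thesis using C by (simp add: h_def abs_mult del: of_real_mult)
    qed
    moreover have "range h \<subseteq> \<real>\<^sub>\<ge>\<^sub>0" using C by (auto simp: h_def)
    ultimately show "\<exists>d h. 0 < d \<and> summable h \<and> range h \<subseteq> \<real>\<^sub>\<ge>\<^sub>0 \<and>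
        (\<forall>\<^sub>F n in sequentially. \<forall>y\<in>ball x d \<inter> {s. Re s > 0}. norm (zeta_term n y) \<le> cmod (h n))"
      using x by (intro exI[of _ d] exI[of _ h]) (auto simp: d_def)
  qed (rule zeta_term_has_deriv)
  then obtain g g' where g: "\<And>x. Re x > 0 \<Longrightarrow> (\<lambda>n. zeta_term n x) sums g x"
      "\<And>x. Re x > 0 \<Longrightarrow> (g has_field_derivative g' x) (at x)" by auto
  then have eq: "g x = zeta_reg x - 1" if "Re x > 0" for x
    using that by (auto simp: zeta_reg_def sums_iff)
  show "(\<lambda>n. zeta_term n s) sums (zeta_reg s - 1)" if "Re s > 0" for s
    using g(1)[OF that] eq[OF that] by simp
  have "(\<lambda>s. g s + 1) holomorphic_on {s. Re s > 0}"
    using g(2) by (intro holomorphic_intros)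
      (auto simp: holomorphic_on_def field_differentiable_def intro: has_field_derivative_at_within)
  then show "zeta_reg holomorphic_on {s. Re s > 0}"
    by (rule holomorphic_transform) (simp add: eq)
qed

section \<open>Dirichlet series in the half plane of absolute convergence\<close>

lemma summable_dirichlet:
  assumes "\<And>n. norm (a n) \<le> C" "Re s > 1"
  shows "summable (\<lambda>n. norm (a (Suc n) * of_nat (Suc n) powr (-s)))"
proof (rule summable_comparison_test')
  show "summable (\<lambda>n. C * real (Suc n) powr (-Re s))"
    using assms(2) by (intro summable_mult summable_Suc_powr) auto
  show "norm (norm (a (Suc n) * of_nat (Suc n) powr (-s))) \<le> C * real (Suc n) powr (-Re s)" for n
    using assms(1)[of "Suc n"] unfolding norm_mult norm_nat_powr by (simp add: mult_right_mono)
qed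

abbreviation zeta :: "complex \<Rightarrow> complex" where "zeta \<equiv> dirichlet_series (\<lambda>_. 1)"

text \<open>For \<open>Re s > 1\<close> the two parts of \<open>zeta_term\<close> can be summed
  separately; the differences of \<open>x powr (1 - s)\<close> telescope to -1, which cancels the
  leading 1 of \<open>zeta_reg\<close>.\<close>

lemma zeta_reg_eq_zeta:
  assumes "Re s > 1"
  shows "zeta_reg s = (s - 1) * zeta s"
proof -
  have "summable (\<lambda>n. norm (1 * of_nat (Suc n) powr (-s) :: complex))"
    by (rule summable_dirichlet[where a = "\<lambda>_. 1" and C = 1]) (use assms in auto)
  then have 1: "(\<lambda>n. (s - 1) * of_nat (Suc n) powr (-s)) sums ((s - 1) * zeta s)"
    unfolding dirichlet_series_def by (intro sums_mult summable_sums) (auto dest: summable_norm_cancel)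
  have "(\<lambda>n. of_nat (Suc n) powr (1 - s) :: complex) \<longlonglongrightarrow> 0"
  proof (rule tendsto_norm_zero_cancel)
    show "(\<lambda>n. norm (of_nat (Suc n) powr (1 - s) :: complex)) \<longlonglongrightarrow> 0"
      unfolding norm_nat_powr using assms by real_asymp
  qed
  from telescope_sums[OF this]
  have 2: "(\<lambda>n. of_nat (Suc (Suc n)) powr (1 - s) - of_nat (Suc n) powr (1 - s) :: complex) sums (-1)"
    by simp
  have "(\<lambda>n. zeta_term n s) sums ((s - 1) * zeta s + -1)"
    using sums_add[OF 1 2] by (simp add: zeta_term_def algebra_simps)
  with zeta_reg_sums[of s] assms have "zeta_reg s - 1 = (s - 1) * zeta s + -1" by (intro sums_unique2) auto
  then show ?thesis by simp
qed

lemma zeta_reg_1: "zeta_reg 1 = 1"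
  by (simp add: zeta_reg_def zeta_term_def del: of_nat_Suc)

lemma dirichlet_series_tendsto:
  assumes "summable (\<lambda>n. norm (a (Suc n) * of_nat (Suc n) powr (-s)))"
  shows "(\<lambda>N. \<Sum>n=1..N. a n * of_nat n powr (-s)) \<longlonglongrightarrow> dirichlet_series a s"
proof -
  have "(\<lambda>N. \<Sum>n<N. a (Suc n) * of_nat (Suc n) powr (-s)) \<longlonglongrightarrow> dirichlet_series a s"
    unfolding dirichlet_series_def using summable_norm_cancel[OF assms] by (rule summable_LIMSEQ)
  then show ?thesis by (simp add: sum.atLeast1_atMost_eq del: of_nat_Suc)
qed

text \<open>The partial sums of the product have the shape treated in
  \<open>sum_div_tendsto\<close>, so no double series is rearranged. \<open>conv\<close> is
  restricted to \<open>n > 0\<close> because 0 has infinitely many divisors.\<close>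

lemma dirichlet_series_mult:
  assumes a: "summable (\<lambda>n. norm (a (Suc n) * of_nat (Suc n) powr (-s)))"
    and b: "summable (\<lambda>n. norm (b (Suc n) * of_nat (Suc n) powr (-s)))"
    and c: "summable (\<lambda>n. norm (c (Suc n) * of_nat (Suc n) powr (-s)))"
    and conv: "\<And>n. n > 0 \<Longrightarrow> c n = (\<Sum>d | d dvd n. a d * b (n div d))"
  shows "dirichlet_series c s = dirichlet_series a s * dirichlet_series b s"
proof -
  have "(\<lambda>N. \<Sum>d=1..N. (a d * of_nat d powr (-s)) * (\<Sum>k=1..N div d. b k * of_nat k powr (-s)))
      \<longlonglongrightarrow> (\<Sum>n. a (Suc n) * of_nat (Suc n) powr (-s)) * dirichlet_series b s"
    by (rule sum_div_tendsto[OF a dirichlet_series_tendsto[OF b]])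
  moreover have "(\<Sum>n=1..N. c n * of_nat n powr (-s)) =
      (\<Sum>d=1..N. (a d * of_nat d powr (-s)) * (\<Sum>k=1..N div d. b k * of_nat k powr (-s)))" for N
  proof -
    have "(\<Sum>n=1..N. c n * of_nat n powr (-s)) =
        (\<Sum>n=1..N. \<Sum>d | d dvd n. (a d * of_nat d powr (-s)) * (b (n div d) * of_nat (n div d) powr (-s)))"
    proof (intro sum.cong refl)
      fix n assume "n \<in> {1..N}"
      then have "c n * of_nat n powr (-s) = (\<Sum>d | d dvd n. a d * b (n div d) * of_nat n powr (-s))"
        by (simp add: conv sum_distrib_right)
      also have "\<dots> = (\<Sum>d | d dvd n. (a d * of_nat d powr (-s)) * (b (n div d) * of_nat (n div d) powr (-s)))"
      proof (intro sum.cong refl)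
        fix d assume "d \<in> {d. d dvd n}"
        then have "n = d * (n div d)" by simp
        then have "(of_nat n :: complex) powr (-s) = of_nat d powr (-s) * of_nat (n div d) powr (-s)"
          by (metis nat_mult_powr)
        then show "a d * b (n div d) * of_nat n powr (-s) =
            (a d * of_nat d powr (-s)) * (b (n div d) * of_nat (n div d) powr (-s))" by simp
      qed
      finally show "c n * of_nat n powr (-s) = \<dots>" .
    qed
    also have "\<dots> = (\<Sum>d=1..N. \<Sum>k=1..N div d. (a d * of_nat d powr (-s)) * (b k * of_nat k powr (-s)))"
      by (rule sum_sum_divisors)
    finally show ?thesis by (simp add: sum_distrib_left)
  qed
  ultimately have "(\<lambda>N. \<Sum>n=1..N. c n * of_nat n powr (-s)) \<longlonglongrightarrow>
      (\<Sum>n. a (Suc n) * of_nat (Suc n) powr (-s)) * dirichlet_series b s" by simp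
  from LIMSEQ_unique[OF dirichlet_series_tendsto[OF c] this] show ?thesis
    by (simp add: dirichlet_series_def)
qed

text \<open>The convolution of \<open>mob\<close> with the constant 1 is the unit. Besides the
  inverse of zeta this yields its non-vanishing to the right of the line.\<close>

lemma zeta_mob:
  assumes "Re s > 1"
  shows "zeta s * dirichlet_series (\<lambda>n. of_int (mob n)) s = 1"
proof -
  have "dirichlet_series (\<lambda>n. if n = 1 then 1 else 0) s =
      dirichlet_series (\<lambda>n. of_int (mob n)) s * zeta s"
  proof (rule dirichlet_series_mult)
    fix n :: nat assume "n > 0"
    then show "(if n = 1 then 1 else 0 :: complex) = (\<Sum>d | d dvd n. of_int (mob d) * 1)"
      using sum_mob[of n] by (simp flip: of_int_sum)
  qed (rule summable_dirichlet[where C = 1, OF _ assms]; simp add: norm_mob_le del: norm_of_int)+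
  moreover have "dirichlet_series (\<lambda>n. if n = 1 then 1 else 0) s = (\<Sum>n\<in>{0}. 1)"
    unfolding dirichlet_series_def by (subst suminf_finite[of "{0}"]) auto
  ultimately show ?thesis by (simp add: mult.commute)
qed

lemma summable_ln_dirichlet:
  assumes "\<And>n. n > 0 \<Longrightarrow> norm (a n) \<le> ln (real n)" "Re s > 1"
  shows "summable (\<lambda>n. norm (a (Suc n) * of_nat (Suc n) powr (-s)))"
proof -
  \<comment> \<open>Half of the surplus over 1 absorbs the logarithm, as
    \<open>ln n \<le> n powr e / e\<close>; the other half keeps the series convergent.\<close>
  define e where "e = (Re s - 1) / 2"
  have e: "e > 0" using assms by (simp add: e_def)
  show ?thesis
  proof (rule summable_comparison_test')
    show "summable (\<lambda>n. (1 / e) * real (Suc n) powr (e - Re s))"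
      using assms(2) by (intro summable_mult summable_Suc_powr) (simp add: e_def field_simps)
    fix n
    have "norm (a (Suc n)) \<le> ln (real (Suc n))" by (rule assms(1)) simp
    also have "\<dots> \<le> real (Suc n) powr e / e" using e by (intro ln_powr_bound) auto
    finally show "norm (norm (a (Suc n) * of_nat (Suc n) powr (-s))) \<le> (1 / e) * real (Suc n) powr (e - Re s)"
      unfolding norm_mult norm_nat_powr
      by (simp add: powr_diff powr_minus field_simps)
  qed
qed

lemma zeta_has_deriv:
  assumes "Re s > 1"
  shows "(zeta has_field_derivative - dirichlet_series (\<lambda>n. of_real (ln (real n))) s) (at s)"
proof -
  have "\<exists>g g'. \<forall>x\<in>{s. Re s > 1}. ((\<lambda>n. of_nat (Suc n) powr (-x)) sums g x) \<and>
      ((\<lambda>n. - (of_real (ln (real (Suc n))) * of_nat (Suc n) powr (-x))) sums g' x) \<and>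
      (g has_field_derivative g' x) (at x)"
  proof (rule series_and_derivative_comparison_complex)
    show "open {s. Re s > 1}" by (simp add: open_halfspace_Re_gt)
    show "((\<lambda>x. of_nat (Suc n) powr (-x)) has_field_derivative
        - (of_real (ln (real (Suc n))) * of_nat (Suc n) powr (-x))) (at x)" for n and x :: complex
    proof -
      have "((\<lambda>x. of_nat (Suc n) powr (-x)) has_field_derivative
          Ln (of_nat (Suc n)) * of_nat (Suc n) powr (-x) * (-1)) (at x)"
        by (rule DERIV_chain2[OF has_field_derivative_powr_right DERIV_minus[OF DERIV_ident]])
           (simp del: of_nat_Suc)
      then show ?thesis by (simp add: Ln_of_nat del: of_nat_Suc)
    qed
    fix x assume "x \<in> {s. Re s > 1}"
    then have x: "Re x > 1" by simp
    define d where "d = (Re x - 1) / 2"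
    define h where "h = (\<lambda>n. complex_of_real (real (Suc n) powr (-d - 1)))"
    have "summable h" unfolding h_def
      using x by (intro summable_of_real summable_Suc_powr) (simp add: d_def)
    moreover have "norm (of_nat (Suc n) powr (-y) :: complex) \<le> norm (h n)" if "y \<in> ball x d" for n y
    proof -
      have "\<bar>Re (x - y)\<bar> < d" using that abs_Re_le_cmod[of "x - y"] by (simp add: dist_norm)
      then have "Re x - Re y < d" by simp
      then have "-Re y \<le> -d - 1" by (simp add: d_def field_simps)
      then show ?thesis unfolding norm_nat_powr by (simp add: h_def powr_mono)
    qed
    moreover have "range h \<subseteq> \<real>\<^sub>\<ge>\<^sub>0" by (auto simp: h_def)
    ultimately show "\<exists>d h. 0 < d \<and> summable h \<and> range h \<subseteq> \<real>\<^sub>\<ge>\<^sub>0 \<and>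
        (\<forall>\<^sub>F n in sequentially. \<forall>y\<in>ball x d \<inter> {s. Re s > 1}.
           norm (of_nat (Suc n) powr (-y) :: complex) \<le> cmod (h n))"
      using x by (intro exI[of _ d] exI[of _ h]) (auto simp: d_def)
  qed
  then obtain g g' where g: "\<And>x. Re x > 1 \<Longrightarrow> (\<lambda>n. of_nat (Suc n) powr (-x)) sums g x"
      "\<And>x. Re x > 1 \<Longrightarrow> (\<lambda>n. - (of_real (ln (real (Suc n))) * of_nat (Suc n) powr (-x))) sums g' x"
      "\<And>x. Re x > 1 \<Longrightarrow> (g has_field_derivative g' x) (at x)" by auto
  have eq: "g x = zeta x" if "Re x > 1" for x
    using g(1)[OF that] by (simp add: dirichlet_series_def sums_iff)
  have "g' s = - dirichlet_series (\<lambda>n. of_real (ln (real n))) s"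
    unfolding dirichlet_series_def using sums_minus[OF g(2)[OF assms]] by (simp add: sums_iff)
  with g(3)[OF assms] have "(g has_field_derivative - dirichlet_series (\<lambda>n. of_real (ln (real n))) s) (at s)"
    by simp
  then show ?thesis
    by (rule has_field_derivative_transform_within_open[where S = "{s. Re s > 1}"])
       (use assms eq in \<open>auto simp: open_halfspace_Re_gt\<close>)
qed

section \<open>The logarithmic derivative of zeta and the absence of zeros on the line\<close>

abbreviation mangoldt_series :: "complex \<Rightarrow> complex" where
  "mangoldt_series \<equiv> dirichlet_series mangoldt"

lemma mangoldt_le_ln: "n > 0 \<Longrightarrow> norm (mangoldt n :: complex) \<le> ln (real n)"
  using mangoldt_le[of n] by simp

lemma zeta_mangoldt:
  assumes "Re s > 1"
  shows "dirichlet_series (\<lambda>n. of_real (ln (real n))) s = mangoldt_series s * zeta s"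
proof (rule dirichlet_series_mult)
  show "summable (\<lambda>n. norm (of_real (ln (real (Suc n))) * of_nat (Suc n) powr (-s) :: complex))"
    by (rule summable_ln_dirichlet[where a = "\<lambda>n. of_real (ln (real n))", OF _ assms]) auto
  show "summable (\<lambda>n. norm (mangoldt (Suc n) * of_nat (Suc n) powr (-s) :: complex))"
    by (rule summable_ln_dirichlet[OF mangoldt_le_ln assms])
  show "summable (\<lambda>n. norm (1 * of_nat (Suc n) powr (-s) :: complex))"
    by (rule summable_dirichlet[where a = "\<lambda>_. 1" and C = 1]) (use assms in auto)
qed (simp add: mangoldt_sum)

text \<open>The limit is the order of vanishing of \<open>f\<close> at \<open>s0\<close>: writing
  \<open>f w = (w - s0) ^ k * g w\<close> with \<open>g s0 \<noteq> 0\<close>, the quotient becomes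
  \<open>k + x * g' / g\<close>. The point \<open>z\<close> with \<open>f z \<noteq> 0\<close>
  excludes the identically vanishing function, which has no finite order.\<close>

lemma tendsto_log_deriv:
  assumes f: "f holomorphic_on S" and S: "open S" "connected S" "s0 \<in> S"
    and nz: "z \<in> S" "f z \<noteq> 0"
  obtains k :: nat where "k = 0 \<longleftrightarrow> f s0 \<noteq> 0"
    "((\<lambda>x. of_real x * deriv f (s0 + of_real x) / f (s0 + of_real x)) \<longlongrightarrow> of_nat k) (at_right 0)"
proof -
  have lim: "((\<lambda>x. g (s0 + of_real x)) \<longlongrightarrow> g s0) (at_right 0)"
    if "g holomorphic_on B" "open B" "s0 \<in> B" for B and g :: "complex \<Rightarrow> complex"
  proof -
    have "isCont g s0"
      using that by (meson continuous_on_eq_continuous_at holomorphic_on_imp_continuous_on)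
    then have "(g \<longlongrightarrow> g (s0 + of_real 0)) (nhds (s0 + of_real 0))"
      by (simp add: isCont_def tendsto_nhds_iff)
    moreover have "((\<lambda>x. s0 + of_real x) \<longlongrightarrow> s0 + of_real 0) (at_right 0)"
      by (intro tendsto_intros)
    ultimately show ?thesis by (auto dest: filterlim_compose)
  qed
  have lim0: "((\<lambda>x. complex_of_real x) \<longlongrightarrow> of_real 0) (at_right 0)"
    by (intro tendsto_intros)
  show ?thesis
  proof (cases "f s0 = 0")
    case False
    have "((\<lambda>x. of_real x * deriv f (s0 + of_real x) / f (s0 + of_real x)) \<longlongrightarrow> of_real 0 * deriv f s0 / f s0) (at_right 0)"
      by (intro tendsto_intros lim0 lim[OF f S(1,3)] lim[OF holomorphic_deriv[OF f S(1)] S(1,3)] False)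
    then show ?thesis using that[of 0] False by simp
  next
    case True
    then have nc: "\<not> f constant_on S" using S(3) nz by (metis constant_on_def)
    obtain g r n where *: "0 < n" "0 < r" "ball s0 r \<subseteq> S" "g holomorphic_on ball s0 r"
      "\<And>w. w \<in> ball s0 r \<Longrightarrow> f w = (w - s0) ^ n * g w"
      "\<And>w. w \<in> ball s0 r \<Longrightarrow> g w \<noteq> 0"
      by (rule holomorphic_factor_zero_nonconstant[OF f S True nc]) blast
    have "((\<lambda>x. of_nat n + of_real x * deriv g (s0 + of_real x) / g (s0 + of_real x))
        \<longlongrightarrow> of_nat n + of_real 0 * deriv g s0 / g s0) (at_right 0)"
      using *(2) *(6)[of s0]
      by (intro tendsto_intros lim0 lim[of _ "ball s0 r"] *(4) holomorphic_deriv[OF *(4)]) auto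
    moreover have "\<forall>\<^sub>F x in at_right 0. of_nat n + of_real x * deriv g (s0 + of_real x) / g (s0 + of_real x)
        = of_real x * deriv f (s0 + of_real x) / f (s0 + of_real x)"
      unfolding eventually_at_right_field
    proof (intro exI[of _ r] conjI allI impI)
      fix x :: real assume x: "0 < x" "x < r"
      define w where "w = s0 + of_real x"
      have w: "w \<in> ball s0 r" using x by (simp add: w_def dist_norm)
      have "(g has_field_derivative deriv g w) (at w)"
        using *(4) w by (intro holomorphic_derivI) auto
      then have "((\<lambda>w. (w - s0) ^ n * g w) has_field_derivative
          (w - s0) ^ n * deriv g w + of_nat n * (w - s0) ^ (n - 1) * g w) (at w)"
        by (auto intro!: derivative_eq_intros)
      then have "(f has_field_derivative
          (w - s0) ^ n * deriv g w + of_nat n * (w - s0) ^ (n - 1) * g w) (at w)"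
        by (rule has_field_derivative_transform_within_open[where S = "ball s0 r"]) (use w *(5) in auto)
      then have d: "deriv f w = (w - s0) ^ n * deriv g w + of_nat n * (w - s0) ^ (n - 1) * g w"
        by (rule DERIV_imp_deriv)
      have xn: "complex_of_real x ^ n = of_real x * of_real x ^ (n - 1)"
        using *(1) by (metis power_eq_if less_numeral_extra(3))
      have ws: "w - s0 = of_real x" by (simp add: w_def)
      have "of_nat n + of_real x * deriv g w / g w = of_real x * deriv f w / f w"
        unfolding d *(5)[OF w] ws xn using *(6)[OF w] x by (simp add: field_simps)
      then show "of_nat n + of_real x * deriv g (s0 + of_real x) / g (s0 + of_real x)
        = of_real x * deriv f (s0 + of_real x) / f (s0 + of_real x)" by (simp add: w_def)
    qed (use * in auto)
    ultimately have "((\<lambda>x. of_real x * deriv f (s0 + of_real x) / f (s0 + of_real x))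
        \<longlongrightarrow> of_nat n + of_real 0 * deriv g s0 / g s0) (at_right 0)"
      by (rule Lim_transform_eventually)
    then show ?thesis using that[of n] True *(1) by simp
  qed
qed

lemma mangoldt_series_eq:
  assumes "Re s > 1"
  shows "mangoldt_series s = 1 / (s - 1) - deriv zeta_reg s / zeta_reg s"
proof -
  have nz: "zeta s \<noteq> 0" using zeta_mob[OF assms] by auto
  have s1: "s \<noteq> 1" using assms by auto
  have "((\<lambda>s. (s - 1) * zeta s) has_field_derivative
      (s - 1) * (- dirichlet_series (\<lambda>n. of_real (ln (real n))) s) + 1 * zeta s) (at s)"
    by (rule DERIV_cong[OF DERIV_mult[OF DERIV_diff[OF DERIV_ident DERIV_const] zeta_has_deriv[OF assms]]]) simp
  then have "(zeta_reg has_field_derivative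
      (s - 1) * (- dirichlet_series (\<lambda>n. of_real (ln (real n))) s) + 1 * zeta s) (at s)"
    by (rule has_field_derivative_transform_within_open[where S = "{s. Re s > 1}"])
       (use assms zeta_reg_eq_zeta in \<open>auto simp: open_halfspace_Re_gt\<close>)
  then have "deriv zeta_reg s = (s - 1) * (- (mangoldt_series s * zeta s)) + zeta s"
    unfolding zeta_mangoldt[OF assms] by (auto dest: DERIV_imp_deriv)
  moreover have "s - 1 \<noteq> 0" using s1 by simp
  ultimately have "deriv zeta_reg s / zeta_reg s = - mangoldt_series s + 1 / (s - 1)"
    unfolding zeta_reg_eq_zeta[OF assms] using nz by (simp add: diff_divide_distrib)
  then show ?thesis by simp
qed

lemma Re_nat_powr:
  "Re (of_nat (Suc n) powr (- (of_real \<sigma> + \<i> * of_real t))) = real (Suc n) powr (-\<sigma>) * cos (t * ln (real (Suc n)))"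
proof -
  have "(of_nat (Suc n) :: complex) powr (- (of_real \<sigma> + \<i> * of_real t)) =
      exp (of_real (-\<sigma> * ln (real (Suc n))) + \<i> * of_real (- (t * ln (real (Suc n)))))"
    by (simp add: powr_def Ln_of_nat algebra_simps del: of_nat_Suc)
  then show ?thesis
    by (simp add: Re_exp powr_def del: of_nat_Suc)
qed

text \<open>Termwise \<open>3 + 4 * cos x + cos (2 * x) = 2 * (1 + cos x)^2\<close>, and the von
  Mangoldt coefficients are non-negative.\<close>

lemma mangoldt_series_341:
  assumes "\<sigma> > 1"
  shows "3 * Re (mangoldt_series (of_real \<sigma> + \<i> * of_real 0)) + 4 * Re (mangoldt_series (of_real \<sigma> + \<i> * of_real t))
     + Re (mangoldt_series (of_real \<sigma> + \<i> * of_real (2 * t))) \<ge> 0"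
proof -
  have sums: "(\<lambda>n. mangoldt (Suc n) * (real (Suc n) powr (-\<sigma>) * cos (u * ln (real (Suc n)))))
      sums Re (mangoldt_series (of_real \<sigma> + \<i> * of_real u))" for u
  proof -
    have "summable (\<lambda>n. norm (mangoldt (Suc n) * of_nat (Suc n) powr (-(of_real \<sigma> + \<i> * of_real u)) :: complex))"
      by (rule summable_ln_dirichlet[OF mangoldt_le_ln]) (use assms in auto)
    then have "(\<lambda>n. mangoldt (Suc n) * of_nat (Suc n) powr (-(of_real \<sigma> + \<i> * of_real u)))
        sums mangoldt_series (of_real \<sigma> + \<i> * of_real u)"
      unfolding dirichlet_series_def by (intro summable_sums) (rule summable_norm_cancel)
    from sums_Re[OF this] show ?thesis
      by (simp only: times_complex.sel Re_mangoldt Im_mangoldt Re_nat_powr mult_zero_left diff_zero)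
  qed
  define h where "h = (\<lambda>u n. mangoldt (Suc n) * (real (Suc n) powr (-\<sigma>) * cos (u * ln (real (Suc n)))))"
  have sums': "(\<lambda>n. 3 * h 0 n + 4 * h t n + h (2 * t) n) sums (3 * Re (mangoldt_series (of_real \<sigma> + \<i> * of_real 0)) + 4 * Re (mangoldt_series (of_real \<sigma> + \<i> * of_real t))
     + Re (mangoldt_series (of_real \<sigma> + \<i> * of_real (2 * t))))"
    unfolding h_def by (intro sums_add sums_mult sums)
  show ?thesis
  proof (rule sums_le[OF _ sums_zero sums'])
    fix n
    define x where "x = t * ln (real (Suc n))"
    have c2: "cos ((2 * t) * ln (real (Suc n))) = 2 * (cos x)\<^sup>2 - 1"
      using cos_double_cos[of x] by (simp add: x_def mult.assoc)
    have "3 * h 0 n + 4 * h t n + h (2 * t) n =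
      mangoldt (Suc n) * real (Suc n) powr (-\<sigma>) * (2 * (1 + cos x)\<^sup>2)"
      unfolding h_def c2 x_def[symmetric] by (simp add: power2_eq_square algebra_simps del: of_nat_Suc)
    also have "\<dots> \<ge> 0" by (simp add: mangoldt_nonneg)
    finally show "0 \<le> 3 * h 0 n + 4 * h t n + h (2 * t) n" .
  qed
qed

text \<open>As \<open>x\<close> tends to 0 from the right, \<open>x * mangoldt_series\<close> at
  \<open>1 + x + \<i> * u\<close> tends to 1 at the pole \<open>u = 0\<close> and to minus the order
  of vanishing for other \<open>u\<close>. If \<open>k\<close> and \<open>j\<close> are the orders
  at \<open>t\<close> and \<open>2 * t\<close>, the preceding inequality gives
  \<open>3 - 4 * k - j \<ge> 0\<close>, hence \<open>k = 0\<close>.\<close>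

lemma zeta_reg_nonzero_line:
  shows "zeta_reg (1 + \<i> * of_real t) \<noteq> 0"
proof (cases "t = 0")
  case False
  define L where "L = (\<lambda>u x. of_real x * deriv zeta_reg (1 + \<i> * of_real u + of_real x) / zeta_reg (1 + \<i> * of_real u + of_real x))"
  have ex: "\<exists>k::nat. (k = 0 \<longleftrightarrow> zeta_reg (1 + \<i> * of_real u) \<noteq> 0) \<and> (L u \<longlongrightarrow> of_nat k) (at_right 0)" for u
  proof -
    have "convex {s. Re s > 0}" by (rule convex_halfspace_Re_gt)
    then have "connected {s. Re s > 0}" by (rule convex_connected)
    moreover have "1 + \<i> * of_real u \<in> {s. Re s > 0}" by simp
    moreover have "1 \<in> {s. Re s > 0}" "zeta_reg 1 \<noteq> 0" by (simp_all add: zeta_reg_1)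
    ultimately obtain k :: nat where "k = 0 \<longleftrightarrow> zeta_reg (1 + \<i> * of_real u) \<noteq> 0" "(L u \<longlongrightarrow> of_nat k) (at_right 0)"
      unfolding L_def by (rule tendsto_log_deriv[OF zeta_reg_holomorphic open_halfspace_Re_gt])
    then show ?thesis by (intro exI conjI)
  qed
  obtain k where k: "k = 0 \<longleftrightarrow> zeta_reg (1 + \<i> * of_real t) \<noteq> 0" "(L t \<longlongrightarrow> of_nat k) (at_right 0)"
    using ex[of t] by (elim exE conjE)
  obtain j where j: "(L (2 * t) \<longlongrightarrow> of_nat j) (at_right 0)"
    using ex[of "2 * t"] by (elim exE conjE)
  obtain i where "i = (0::nat) \<longleftrightarrow> zeta_reg (1 + \<i> * of_real 0) \<noteq> 0" "(L 0 \<longlongrightarrow> of_nat i) (at_right 0)"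
    using ex[of 0] by (elim exE conjE)
  then have i: "(L 0 \<longlongrightarrow> 0) (at_right 0)" by (simp add: zeta_reg_1)
  define M where "M = (\<lambda>u x. of_real x * mangoldt_series (of_real (1 + x) + \<i> * of_real u))"
  have M: "M u x = of_real x / (of_real x + \<i> * of_real u) - L u x" if "x > 0" for u x
  proof -
    have *: "of_real (1 + x) + \<i> * of_real u = 1 + \<i> * of_real u + of_real x"
      "1 + \<i> * of_real u + of_real x - 1 = of_real x + \<i> * of_real u" by simp_all
    have "Re (1 + \<i> * of_real u + of_real x) > 1" using that by simp
    from mangoldt_series_eq[OF this] show ?thesis
      unfolding M_def L_def * by (simp only: right_diff_distrib times_divide_eq_right mult_1_right)
  qed
  have lim0: "((\<lambda>x. complex_of_real x) \<longlongrightarrow> of_real 0) (at_right 0)"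
    by (intro tendsto_intros)
  have Mlim: "(M u \<longlongrightarrow> - of_nat k) (at_right 0)" if "u \<noteq> 0" "(L u \<longlongrightarrow> of_nat k) (at_right 0)" for u k
  proof -
    have "((\<lambda>x. of_real x / (of_real x + \<i> * of_real u) - L u x) \<longlongrightarrow>
        of_real 0 / (of_real 0 + \<i> * of_real u) - of_nat k) (at_right 0)"
      using that by (intro tendsto_intros lim0) auto
    moreover have "\<forall>\<^sub>F x in at_right 0. of_real x / (of_real x + \<i> * of_real u) - L u x = M u x"
      using M by (auto simp: eventually_at_right_field intro: exI[of _ 1])
    ultimately show ?thesis using Lim_transform_eventually by fastforce
  qed
  have M0: "(M 0 \<longlongrightarrow> 1) (at_right 0)"
  proof -
    have "((\<lambda>x. 1 - L 0 x) \<longlongrightarrow> 1 - 0) (at_right 0)" by (intro tendsto_intros i)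
    moreover have "\<forall>\<^sub>F x in at_right 0. 1 - L 0 x = M 0 x"
      using M[of _ 0] by (auto simp: eventually_at_right_field intro: exI[of _ 1])
    ultimately show ?thesis using Lim_transform_eventually by fastforce
  qed
  have "((\<lambda>x. 3 * Re (M 0 x) + 4 * Re (M t x) + Re (M (2 * t) x)) \<longlongrightarrow>
      3 * Re 1 + 4 * Re (- of_nat k) + Re (- of_nat j)) (at_right 0)"
    using False by (intro tendsto_intros M0 Mlim k j) auto
  moreover have "\<forall>\<^sub>F x in at_right 0. 3 * Re (M 0 x) + 4 * Re (M t x) + Re (M (2 * t) x) \<ge> 0"
    unfolding eventually_at_right_field
  proof (intro exI[of _ 1] conjI allI impI)
    fix x :: real assume "0 < x"
    have "3 * Re (M 0 x) + 4 * Re (M t x) + Re (M (2 * t) x) = x *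
       (3 * Re (mangoldt_series (of_real (1 + x) + \<i> * of_real 0))
        + 4 * Re (mangoldt_series (of_real (1 + x) + \<i> * of_real t))
        + Re (mangoldt_series (of_real (1 + x) + \<i> * of_real (2 * t))))"
      unfolding M_def Re_complex_of_real times_complex.sel by (simp add: algebra_simps)
    also have "\<dots> \<ge> 0" using mangoldt_series_341[of "1 + x" t] \<open>0 < x\<close> by (intro mult_nonneg_nonneg) auto
    finally show "0 \<le> 3 * Re (M 0 x) + 4 * Re (M t x) + Re (M (2 * t) x)" .
  qed auto
  ultimately have "3 * Re 1 + 4 * Re (- of_nat k) + Re (- of_nat j) \<ge> 0"
    by (intro tendsto_lowerbound[where F = "at_right (0::real)"]) auto
  then have "4 * real k \<le> 3" by simp
  then have "k = 0" by (cases k) auto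
  then show ?thesis using k by simp
qed (simp add: zeta_reg_1)

lemma zeta_reg_nonzero:
  assumes "Re s \<ge> 1"
  shows "zeta_reg s \<noteq> 0"
proof (cases "Re s = 1")
  case True
  then have "s = 1 + \<i> * of_real (Im s)" by (simp add: complex_eq_iff)
  then show ?thesis using zeta_reg_nonzero_line by metis
next
  case False
  then have "Re s > 1" using assms by simp
  then show ?thesis using zeta_mob[of s] zeta_reg_eq_zeta[of s] by auto
qed

section \<open>Newman's Tauberian theorem\<close>

lemma powr_mean_value:
  fixes a c :: real
  assumes "a > 0"
  obtains z where "a < z" "z < a + 1" "(a + 1) powr c - a powr c = c * z powr (c - 1)"
proof -
  have "\<exists>z>a. z < a + 1 \<and> (a + 1) powr c - a powr c = (a + 1 - a) * (c * z powr (c - 1))"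
    by (rule MVT2) (use assms in \<open>auto intro!: derivative_eq_intros\<close>)
  then show ?thesis using that by auto
qed

text \<open>Comparison with the integral of \<open>u powr (y - 1)\<close>. The integrand decreases
  for \<open>y < 1\<close> and does not decrease otherwise; in the second case the last summand is
  added separately and becomes the \<open>1 / real N\<close>. The bound is explicit in
  \<open>y\<close> because it is applied with \<open>y = - Re z\<close> arbitrarily close to
  0.\<close>

lemma sum_powr_le:
  assumes "y > 0" "N > 0"
  shows "(\<Sum>n=1..N. real n powr (y - 1)) \<le> real N powr y * (1 / y + 1 / real N)"
proof -
  have step: "\<exists>z. real N < z \<and> z < real (Suc N) \<and> z powr (y - 1) = real (Suc N) powr y / y - real N powr y / y"
    if N: "N > 0" for N
  proof -
    obtain z where "real N < z" "z < real N + 1" "(real N + 1) powr y - real N powr y = y * z powr (y - 1)"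
      by (rule powr_mean_value[of "real N" y]) (use N in auto)
    then show ?thesis
      using assms(1) by (intro exI[of _ z]) (simp add: add.commute flip: diff_divide_distrib)
  qed
  have "(\<Sum>n=1..N. real n powr (y - 1)) \<le> real N powr y / y + real N powr (y - 1)"
  proof (cases "y < 1")
    case True
    have "(\<Sum>n=1..N. real n powr (y - 1)) \<le> real N powr y / y" for N
    proof (induction N)
      case (Suc N)
      have "real (Suc N) powr (y - 1) \<le> real (Suc N) powr y / y - real N powr y / y"
      proof (cases "N = 0")
        case False
        with step[of N] show ?thesis using True by (metis diff_le_0_iff_le less_imp_le neq0_conv
          of_nat_0_le_iff order_le_less_trans powr_mono2')
      qed (use assms True in auto)
      with Suc show ?case by simp
    qed simp
    from this[of N] show ?thesis using powr_ge_zero[of "real N" "y - 1"] by linarith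
  next
    case False
    have "(\<Sum>n=1..N. real n powr (y - 1)) \<le> real N powr y / y + real N powr (y - 1)" for N
    proof (induction N)
      case (Suc N)
      have "real N powr (y - 1) \<le> real (Suc N) powr y / y - real N powr y / y"
      proof (cases "N = 0")
        case False
        with step[of N] show ?thesis using \<open>\<not> y < 1\<close> by (metis diff_ge_0_iff_ge less_imp_le neq0_conv
          not_less of_nat_0_le_iff powr_mono2)
      qed (use assms in auto)
      with Suc show ?case by simp
    qed simp
    then show ?thesis .
  qed
  also have "\<dots> = real N powr y * (1 / y + 1 / real N)"
    using assms by (simp add: powr_diff field_simps)
  finally show ?thesis .
qed

text \<open>The argument is shifted by 1, so that the sum of \<open>a n / n\<close> is the value at
  the origin, where the Cauchy kernel has its pole.\<close>

definition dirichlet_sum :: "(nat \<Rightarrow> complex) \<Rightarrow> nat \<Rightarrow> complex \<Rightarrow> complex" where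
  "dirichlet_sum a N z = (\<Sum>n=1..N. a n * of_nat n powr (-(1 + z)))"

lemma dirichlet_sum_0: "dirichlet_sum a N 0 = (\<Sum>n=1..N. a n / of_nat n)"
  unfolding dirichlet_sum_def by (intro sum.cong refl) (auto simp: powr_minus divide_inverse)

lemma dirichlet_sum_holomorphic: "dirichlet_sum a N holomorphic_on A"
  unfolding dirichlet_sum_def[abs_def] by (intro holomorphic_intros)

lemma norm_dirichlet_sum_le:
  assumes a: "\<And>n. norm (a n) \<le> 1" and z: "Re z < 0" and N: "N > 0"
  shows "norm (dirichlet_sum a N z) \<le> real N powr (-Re z) * (1 / (-Re z) + 1 / real N)"
proof -
  have "norm (dirichlet_sum a N z) \<le> (\<Sum>n=1..N. real n powr (-Re z - 1))"
    unfolding dirichlet_sum_def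
  proof (rule sum_norm_le)
    fix n assume "n \<in> {1..N}"
    then have "norm (of_nat n powr (-(1 + z)) :: complex) = real n powr (-Re z - 1)"
      by (subst norm_powr_real_powr) (auto intro: arg_cong[of _ _ "\<lambda>x. real n powr x"])
    then show "norm (a n * of_nat n powr (-(1 + z))) \<le> real n powr (-Re z - 1)"
      unfolding norm_mult using mult_right_mono[OF a[of n], of "real n powr (-Re z - 1)"] by simp
  qed
  also have "\<dots> \<le> real N powr (-Re z) * (1 / (-Re z) + 1 / real N)"
    by (rule sum_powr_le) (use z N in auto)
  finally show ?thesis .
qed

text \<open>By the mean value theorem the term of index \<open>n + 1\<close> is at most the decrease
  of \<open>u powr (-x) / x\<close> over \<open>[n, n + 1]\<close>, and these decreases telescope
  from \<open>N\<close> onwards.\<close>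

lemma norm_dirichlet_tail_le:
  assumes a: "\<And>n. norm (a n) \<le> 1" and z: "Re z > 0" and N: "N > 0"
  shows "norm (dirichlet_series a (1 + z) - dirichlet_sum a N z) \<le> real N powr (-Re z) / Re z"
proof -
  define t where "t = (\<lambda>n. a (Suc n) * of_nat (Suc n) powr (-(1 + z)))"
  define x where "x = Re z"
  have x: "x > 0" using z by (simp add: x_def)
  have t: "summable t"
    unfolding t_def by (rule summable_norm_cancel[OF summable_dirichlet[OF a]]) (use z in auto)
  have "dirichlet_sum a N z = (\<Sum>n<N. t n)"
    unfolding dirichlet_sum_def t_def by (simp add: sum.atLeast1_atMost_eq)
  then have "dirichlet_series a (1 + z) - dirichlet_sum a N z = (\<Sum>n. t (n + N))"
    using suminf_minus_initial_segment[OF t, of N] by (simp add: dirichlet_series_def t_def)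
  moreover have s: "(\<lambda>n. (real (n + N) powr (-x) - real (Suc n + N) powr (-x)) / x) sums ((real (0 + N) powr (-x) - 0) / x)"
    using x by (intro sums_divide telescope_sums') real_asymp
  ultimately have "norm (dirichlet_series a (1 + z) - dirichlet_sum a N z) = norm (\<Sum>n. t (n + N))" by simp
  also have "\<dots> \<le> (\<Sum>n. (real (n + N) powr (-x) - real (Suc n + N) powr (-x)) / x)"
  proof (rule norm_suminf_le)
    fix n
    obtain w where w: "real (n + N) < w" "w < real (n + N) + 1"
      "(real (n + N) + 1) powr (-x) - real (n + N) powr (-x) = -x * w powr (-x - 1)"
      using powr_mean_value[of "real (n + N)" "-x"] N by auto
    have "norm (of_nat (Suc (n + N)) powr (-(1 + z)) :: complex) = real (Suc (n + N)) powr (-x - 1)"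
      unfolding norm_nat_powr x_def by (rule arg_cong[of _ _ "\<lambda>y. real (Suc (n + N)) powr y"]) simp
    then have "norm (t (n + N)) \<le> real (Suc (n + N)) powr (-x - 1)"
      unfolding t_def norm_mult using mult_right_mono[OF a, of "real (Suc (n + N)) powr (-x - 1)"] by simp
    also have "\<dots> \<le> w powr (-x - 1)" using w x by (intro powr_mono2') auto
    also have "\<dots> = -((real (n + N) + 1) powr (-x) - real (n + N) powr (-x)) / x"
      unfolding w(3) using x by simp
    finally show "norm (t (n + N)) \<le> (real (n + N) powr (-x) - real (Suc n + N) powr (-x)) / x"
      by (simp add: add_ac)
  qed (rule sums_summable[OF s])
  also have "\<dots> = (real (0 + N) powr (-x) - 0) / x" by (rule sums_unique[OF s, symmetric])
  finally show ?thesis by (simp add: x_def)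
qed

text \<open>On the circle \<open>R^2 = z * cnj z\<close>, which turns \<open>R^2 + z^2\<close> into
  \<open>z * (cnj z + z)\<close>. The summand \<open>z^2 / R^2\<close> does not change the residue
  at 0 and makes the kernel vanish at \<open>\<i> * R\<close> and \<open>- \<i> * R\<close>, where
  the estimates from both sides blow up.\<close>

lemma newman_kernel:
  assumes "norm z = R" "R > 0"
  shows "(1 + z\<^sup>2 / (of_real R)\<^sup>2) / z = of_real (2 * Re z / R\<^sup>2)"
proof -
  have "z \<noteq> 0" using assms by auto
  have 1: "z * cnj z = of_real (R\<^sup>2)" using assms by (simp flip: complex_norm_square)
  have "(1 + z\<^sup>2 / (of_real R)\<^sup>2) / z = (of_real (R\<^sup>2) + z\<^sup>2) / (of_real (R\<^sup>2) * z)"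
    using assms \<open>z \<noteq> 0\<close> by (simp add: field_simps)
  also have "\<dots> = (z * (cnj z + z)) / (of_real (R\<^sup>2) * z)"
    unfolding 1[symmetric] by (simp add: algebra_simps power2_eq_square)
  also have "\<dots> = (cnj z + z) / of_real (R\<^sup>2)"
    using \<open>z \<noteq> 0\<close> assms by simp
  also have "cnj z + z = of_real (2 * Re z)" by (simp add: complex_eq_iff)
  finally show ?thesis by simp
qed

section \<open>Arcs, segments and the Cauchy formula\<close>

lemma right_semicircle:
  assumes "z \<in> path_image (part_circlepath 0 R (-pi/2) (pi/2))" "R > 0"
  shows "norm z = R" "Re z \<ge> 0"
proof -
  from assms obtain x where x: "-pi/2 \<le> x" "x \<le> pi/2" "z = of_real R * cis x"
    unfolding path_image_part_circlepath' by (auto simp: closed_segment_eq_real_ivl split: if_splits)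
  then show "norm z = R" using assms by (simp add: norm_mult)
  have "cos x \<ge> 0" using x by (intro cos_ge_zero) auto
  then show "Re z \<ge> 0" using x assms by simp
qed

lemma left_semicircle:
  assumes "z \<in> path_image (part_circlepath 0 R (pi/2) (3*pi/2))" "R > 0"
  shows "norm z = R" "Re z \<le> 0"
proof -
  from assms obtain x where x: "pi/2 \<le> x" "x \<le> 3*pi/2" "z = of_real R * cis x"
    unfolding path_image_part_circlepath' by (auto simp: closed_segment_eq_real_ivl split: if_splits)
  then show "norm z = R" using assms by (simp add: norm_mult)
  have "cos (x - pi) \<ge> 0" using x by (intro cos_ge_zero) auto
  then show "Re z \<le> 0" using x assms by (simp add: mult_nonneg_nonpos)
qed

text \<open>These two points form the exceptional set in the arc bounds: there
  \<open>Re z = 0\<close>, and bounds containing \<open>1 / Re z\<close> say nothing.\<close>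

lemma circle_imaginary_points:
  assumes "norm z = R" "Re z = 0"
  shows "z \<in> {\<i> * of_real R, - (\<i> * of_real R)}"
proof -
  have "\<bar>Im z\<bar> = R" using assms by (simp add: norm_complex_def)
  then show ?thesis using assms(2) by (auto simp: complex_eq_iff abs_if split: if_splits)
qed

lemma has_contour_integral_inverse_arc:
  assumes "s < t" "R > 0"
  shows "((\<lambda>z. 1 / z) has_contour_integral \<i> * of_real (t - s)) (part_circlepath 0 R s t)"
proof -
  have "((\<lambda>_. \<i>) has_integral (of_real (t - s) * \<i>)) {s..t}"
    using has_integral_const_real[of \<i> s t] assms by (simp add: scaleR_conv_of_real)
  then have "((\<lambda>x. 1 / (0 + of_real R * cis x) * of_real R * \<i> * cis x) has_integral \<i> * of_real (t - s)) {s..t}"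
    using assms by (simp add: mult.commute)
  then show ?thesis by (simp add: has_contour_integral_part_circlepath_iff[OF assms(1)])
qed

text \<open>Winding number one is asked for as the value of the integral of \<open>1 / z\<close>,
  since that integral can be added up over arcs and segments.\<close>

lemma closed_contour_formula:
  assumes U: "convex U" "open U" "0 \<in> U" and H: "H holomorphic_on U"
    and g: "valid_path g" "path_image g \<subseteq> U - {0}" "pathfinish g = pathstart g"
    and w: "((\<lambda>z. 1 / z) has_contour_integral (2 * pi * \<i>)) g"
  shows "contour_integral g (\<lambda>z. H z / z) = 2 * pi * \<i> * H 0"
proof -
  have z: "0 \<in> interior U" using U by (simp add: interior_open)
  have "winding_number g 0 = 1"
    using winding_number_valid_path[OF g(1), of 0] g(2) contour_integral_unique[OF w] by auto
  then show ?thesis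
    using Cauchy_integral_formula_convex_simple[OF U(1) H z g] by (simp add: contour_integral_unique)
qed

text \<open>Exponential decay along the segment gains a factor \<open>1 / c\<close> over the trivial
  bound. With \<open>c = d * ln N\<close> this is the source of the term \<open>K / ln N\<close> in
  Newman's estimate.\<close>

lemma contour_integral_linepath_exp_bound:
  assumes f: "continuous_on (closed_segment a b) f" and c: "c > 0"
    and B: "\<And>t. 0 \<le> t \<Longrightarrow> t \<le> 1 \<Longrightarrow> norm (f (linepath a b t)) \<le> C * exp (- c * t)" and C: "C \<ge> 0"
  shows "norm (contour_integral (linepath a b) f) \<le> C * norm (b - a) / c"
proof -
  have "f contour_integrable_on (linepath a b)"
    by (rule contour_integrable_continuous_linepath[OF f])
  then have "(f has_contour_integral contour_integral (linepath a b) f) (linepath a b)"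
    by (rule has_contour_integral_integral)
  then have i: "((\<lambda>x. f (linepath a b x) * (b - a)) has_integral contour_integral (linepath a b) f) {0..1}"
    by (simp add: has_contour_integral_linepath)
  define G where "G = (\<lambda>t. - (C * norm (b - a) / c) * exp (- c * t))"
  have "((\<lambda>t. C * norm (b - a) * exp (- c * t)) has_integral (G 1 - G 0)) {0..1}"
    unfolding G_def using c
    by (intro fundamental_theorem_of_calculus)
       (auto intro!: derivative_eq_intros simp flip: has_real_derivative_iff_has_vector_derivative)
  then have j: "((\<lambda>t. C * norm (b - a) * exp (- c * t)) has_integral (C * norm (b - a) / c * (1 - exp (- c)))) {0..1}"
    by (simp add: G_def right_diff_distrib)
  have "norm (contour_integral (linepath a b) f) = norm (integral {0..1} (\<lambda>x. f (linepath a b x) * (b - a)))"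
    using integral_unique[OF i] by simp
  also have "\<dots> \<le> integral {0..1} (\<lambda>t. C * norm (b - a) * exp (- c * t))"
  proof (rule integral_norm_bound_integral)
    show "(\<lambda>x. f (linepath a b x) * (b - a)) integrable_on {0..1}" using i by blast
    show "(\<lambda>t. C * norm (b - a) * exp (- c * t)) integrable_on {0..1}" using j by blast
    fix t :: real assume "t \<in> {0..1}"
    then have "norm (f (linepath a b t)) * norm (b - a) \<le> C * exp (- c * t) * norm (b - a)"
      by (intro mult_right_mono B) auto
    then show "norm (f (linepath a b t) * (b - a)) \<le> C * norm (b - a) * exp (- c * t)"
      by (simp add: norm_mult mult_ac)
  qed
  also have "\<dots> = C * norm (b - a) / c * (1 - exp (- c))" by (rule integral_unique[OF j])
  also have "\<dots> \<le> C * norm (b - a) / c * 1" using C c by (intro mult_left_mono) auto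
  finally show ?thesis by simp
qed

text \<open>
  The right half of the circle of radius \<open>R\<close> is closed up by two segments through \<open>-d\<close>, inside the domain
  of \<open>f\<close>; the partial sum is entire and is integrated over the left half of the circle instead. On the
  circle the kernel \<open>1/z + z/R^2\<close> is real, of size proportional to \<open>Re z\<close>, which compensates the
  factor \<open>1 / Re z\<close> in the bounds for the tail and for the partial sum.
\<close>
lemma newman_estimate:
  assumes a: "\<And>n. norm (a n) \<le> 1" and R: "R > 0" and \<delta>: "\<delta> > 0"
    and hol: "f holomorphic_on {z. Re z > -\<delta> \<and> \<bar>Im z\<bar> < 2 * R}"
    and eq: "\<And>z. Re z > 0 \<Longrightarrow> f z = dirichlet_series a (1 + z)"
  obtains K where "K \<ge> 0"
    "\<And>N. N > 1 \<Longrightarrow> norm (f 0 - dirichlet_sum a N 0) \<le> 2 / R + 1 / real N + K / ln (real N)"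
proof -
  define d where "d = min (\<delta> / 2) R"
  have d: "d > 0" "d < \<delta>" using \<delta> R by (auto simp: d_def)
  define U where "U = {z. Re z > -\<delta> \<and> \<bar>Im z\<bar> < 2 * R}"
  have U_eq: "U = {z. Re z > -\<delta>} \<inter> {z. Im z < 2 * R} \<inter> {z. Im z > - 2 * R}"
    by (auto simp: U_def)
  have "open U" unfolding U_eq
    by (intro open_Int open_halfspace_Re_gt open_halfspace_Im_lt open_halfspace_Im_gt)
  moreover have "convex U" unfolding U_eq
    by (intro convex_Int convex_halfspace_Re_gt convex_halfspace_Im_lt convex_halfspace_Im_gt)
  moreover have "0 \<in> U" using \<delta> R by (simp add: U_def)
  ultimately have U: "open U" "convex U" "0 \<in> U" by blast+
  define A where "A = part_circlepath 0 R (-pi/2) (pi/2)"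
  define B where "B = part_circlepath 0 R (pi/2) (3*pi/2)"
  define L1 where "L1 = linepath (\<i> * of_real R) (- of_real d)"
  define L2 where "L2 = linepath (- of_real d) (- (\<i> * of_real R))"
  define k where "k = (\<lambda>z::complex. (1 + z\<^sup>2 / (of_real R)\<^sup>2))"
  define e where "e = (\<lambda>N (z::complex). exp (z * of_real (ln (real N))))"
  define S where "S = dirichlet_sum a"
  have exp_i: "exp (\<i> * complex_of_real (pi / 2)) = \<i>" "exp (\<i> * complex_of_real (- pi / 2)) = - \<i>"
    "exp (\<i> * complex_of_real (3 * pi / 2)) = - \<i>"
  proof -
    show "exp (\<i> * complex_of_real (pi / 2)) = \<i>"
      by (simp only: cis_conv_exp[symmetric] cis_pi_half)
    have "cis (- pi / 2) = - \<i>" by (simp add: complex_eq_iff)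
    then show "exp (\<i> * complex_of_real (- pi / 2)) = - \<i>" by (simp only: cis_conv_exp)
    have "cis (3 * pi / 2) = - \<i>" using cis_mult[of pi "pi / 2"] by simp
    then show "exp (\<i> * complex_of_real (3 * pi / 2)) = - \<i>" by (simp only: cis_conv_exp)
  qed
  have ends: "pathstart A = - (\<i> * of_real R)" "pathfinish A = \<i> * of_real R"
    "pathstart B = \<i> * of_real R" "pathfinish B = - (\<i> * of_real R)"
    "pathstart L1 = \<i> * of_real R" "pathfinish L1 = - of_real d"
    "pathstart L2 = - of_real d" "pathfinish L2 = - (\<i> * of_real R)"
    unfolding A_def B_def L1_def L2_def
    by (simp_all only: pathstart_part_circlepath pathfinish_part_circlepath exp_i) (simp_all add: mult.commute)
  have valid: "valid_path A" "valid_path B" "valid_path L1" "valid_path L2"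
    by (simp_all add: A_def B_def L1_def L2_def)
  \<comment> \<open>The values \<open>R\<close> and \<open>- R\<close> of \<open>\<rho>\<close> give
    the two segments, the second one reversed, so both are treated at once. The real part falls
    linearly from 0 to \<open>- d\<close>, whence \<open>N powr z\<close> decays exponentially in
    the parameter.\<close>
  define E where "E \<rho> = linepath (\<i> * of_real \<rho>) (- of_real d :: complex)" for \<rho>
  have L_pt: "Re (E \<rho> t) = - d * t"
    "Im (E \<rho> t) = \<rho> * (1 - t)" for t \<rho>
    by (simp_all add: E_def linepath_def algebra_simps)
  have pA: "z \<in> U \<and> z \<noteq> 0" if "z \<in> path_image A" for z
    using right_semicircle[OF that[unfolded A_def] R] abs_Im_le_cmod[of z] R \<delta>
    by (auto simp: U_def)
  have pB: "z \<noteq> 0" if "z \<in> path_image B" for z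
    using left_semicircle[OF that[unfolded B_def] R] R by auto
  have pL: "z \<in> U \<and> z \<noteq> 0 \<and> - z \<notin> \<real>\<^sub>\<le>\<^sub>0"
    if z: "z \<in> path_image (E \<rho>)" and \<rho>: "\<bar>\<rho>\<bar> = R" for z \<rho>
  proof -
    obtain t where t: "0 \<le> t" "t \<le> 1" "z = E \<rho> t"
      using z unfolding path_image_def by auto
    have re: "Re z = - d * t" and im: "Im z = \<rho> * (1 - t)" using L_pt t by auto
    have "d * t \<le> d * 1" using t d by (intro mult_left_mono) auto
    then have 1: "Re z > - \<delta>" using re d by linarith
    have "\<bar>Im z\<bar> = R * (1 - t)" using im \<rho> t by (simp add: abs_mult)
    also have "\<dots> \<le> R * 1" using t R by (intro mult_left_mono) auto
    finally have 2: "\<bar>Im z\<bar> < 2 * R" using R by linarith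
    have "Im z = 0 \<Longrightarrow> Re z < 0" using re im \<rho> R d by auto
    then show ?thesis using 1 2 by (auto simp: U_def complex_nonpos_Reals_iff)
  qed
  have pL1: "z \<in> U \<and> z \<noteq> 0 \<and> - z \<notin> \<real>\<^sub>\<le>\<^sub>0" if "z \<in> path_image L1" for z
    using pL[of z R] that R by (simp add: L1_def E_def)
  have pL2: "z \<in> U \<and> z \<noteq> 0 \<and> - z \<notin> \<real>\<^sub>\<le>\<^sub>0" if "z \<in> path_image L2" for z
    using pL[of z "-R"] that R by (simp add: L2_def E_def closed_segment_commute)
  have arc: "((\<lambda>z. 1 / z) has_contour_integral \<i> * pi) A" "((\<lambda>z. 1 / z) has_contour_integral \<i> * pi) B"
  proof -
    have "pi / 2 - (- pi / 2) = pi" "3 * pi / 2 - pi / 2 = pi" "- pi / 2 < pi / 2" "pi / 2 < 3 * pi / 2" by simp_all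
    then show "((\<lambda>z. 1 / z) has_contour_integral \<i> * pi) A" "((\<lambda>z. 1 / z) has_contour_integral \<i> * pi) B"
      unfolding A_def B_def using has_contour_integral_inverse_arc R by metis+
  qed
  \<comment> \<open>\<open>Ln (- z)\<close> is a primitive of \<open>1 / z\<close> off the
    non-negative real axis, which the two segments avoid; this branch gives the half turn on the
    left of the origin.\<close>
  have Larc: "((\<lambda>z. 1 / z) has_contour_integral \<i> * pi) (L1 +++ L2)"
  proof -
    have "((\<lambda>z. 1 / z) has_contour_integral Ln (- pathfinish (L1 +++ L2)) - Ln (- pathstart (L1 +++ L2))) (L1 +++ L2)"
    proof (rule contour_integral_primitive[where S = "{z. - z \<notin> \<real>\<^sub>\<le>\<^sub>0}"])
      fix z :: complex assume "z \<in> {z. - z \<notin> \<real>\<^sub>\<le>\<^sub>0}"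
      then have z: "- z \<notin> \<real>\<^sub>\<le>\<^sub>0" by simp
      have "((\<lambda>z. Ln (- z)) has_field_derivative inverse (- z) * (- 1)) (at z)"
        by (rule DERIV_chain2[OF has_field_derivative_Ln[OF z] DERIV_minus[OF DERIV_ident]])
      then show "((\<lambda>z. Ln (- z)) has_field_derivative 1 / z) (at z within {z. - z \<notin> \<real>\<^sub>\<le>\<^sub>0})"
        by (rule has_field_derivative_at_within[OF DERIV_cong]) (simp add: divide_inverse)
    next
      show "path_image (L1 +++ L2) \<subseteq> {z. - z \<notin> \<real>\<^sub>\<le>\<^sub>0}"
        using pL1 pL2 by (auto simp: path_image_join ends)
    qed (use valid ends in auto)
    moreover have "Ln (\<i> * of_real R) - Ln (- (\<i> * of_real R)) = \<i> * pi"
      using Ln_times_of_real[OF R, of "\<i>"] Ln_times_of_real[OF R, of "-\<i>"] by (simp add: mult.commute)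
    ultimately show ?thesis by (simp add: ends)
  qed
  have cAL: "contour_integral A (\<lambda>z. H z / z) + (contour_integral L1 (\<lambda>z. H z / z) + contour_integral L2 (\<lambda>z. H z / z))
     = 2 * pi * \<i> * H 0" if H: "H holomorphic_on U" for H
  proof -
    have Hc: "continuous_on U H" using H by (rule holomorphic_on_imp_continuous_on)
    have i: "(\<lambda>z. H z / z) contour_integrable_on A" "(\<lambda>z. H z / z) contour_integrable_on L1"
      "(\<lambda>z. H z / z) contour_integrable_on L2"
      unfolding A_def L1_def L2_def using pA pL1 pL2
      by (auto intro!: contour_integrable_continuous_part_circlepath contour_integrable_continuous_linepath
          continuous_intros continuous_on_subset[OF Hc] simp: A_def L1_def L2_def)
    have "contour_integral (A +++ L1 +++ L2) (\<lambda>z. H z / z) = 2 * pi * \<i> * H 0"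
    proof (rule closed_contour_formula[OF U(2,1,3) H])
      show "path_image (A +++ L1 +++ L2) \<subseteq> U - {0}"
        using pA pL1 pL2 by (auto simp: path_image_join ends)
      show "((\<lambda>z. 1 / z) has_contour_integral 2 * pi * \<i>) (A +++ L1 +++ L2)"
        using has_contour_integral_join[OF arc(1) Larc] valid ends by (simp add: algebra_simps)
    qed (use valid ends in auto)
    then show ?thesis using i valid ends by simp
  qed
  have cAB: "contour_integral A (\<lambda>z. H z / z) + contour_integral B (\<lambda>z. H z / z)
     = 2 * pi * \<i> * H 0" if H: "H holomorphic_on UNIV" for H
  proof -
    have Hc: "continuous_on UNIV H" using H by (rule holomorphic_on_imp_continuous_on)
    have i: "(\<lambda>z. H z / z) contour_integrable_on A" "(\<lambda>z. H z / z) contour_integrable_on B"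
      unfolding A_def B_def using pA pB
      by (auto intro!: contour_integrable_continuous_part_circlepath
          continuous_intros continuous_on_subset[OF Hc] simp: A_def B_def)
    have "contour_integral (A +++ B) (\<lambda>z. H z / z) = 2 * pi * \<i> * H 0"
    proof (rule closed_contour_formula[OF _ _ _ H])
      show "path_image (A +++ B) \<subseteq> UNIV - {0}"
        using pA pB by (auto simp: path_image_join ends)
      show "((\<lambda>z. 1 / z) has_contour_integral 2 * pi * \<i>) (A +++ B)"
        using has_contour_integral_join[OF arc] valid ends by (simp add: algebra_simps)
    qed (use valid ends in auto)
    then show ?thesis using i valid ends by simp
  qed
  have k_hol: "k holomorphic_on X" for X unfolding k_def using R by (intro holomorphic_intros) auto
  have e_hol: "e N holomorphic_on X" for X N unfolding e_def by (intro holomorphic_intros)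
  have f_hol: "f holomorphic_on U" using hol by (simp add: U_def)
  have norm_e: "norm (e N z) = real N powr Re z" if "N > 0" for N z
    using that by (simp add: e_def norm_exp_eq_Re powr_def)
  have kernel: "norm (k z / z) = 2 * \<bar>Re z\<bar> / R\<^sup>2" if "norm z = R" for z
    unfolding k_def newman_kernel[OF that R] norm_of_real by (simp add: abs_mult)


  have "compact (path_image L1 \<union> path_image L2)"
    using valid by (intro compact_Un compact_path_image valid_path_imp_path)
  moreover have "continuous_on (path_image L1 \<union> path_image L2) (\<lambda>z. f z * k z / z)"
    using pL1 pL2 k_hol
    by (intro continuous_intros continuous_on_subset[OF holomorphic_on_imp_continuous_on[OF f_hol]]
        holomorphic_on_imp_continuous_on) auto
  ultimately have "compact ((\<lambda>z. f z * k z / z) ` (path_image L1 \<union> path_image L2))"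
    by (intro compact_continuous_image)
  \<comment> \<open>The factor \<open>e N\<close> is left out of the bounded quantity, so
    \<open>C\<close>, and hence \<open>K\<close>, does not depend on \<open>N\<close>.\<close>
  then obtain C where C: "C > 0" "\<And>z. z \<in> path_image L1 \<union> path_image L2 \<Longrightarrow> norm (f z * k z / z) \<le> C"
    using compact_imp_bounded bounded_pos by (metis (no_types, lifting) image_eqI)
  define K where "K = 2 * (C * (d + R) / d)"
  show ?thesis
  proof (rule that)
    show "K \<ge> 0" using C d R by (auto simp: K_def)
    fix N :: nat assume N: "N > 1"
    then have lnN: "ln (real N) > 0" by simp
    define F where "F = (\<lambda>z. f z * e N z * k z)"
    define G where "G = (\<lambda>z. S N z * e N z * k z)"
    have F: "F holomorphic_on U" unfolding F_def by (intro holomorphic_intros f_hol e_hol k_hol)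
    have G: "G holomorphic_on X" for X
      unfolding G_def S_def by (intro holomorphic_intros dirichlet_sum_holomorphic e_hol k_hol)
    have F0: "F 0 = f 0" "G 0 = S N 0" by (simp_all add: F_def G_def e_def k_def)
    have cont: "continuous_on (path_image A) (\<lambda>z. F z / z)" "continuous_on (path_image A) (\<lambda>z. G z / z)"
      "continuous_on (path_image B) (\<lambda>z. G z / z)"
      using pA pB by (auto intro!: continuous_intros
        continuous_on_subset[OF holomorphic_on_imp_continuous_on[OF F]] holomorphic_on_imp_continuous_on[OF G])
    have intA: "(\<lambda>z. F z / z) contour_integrable_on A" "(\<lambda>z. G z / z) contour_integrable_on A"
      "(\<lambda>z. G z / z) contour_integrable_on B"
      using cont unfolding A_def B_def by (auto intro: contour_integrable_continuous_part_circlepath)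
    have main: "2 * pi * \<i> * (f 0 - S N 0) = contour_integral A (\<lambda>z. F z / z - G z / z)
        + contour_integral L1 (\<lambda>z. F z / z) + contour_integral L2 (\<lambda>z. F z / z)
        - contour_integral B (\<lambda>z. G z / z)"
      using cAL[OF F] cAB[OF G] intA by (simp add: F0 contour_integral_diff algebra_simps)
    have arc_bound: "norm (contour_integral (part_circlepath 0 R s t) g) \<le> b * R * (t - s)"
      if "g contour_integrable_on part_circlepath 0 R s t" "b \<ge> 0" "s \<le> t"
        "\<And>z. z \<in> path_image (part_circlepath 0 R s t) \<Longrightarrow> Re z \<noteq> 0 \<Longrightarrow> norm (g z) \<le> b" for g b s t
    proof (rule has_contour_integral_bound_part_circlepath_strong[OF has_contour_integral_integral[OF that(1)]])
      fix z assume z: "z \<in> path_image (part_circlepath 0 R s t) - {\<i> * of_real R, - (\<i> * of_real R)}"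
      then have "norm z = R" using in_path_image_part_circlepath[of z 0 R s t] that(3) R by auto
      then show "norm (g z) \<le> b" using that(4) z circle_imaginary_points by blast
    qed (use that R in auto)
    have N0: "N > 0" using N by simp
    have 1: "norm (contour_integral A (\<lambda>z. F z / z - G z / z)) \<le> 2 * pi / R"
    proof -
      have "norm (contour_integral A (\<lambda>z. F z / z - G z / z)) \<le> 2 / R\<^sup>2 * R * (pi / 2 - (- pi / 2))"
        unfolding A_def
      proof (rule arc_bound)
        fix z assume z: "z \<in> path_image (part_circlepath 0 R (- pi / 2) (pi / 2))" "Re z \<noteq> 0"
        have nz: "norm z = R" and rz: "Re z > 0" using right_semicircle[OF z(1) R] z(2) by auto
        have "F z / z - G z / z = (f z - S N z) * e N z * (k z / z)"
          by (simp add: F_def G_def algebra_simps diff_divide_distrib)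
        also have "norm \<dots> \<le> real N powr (- Re z) / Re z * real N powr Re z * (2 * \<bar>Re z\<bar> / R\<^sup>2)"
          unfolding norm_mult kernel[OF nz] norm_e[OF N0] eq[OF rz] S_def
          using norm_dirichlet_tail_le[OF a rz N0] by (intro mult_right_mono) auto
        also have "\<dots> = 2 / R\<^sup>2" using rz N by (simp add: powr_minus field_simps)
        finally show "norm (F z / z - G z / z) \<le> 2 / R\<^sup>2" .
      qed (use R intA contour_integrable_diff in \<open>auto simp: A_def\<close>)
      also have "\<dots> = 2 * pi / R"
        using R by (simp add: power2_eq_square field_simps)
      finally show ?thesis .
    qed
    have 2: "norm (contour_integral B (\<lambda>z. G z / z)) \<le> 2 * pi / R + 2 * pi / real N"
    proof -
      have "norm (contour_integral B (\<lambda>z. G z / z)) \<le> (2 / R\<^sup>2 + 2 / (R * real N)) * R * (3 * pi / 2 - pi / 2)"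
        unfolding B_def
      proof (rule arc_bound)
        fix z assume z: "z \<in> path_image (part_circlepath 0 R (pi / 2) (3 * pi / 2))" "Re z \<noteq> 0"
        have nz: "norm z = R" and rz: "Re z < 0" using left_semicircle[OF z(1) R] z(2) by auto
        have "G z / z = S N z * e N z * (k z / z)" by (simp add: G_def)
        also have "norm \<dots> \<le> (real N powr (-Re z) * (1 / (-Re z) + 1 / real N)) * real N powr Re z * (2 * \<bar>Re z\<bar> / R\<^sup>2)"
          unfolding norm_mult kernel[OF nz] norm_e[OF N0] S_def
          using norm_dirichlet_sum_le[OF a rz N0] by (intro mult_right_mono) auto
        also have "\<dots> = (1 / (-Re z) + 1 / real N) * (2 * \<bar>Re z\<bar> / R\<^sup>2)"
          using N by (simp add: powr_minus)
        also have "\<dots> = 2 / R\<^sup>2 + 2 * \<bar>Re z\<bar> / (R\<^sup>2 * real N)"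
          using rz N R by (simp add: field_simps)
        also have "\<dots> \<le> 2 / R\<^sup>2 + 2 * R / (R\<^sup>2 * real N)"
          using abs_Re_le_cmod[of z] nz R N by (intro add_left_mono divide_right_mono) auto
        also have "2 * R / (R\<^sup>2 * real N) = 2 / (R * real N)" using R by (simp add: power2_eq_square)
        finally show "norm (G z / z) \<le> 2 / R\<^sup>2 + 2 / (R * real N)" .
      qed (use R N intA in \<open>auto simp: B_def\<close>)
      also have "\<dots> = 2 * pi / R + 2 * pi / real N"
        using R N by (simp add: power2_eq_square field_simps)
      finally show ?thesis .
    qed
    have Fcont: "continuous_on X (\<lambda>z. F z / z)" if "X \<subseteq> U" "0 \<notin> X" for X
      using that by (intro continuous_intros continuous_on_subset[OF holomorphic_on_imp_continuous_on[OF F]]) auto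
    have Fbound: "norm (F z / z) \<le> C * exp (- (d * ln (real N)) * t)"
      if "z \<in> path_image L1 \<union> path_image L2" "Re z = - d * t" for z t
    proof -
      have "F z / z = (f z * k z / z) * e N z" by (simp add: F_def)
      also have "norm \<dots> \<le> C * real N powr (- d * t)"
        unfolding norm_mult[of "f z * k z / z"] norm_e[OF N0]
        using C(2)[OF that(1)] that(2) by (intro mult_mono) (use C in auto)
      finally show ?thesis using N by (simp add: powr_def algebra_simps)
    qed
    have seg: "norm (contour_integral (E \<rho>) (\<lambda>z. F z / z)) \<le> C * (d + R) / (d * ln (real N))"
      if \<rho>: "\<bar>\<rho>\<bar> = R" and sub: "path_image (E \<rho>) \<subseteq> path_image L1 \<union> path_image L2" for \<rho>
    proof -
      have "norm (contour_integral (E \<rho>) (\<lambda>z. F z / z))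
          \<le> C * norm (- of_real d - \<i> * of_real \<rho> :: complex) / (d * ln (real N))"
      proof (rule contour_integral_linepath_exp_bound[of "\<i> * of_real \<rho>" "- of_real d", folded E_def])
        show "continuous_on (closed_segment (\<i> * of_real \<rho>) (- of_real d)) (\<lambda>z. F z / z)"
          using pL \<rho> by (intro Fcont) (auto simp: E_def)
        fix t :: real assume "0 \<le> t" "t \<le> 1"
        then have "E \<rho> t \<in> path_image (E \<rho>)"
          by (auto simp: path_image_def)
        then show "norm (F (E \<rho> t) / E \<rho> t)
            \<le> C * exp (- (d * ln (real N)) * t)"
          by (intro Fbound L_pt subsetD[OF sub])
      qed (use C d lnN in auto)
      also have "norm (- of_real d - \<i> * of_real \<rho> :: complex) \<le> d + R"
        using norm_triangle_ineq4[of "- of_real d" "\<i> * of_real \<rho> :: complex"] d \<rho> by (simp add: norm_mult)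
      then have "C * norm (- of_real d - \<i> * of_real \<rho> :: complex) / (d * ln (real N)) \<le> C * (d + R) / (d * ln (real N))"
        using C d lnN by (intro divide_right_mono mult_left_mono) auto
      finally show ?thesis .
    qed
    have 3: "norm (contour_integral L1 (\<lambda>z. F z / z)) \<le> C * (d + R) / (d * ln (real N))"
      using seg[of R] R by (simp add: L1_def E_def)
    have 4: "norm (contour_integral L2 (\<lambda>z. F z / z)) \<le> C * (d + R) / (d * ln (real N))"
    proof -
      have "contour_integral L2 (\<lambda>z. F z / z) = - contour_integral (linepath (- (\<i> * of_real R)) (- of_real d)) (\<lambda>z. F z / z)"
        unfolding L2_def using pL2 by (intro contour_integral_reverse_linepath Fcont) (auto simp: L2_def)
      then show ?thesis using seg[of "-R"] R by (simp add: L2_def E_def closed_segment_commute)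
    qed
    have K_eq: "K / ln (real N) = C * (d + R) / (d * ln (real N)) + C * (d + R) / (d * ln (real N))"
      by (simp add: K_def)
    have K0: "K / ln (real N) \<ge> 0" using C d R lnN by (simp add: K_def)
    have tri: "norm (p + q + r - s) \<le> norm p + norm q + norm r + norm s" for p q r s :: complex
      using norm_triangle_ineq4[of "p + q + r" s] norm_triangle_ineq[of "p + q" r] norm_triangle_ineq[of p q]
      by linarith
    have "2 * pi * norm (f 0 - S N 0) = norm (2 * pi * \<i> * (f 0 - S N 0))"
      by (simp add: norm_mult)
    also have "\<dots> \<le> 2 * pi / R + K / ln (real N) + (2 * pi / R + 2 * pi / real N)"
      unfolding main K_eq by (rule order_trans[OF tri]) (use 1 2 3 4 in linarith)
    also have "\<dots> \<le> 2 * pi / R + 2 * pi * (K / ln (real N)) + (2 * pi / R + 2 * pi / real N)"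
    proof -
      have "1 * (K / ln (real N)) \<le> 2 * pi * (K / ln (real N))"
        using K0 pi_gt3 by (intro mult_right_mono) auto
      then show ?thesis by simp
    qed
    also have "\<dots> = 2 * pi * (2 / R + 1 / real N + K / ln (real N))" by (simp add: algebra_simps)
    finally show "norm (f 0 - dirichlet_sum a N 0) \<le> 2 / R + 1 / real N + K / ln (real N)"
      by (simp add: S_def)
  qed
qed

text \<open>For fixed \<open>R\<close> the error tends to \<open>2 / R\<close>, and \<open>R\<close>
  is arbitrary. The width \<open>\<delta>\<close> may shrink as \<open>R\<close> grows: continuation
  slightly past the line is enough, without any uniform zero-free region.\<close>

theorem newman_tauberian:
  assumes a: "\<And>n. norm (a n) \<le> 1"
    and hol: "\<And>R. R > 0 \<Longrightarrow> \<exists>\<delta>>0. f holomorphic_on {z. Re z > -\<delta> \<and> \<bar>Im z\<bar> < R}"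
    and eq: "\<And>z. Re z > 0 \<Longrightarrow> f z = dirichlet_series a (1 + z)"
  shows "(\<lambda>N. \<Sum>n=1..N. a n / of_nat n) \<longlonglongrightarrow> f 0"
proof -
  have "(\<lambda>N. dirichlet_sum a N 0) \<longlonglongrightarrow> f 0"
  proof (rule tendstoI)
    fix \<epsilon> :: real assume \<epsilon>: "\<epsilon> > 0"
    define R where "R = 4 / \<epsilon>"
    have R: "R > 0" using \<epsilon> by (simp add: R_def)
    obtain \<delta> where \<delta>: "\<delta> > 0" "f holomorphic_on {z. Re z > -\<delta> \<and> \<bar>Im z\<bar> < 2 * R}"
      using hol[of "2 * R"] R by auto
    obtain K where K: "\<And>N. N > 1 \<Longrightarrow> norm (f 0 - dirichlet_sum a N 0) \<le> 2 / R + 1 / real N + K / ln (real N)"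
      using newman_estimate[OF a R \<delta> eq] by blast
    have "(\<lambda>N. 2 / R + 1 / real N + K / ln (real N)) \<longlonglongrightarrow> 2 / R" by real_asymp
    moreover have "2 / R < \<epsilon>" using \<epsilon> by (simp add: R_def)
    ultimately have "\<forall>\<^sub>F N in sequentially. 2 / R + 1 / real N + K / ln (real N) < \<epsilon>"
      by (rule order_tendstoD)
    then show "\<forall>\<^sub>F N in sequentially. dist (dirichlet_sum a N 0) (f 0) < \<epsilon>"
      using eventually_gt_at_top[of 1]
      by eventually_elim (use K in \<open>force simp: dist_norm norm_minus_commute\<close>)
  qed
  then show ?thesis by (simp add: dirichlet_sum_0)
qed

section \<open>The series of mob n / n and Axer's theorem\<close>

text \<open>Compactness of the segment with imaginary parts in \<open>[-R, R]\<close>: it lies in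
  the open set where \<open>zeta_reg\<close> does not vanish, and so does a neighbourhood of fixed
  width. The cap \<open>1 / 2\<close> in \<open>\<delta>\<close> keeps \<open>1 + z\<close> in the
  half plane where \<open>zeta_reg\<close> is holomorphic.\<close>

lemma zeta_reg_nonzero_strip:
  assumes "R > 0"
  obtains \<delta> where "\<delta> > 0" "\<delta> < 1" "\<And>z. Re z > -\<delta> \<Longrightarrow> \<bar>Im z\<bar> \<le> R \<Longrightarrow> zeta_reg (1 + z) \<noteq> 0"
proof -
  define T where "T = (\<lambda>t. 1 + \<i> * complex_of_real t) ` {-R..R}"
  have T: "compact T" unfolding T_def by (intro compact_continuous_image continuous_intros) auto
  define V where "V = {s. Re s > 0} \<inter> zeta_reg -` (- {0})"
  have V: "open V" unfolding V_def
    by (intro continuous_open_preimage holomorphic_on_imp_continuous_on zeta_reg_holomorphic open_halfspace_Re_gt) auto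
  have "T \<subseteq> V" unfolding T_def V_def using zeta_reg_nonzero_line by auto
  then obtain e where e: "e > 0" "{x. infdist x T \<le> e} \<subseteq> V"
    using compact_in_open_separated[of T V] T V assms
    by (auto simp: T_def)
  define \<delta> where "\<delta> = min e (1 / 2)"
  show ?thesis
  proof (rule that)
    show "\<delta> > 0" "\<delta> < 1" using e by (auto simp: \<delta>_def)
    fix z assume z: "Re z > -\<delta>" "\<bar>Im z\<bar> \<le> R"
    show "zeta_reg (1 + z) \<noteq> 0"
    proof (cases "Re z \<ge> 0")
      case False
      have "1 + \<i> * of_real (Im z) \<in> T"
        unfolding T_def by (rule image_eqI[of _ _ "Im z"]) (use z in auto)
      then have "infdist (1 + z) T \<le> dist (1 + z) (1 + \<i> * of_real (Im z))" by (rule infdist_le)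
      also have "\<dots> = norm (z - \<i> * of_real (Im z))" by (simp add: dist_norm)
      also have "z - \<i> * of_real (Im z) = of_real (Re z)" by (simp add: complex_eq_iff)
      also have "norm (of_real (Re z) :: complex) \<le> e" using z False by (simp add: \<delta>_def)
      finally have "1 + z \<in> V" using e by auto
      then show ?thesis by (simp add: V_def)
    qed (use zeta_reg_nonzero in auto)
  qed
qed

text \<open>\<open>f z\<close> equals \<open>1 / zeta (1 + z)\<close> for \<open>Re z > 0\<close>;
  the pole of zeta turns into the zero of \<open>f\<close> at the origin, and that value is the sum
  of the series.\<close>

theorem sum_mob_over_n_tendsto:
  "(\<lambda>N. \<Sum>n=1..N. of_int (mob n) / of_nat n :: complex) \<longlonglongrightarrow> 0"
proof -
  define f where "f = (\<lambda>z. z / zeta_reg (1 + z))"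
  have "(\<lambda>N. \<Sum>n=1..N. of_int (mob n) / of_nat n :: complex) \<longlonglongrightarrow> f 0"
  proof (rule newman_tauberian)
    fix R :: real assume "R > 0"
    then obtain \<delta> where \<delta>: "\<delta> > 0" "\<delta> < 1" "\<And>z. Re z > -\<delta> \<Longrightarrow> \<bar>Im z\<bar> \<le> R \<Longrightarrow> zeta_reg (1 + z) \<noteq> 0"
      by (rule zeta_reg_nonzero_strip) blast
    have "(zeta_reg \<circ> (\<lambda>z. 1 + z)) holomorphic_on {z. Re z > -\<delta> \<and> \<bar>Im z\<bar> < R}"
      by (intro holomorphic_on_compose holomorphic_intros holomorphic_on_subset[OF zeta_reg_holomorphic])
         (use \<delta> in auto)
    then have "f holomorphic_on {z. Re z > -\<delta> \<and> \<bar>Im z\<bar> < R}"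
      unfolding f_def using \<delta> by (intro holomorphic_intros) (auto simp: o_def)
    then show "\<exists>\<delta>>0. f holomorphic_on {z. Re z > -\<delta> \<and> \<bar>Im z\<bar> < R}" using \<delta> by auto
  next
    fix z :: complex assume "Re z > 0"
    then have s: "Re (1 + z) > 1" by simp
    have "zeta (1 + z) \<noteq> 0" "z \<noteq> 0" using zeta_mob[OF s] \<open>Re z > 0\<close> by auto
    then show "f z = dirichlet_series (\<lambda>n. of_int (mob n)) (1 + z)"
      using zeta_mob[OF s] zeta_reg_eq_zeta[OF s] by (simp add: f_def field_simps)
  qed (rule norm_mob_le)
  then show ?thesis by (simp add: f_def)
qed

text \<open>Indexed by a set of primes instead of a modulus, so that induction can treat one prime
  at a time.\<close>

definition mob_avoiding :: "nat set \<Rightarrow> nat \<Rightarrow> complex" where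
  "mob_avoiding P n = (if \<forall>p\<in>P. \<not> p dvd n then of_int (mob n) else 0)"

text \<open>Coefficient form of multiplying a Dirichlet series by the Euler factor
  \<open>1 - p powr (-s)\<close>. Multiples of \<open>p^2\<close> contribute nothing on either
  side.\<close>

lemma mob_avoiding_insert:
  assumes "prime p" "p \<notin> P" "\<And>q. q \<in> P \<Longrightarrow> prime q"
  shows "mob_avoiding P n = mob_avoiding (insert p P) n
           - (if p dvd n then mob_avoiding (insert p P) (n div p) else 0)"
proof (cases "p dvd n")
  case False
  then show ?thesis by (simp add: mob_avoiding_def)
next
  case True
  then obtain m where n: "n = p * m" by auto
  have p0: "p > 0" using assms(1) by (simp add: prime_gt_0_nat)
  have q: "q dvd p * m \<longleftrightarrow> q dvd m" if "q \<in> P" for q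
    using assms that by (metis prime_dvd_mult_iff primes_dvd_imp_eq)
  show ?thesis
  proof (cases "p dvd m")
    case True
    then have "p\<^sup>2 dvd n" by (auto simp: n power2_eq_square)
    then have "\<not> squarefree n" using not_squarefreeI[of p n] prime_gt_1_nat[OF assms(1)] by simp
    then show ?thesis using True p0 by (simp add: mob_avoiding_def mob_def n)
  next
    case False
    then have "coprime p m" using assms(1) by (simp add: prime_imp_coprime)
    then have "mob n = - mob m" using assms(1) by (simp add: n mob_mult_coprime mob_prime)
    then show ?thesis using False p0 q by (auto simp: mob_avoiding_def n)
  qed
qed

text \<open>Undoes an Euler factor. The recursion contracts by \<open>1 / p\<close>, at most 1/2, so
  \<open>s\<close> inherits boundedness from \<open>t\<close>; each further use halves the excess of
  the eventual bound over \<open>2 * \<epsilon>\<close>, the fixed point of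
  \<open>x \<mapsto> \<epsilon> + x / 2\<close>.\<close>

lemma tendsto_0_div_recursion:
  fixes s t :: "nat \<Rightarrow> complex"
  assumes rec: "\<And>N. N > 0 \<Longrightarrow> s N = t N + s (N div p) / of_nat p" and "s 0 = 0" and p: "p \<ge> 2"
    and t: "t \<longlonglongrightarrow> 0"
  shows "s \<longlonglongrightarrow> 0"
proof -
  obtain C where C: "\<And>n. norm (t n) \<le> C"
    using convergent_imp_Bseq[OF convergentI[OF t]] by (auto simp: Bseq_def)
  have C0: "C \<ge> 0" using order_trans[OF norm_ge_zero C[of 0]] .
  have step: "norm (s N) \<le> norm (t N) + norm (s (N div p)) / 2" if "N > 0" for N
  proof -
    have "norm (s (N div p)) / real p \<le> norm (s (N div p)) / 2"
      using p by (intro divide_left_mono) auto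
    moreover have "norm (s N) \<le> norm (t N) + norm (s (N div p)) / real p"
      using norm_triangle_ineq[of "t N" "s (N div p) / of_nat p"] unfolding rec[OF that] by (simp add: norm_divide)
    ultimately show ?thesis by linarith
  qed
  have bound: "norm (s N) \<le> 2 * C" for N
  proof (induction N rule: less_induct)
    case (less N)
    show ?case
    proof (cases "N = 0")
      case False
      then have "N div p < N" using p by (simp add: div_less_dividend)
      from less[OF this] step[of N] C[of N] False show ?thesis by simp
    qed (use assms(2) C0 in simp)
  qed
  have ev: "\<forall>\<^sub>F N in sequentially. norm (s N) \<le> 2 * \<epsilon> + 2 * C / 2 ^ j" if "\<epsilon> > 0" for \<epsilon> j
  proof (induction j)
    case 0
    then show ?case using bound that by (auto intro!: always_eventually order_trans[OF bound])
  next
    case (Suc j)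
    have "filterlim (\<lambda>N. N div p) at_top sequentially"
      using p by (intro filterlim_at_top_div_const_nat) simp
    then have "\<forall>\<^sub>F N in sequentially. norm (s (N div p)) \<le> 2 * \<epsilon> + 2 * C / 2 ^ j"
      by (rule eventually_compose_filterlim[OF Suc])
    moreover have "\<forall>\<^sub>F N in sequentially. norm (t N) < \<epsilon>"
      using t that by (simp add: tendsto_iff)
    ultimately show ?case using eventually_gt_at_top[of 0]
    proof eventually_elim
      case (elim N)
      have "norm (s (N div p)) / 2 \<le> (2 * \<epsilon> + 2 * C / 2 ^ j) / 2"
        using elim(1) by (rule divide_right_mono) simp
      with elim(2) have "norm (t N) + norm (s (N div p)) / 2 \<le> \<epsilon> + (2 * \<epsilon> + 2 * C / 2 ^ j) / 2"
        by (intro add_mono) auto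
      with step[OF elim(3)] have "norm (s N) \<le> \<epsilon> + (2 * \<epsilon> + 2 * C / 2 ^ j) / 2" by (rule order_trans)
      then show ?case by (simp add: add_divide_distrib)
    qed
  qed
  show ?thesis
  proof (rule tendstoI)
    fix e :: real assume e: "e > 0"
    have "(\<lambda>j. 2 * (e / 4) + 2 * C / 2 ^ j) \<longlonglongrightarrow> 2 * (e / 4)" by real_asymp
    then have "\<forall>\<^sub>F j in sequentially. 2 * (e / 4) + 2 * C / 2 ^ j < e"
      by (rule order_tendstoD) (use e in auto)
    then obtain j where j: "2 * (e / 4) + 2 * C / 2 ^ j < e" by (auto simp: eventually_sequentially)
    show "\<forall>\<^sub>F N in sequentially. dist (s N) 0 < e"
      using ev[of "e / 4" j] e j by (auto elim!: eventually_mono)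
  qed
qed

lemma sum_mob_avoiding_tendsto:
  assumes "finite P" "\<And>p. p \<in> P \<Longrightarrow> prime p"
  shows "(\<lambda>N. \<Sum>n=1..N. mob_avoiding P n / of_nat n) \<longlonglongrightarrow> 0"
  using assms
proof (induction P rule: finite_induct)
  case empty
  then show ?case using sum_mob_over_n_tendsto by (simp add: mob_avoiding_def)
next
  case (insert p P)
  have p: "prime p" using insert by auto
  define c where "c = mob_avoiding (insert p P)"
  have "(\<lambda>N. \<Sum>n=1..N. c n / of_nat n) \<longlonglongrightarrow> 0"
  proof (rule tendsto_0_div_recursion)
    show "2 \<le> p" using p by (rule prime_ge_2_nat)
    show "(\<lambda>N. \<Sum>n=1..N. mob_avoiding P n / of_nat n) \<longlonglongrightarrow> 0" using insert by auto
    fix N :: nat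
    have "(\<Sum>n=1..N. mob_avoiding P n / of_nat n) =
        (\<Sum>n=1..N. c n / of_nat n - (if p dvd n then c (n div p) / of_nat n else 0))"
    proof (intro sum.cong refl)
      fix n
      show "mob_avoiding P n / of_nat n = c n / of_nat n - (if p dvd n then c (n div p) / of_nat n else 0)"
        using mob_avoiding_insert[OF p insert(2), of n] insert.prems
        by (simp add: c_def diff_divide_distrib)
    qed
    also have "\<dots> = (\<Sum>n=1..N. c n / of_nat n) - (\<Sum>n | n \<in> {1..N} \<and> p dvd n. c (n div p) / of_nat n)"
      by (subst sum.inter_filter) (simp_all add: sum_subtractf)
    also have "(\<Sum>n | n \<in> {1..N} \<and> p dvd n. c (n div p) / of_nat n) = (\<Sum>m=1..N div p. c m / (of_nat p * of_nat m))"
      using prime_gt_0_nat[OF p]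
      by (intro sum.reindex_bij_witness[where i = "\<lambda>m. p * m" and j = "\<lambda>n. n div p"])
         (auto simp: div_le_mono less_eq_div_iff_mult_less_eq mult.commute Suc_le_eq elim!: dvdE)
    also have "\<dots> = (\<Sum>m=1..N div p. c m / of_nat m) / of_nat p"
      by (simp add: sum_divide_distrib mult.commute)
    finally show "(\<Sum>n=1..N. c n / of_nat n) = (\<Sum>n=1..N. mob_avoiding P n / of_nat n) +
        (\<Sum>m=1..N div p. c m / of_nat m) / of_nat p" by simp
  qed auto
  then show ?case by (simp add: c_def)
qed

section \<open>Products of two conditionally convergent series\<close>

definition mob_coprime :: "nat \<Rightarrow> nat \<Rightarrow> complex" where
  "mob_coprime M n = (if coprime n M then of_int (mob n) else 0)"

lemma norm_mob_coprime_le: "norm (mob_coprime M n) \<le> 1"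
  using norm_mob_le[of n] by (simp add: mob_coprime_def)

lemma sum_mob_coprime_tendsto:
  assumes "M > 0"
  shows "(\<lambda>N. \<Sum>n=1..N. mob_coprime M n / of_nat n) \<longlonglongrightarrow> 0"
proof -
  have "mob_coprime M n = mob_avoiding (prime_factors M) n" for n
    using assms by (auto simp: mob_coprime_def mob_avoiding_def coprime_iff_no_common_prime in_prime_factors_iff)
  moreover have "(\<lambda>N. \<Sum>n=1..N. mob_avoiding (prime_factors M) n / of_nat n) \<longlonglongrightarrow> 0"
    by (rule sum_mob_avoiding_tendsto) (auto simp: in_prime_factors_iff)
  ultimately show ?thesis by simp
qed

text \<open>\<open>N div u = v\<close> holds exactly for
  \<open>N div Suc v < u \<le> N div v\<close>, so a level set is an interval and its sum a
  difference of two partial sums.\<close>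

lemma sum_div_eq_level:
  fixes w :: "nat \<Rightarrow> complex"
  assumes "v > 0"
  shows "(\<Sum>u | u \<in> {1..N} \<and> N div u = v. w u) = (\<Sum>u=1..N div v. w u) - (\<Sum>u=1..N div Suc v. w u)"
proof -
  have iff: "u \<le> N div k \<longleftrightarrow> k \<le> N div u" if "u > 0" "k > 0" for u k
    using that by (simp add: less_eq_div_iff_mult_less_eq mult.commute)
  have "{u \<in> {1..N}. N div u = v} = {1..N div v} - {1..N div Suc v}"
  proof (intro equalityI subsetI)
    fix u assume "u \<in> {u \<in> {1..N}. N div u = v}"
    then show "u \<in> {1..N div v} - {1..N div Suc v}" using iff[of u v] iff[of u "Suc v"] assms by auto
  next
    fix u assume *: "u \<in> {1..N div v} - {1..N div Suc v}"
    then have "v \<le> N div u" "\<not> Suc v \<le> N div u" using iff[of u v] iff[of u "Suc v"] assms by auto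
    moreover have "u \<le> N" using * by (auto intro: order_trans[OF _ div_le_dividend])
    ultimately show "u \<in> {u \<in> {1..N}. N div u = v}" using * by auto
  qed
  moreover have "{1..N div Suc v} \<subseteq> {1..N div v}" using assms by (auto intro: order_trans div_le_mono2)
  ultimately show ?thesis by (simp add: sum_diff)
qed

text \<open>
  Where \<open>N div u\<close> is large the trivial bound suffices; where \<open>N div u\<close> takes one of the finitely many
  small values, \<open>V\<close> is constant and the cancellation in the partial sums of \<open>w\<close> is used.
\<close>
lemma axer:
  fixes w V :: "nat \<Rightarrow> complex"
  assumes w: "\<And>u. norm (w u) \<le> 1 / real u" and W: "(\<lambda>N. \<Sum>u=1..N. w u) \<longlonglongrightarrow> 0"
    and V: "\<And>y. norm (V y - C) \<le> K / (real y + 1)"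
  shows "(\<lambda>N. \<Sum>u=1..N. w u * V (N div u)) \<longlonglongrightarrow> 0"
proof -
  define e where "e = (\<lambda>y. V y - C)"
  have K: "K \<ge> 0" using order_trans[OF norm_ge_zero V[of 0]] by simp
  have "(\<lambda>N. \<Sum>u=1..N. w u * e (N div u)) \<longlonglongrightarrow> 0"
  proof (rule tendstoI)
    fix \<epsilon> :: real assume \<epsilon>: "\<epsilon> > 0"
    obtain J :: nat where J: "J > 0" "K / real J < \<epsilon> / 2"
    proof -
      have "(\<lambda>J. K / real J) \<longlonglongrightarrow> 0" by real_asymp
      then have "\<forall>\<^sub>F J in sequentially. K / real J < \<epsilon> / 2" by (rule order_tendstoD) (use \<epsilon> in auto)
      then have "\<forall>\<^sub>F J in sequentially. K / real J < \<epsilon> / 2 \<and> J > 0" using eventually_gt_at_top[of 0] by eventually_elim auto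
      then show ?thesis using that by (auto simp: eventually_sequentially)
    qed
    define S where "S = (\<lambda>N. \<Sum>v\<in>{1..<J}. e v * ((\<Sum>u=1..N div v. w u) - (\<Sum>u=1..N div Suc v. w u)))"
    have "S \<longlonglongrightarrow> (\<Sum>v\<in>{1..<J}. e v * (0 - 0))"
      unfolding S_def
      by (intro tendsto_sum tendsto_mult tendsto_const tendsto_diff filterlim_compose[OF W] filterlim_at_top_div_const_nat) auto
    then have "S \<longlonglongrightarrow> 0" by simp
    from tendstoD[OF this, of "\<epsilon> / 2"]
    have "\<forall>\<^sub>F N in sequentially. norm (S N) < \<epsilon> / 2" using \<epsilon> by simp
    then show "\<forall>\<^sub>F N in sequentially. dist (\<Sum>u=1..N. w u * e (N div u)) 0 < \<epsilon>"
      using eventually_gt_at_top[of 0]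
    proof eventually_elim
      case (elim N)
      let ?L = "{u \<in> {1..N}. J \<le> N div u}"
      have split: "{1..N} = {u \<in> {1..N}. N div u < J} \<union> ?L" by auto
      have "(\<Sum>u=1..N. w u * e (N div u)) =
          (\<Sum>u | u \<in> {1..N} \<and> N div u < J. w u * e (N div u)) + (\<Sum>u\<in>?L. w u * e (N div u))"
        by (subst split, rule sum.union_disjoint) auto
      also have "(\<Sum>u | u \<in> {1..N} \<and> N div u < J. w u * e (N div u)) =
          (\<Sum>v\<in>{1..<J}. \<Sum>u | u \<in> {u \<in> {1..N}. N div u < J} \<and> N div u = v. w u * e (N div u))"
        by (rule sum.group[symmetric]) (auto simp: Suc_le_eq div_greater_zero_iff)
      also have "\<dots> = (\<Sum>v\<in>{1..<J}. \<Sum>u | u \<in> {1..N} \<and> N div u = v. w u * e v)"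
        by (intro sum.cong) auto
      also have "\<dots> = (\<Sum>v\<in>{1..<J}. e v * (\<Sum>u | u \<in> {1..N} \<and> N div u = v. w u))"
        by (simp add: sum_distrib_left mult.commute)
      also have "\<dots> = S N" unfolding S_def by (intro sum.cong refl) (subst sum_div_eq_level, auto)
      finally have eq: "(\<Sum>u=1..N. w u * e (N div u)) = S N + (\<Sum>u\<in>?L. w u * e (N div u))" .
      have "norm (\<Sum>u\<in>?L. w u * e (N div u)) \<le> (\<Sum>u\<in>?L. K / real N)"
      proof (rule sum_norm_le)
        fix u assume u: "u \<in> ?L"
        \<comment> \<open>This inequality lets the decay of \<open>V\<close> compensate the factor
          \<open>1 / u\<close>: each term is at most \<open>K / N\<close>, and at most
          \<open>N div J\<close> indices have \<open>N div u \<ge> J\<close>.\<close>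
        have "N < u * (N div u + 1)" using u by (simp add: dividend_less_times_div)
        then have "real N < real (u * (N div u + 1))" by (rule iffD2[OF of_nat_less_iff])
        then have "real N \<le> real u * (real (N div u) + 1)" by (simp add: distrib_left)
        have "norm (w u * e (N div u)) \<le> (1 / real u) * (K / (real (N div u) + 1))"
          unfolding norm_mult e_def by (intro mult_mono w V) auto
        also have "\<dots> = K / (real u * (real (N div u) + 1))" by simp
        also have "\<dots> \<le> K / real N"
          using K \<open>real N \<le> _\<close> elim by (intro divide_left_mono) (auto intro!: mult_pos_pos)
        finally show "norm (w u * e (N div u)) \<le> K / real N" .
      qed
      also have "\<dots> = real (card ?L) * (K / real N)" by simp
      also have "\<dots> \<le> real (N div J) * (K / real N)"
      proof (intro mult_right_mono)
        have "?L \<subseteq> {1..N div J}"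
          using J by (auto simp: less_eq_div_iff_mult_less_eq mult.commute)
        then have "card ?L \<le> card {1..N div J}" by (intro card_mono) auto
        then show "real (card ?L) \<le> real (N div J)" by simp
      qed (use K in auto)
      also have "\<dots> \<le> (real N / real J) * (K / real N)"
        using K by (intro mult_right_mono) (auto intro: of_nat_div_le_of_nat)
      also have "\<dots> = K / real J" using elim by simp
      finally have "norm (\<Sum>u=1..N. w u * e (N div u)) < \<epsilon> / 2 + \<epsilon> / 2"
        unfolding eq using elim J by (intro norm_triangle_lt) linarith
      then show ?case by simp
    qed
  qed
  moreover have "(\<lambda>N. (\<Sum>u=1..N. w u) * C) \<longlonglongrightarrow> 0 * C" by (intro tendsto_mult W tendsto_const)
  ultimately have "(\<lambda>N. (\<Sum>u=1..N. w u * e (N div u)) + (\<Sum>u=1..N. w u) * C) \<longlonglongrightarrow> 0 + 0 * C"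
    by (rule tendsto_add)
  then show ?thesis
    by (simp add: e_def algebra_simps sum.distrib sum_distrib_left sum_distrib_right sum_subtractf)
qed

text \<open>Abel summation. The rate \<open>1 / (y + 1)\<close>, and not merely convergence, is what
  \<open>axer\<close> consumes; one \<open>B\<close> comes from the boundary term, the other from
  the tail of a telescoping majorant.\<close>

lemma sum_over_n_abel:
  fixes \<alpha> :: "nat \<Rightarrow> complex"
  assumes B: "\<And>y. norm (\<Sum>d=1..y. \<alpha> d) \<le> B"
  obtains C where "\<And>y. norm ((\<Sum>d=1..y. \<alpha> d / of_nat d) - C) \<le> 2 * B / (real y + 1)"
proof -
  define A where "A = (\<lambda>y. \<Sum>d=1..y. \<alpha> d)"
  define g where "g = (\<lambda>d. A (Suc d) * of_real (1 / real (Suc d) - 1 / real (Suc (Suc d))))"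
  have abel: "(\<Sum>d=1..y. \<alpha> d / of_nat d) = A y / of_nat (Suc y) + (\<Sum>d<y. g d)" for y
  proof (induction y)
    case (Suc y)
    have "\<alpha> (Suc y) = A (Suc y) - A y" by (simp add: A_def)
    then have 1: "\<alpha> (Suc y) / of_nat (Suc y) = A (Suc y) / of_nat (Suc y) - A y / of_nat (Suc y)"
      by (simp add: diff_divide_distrib)
    have 2: "g y = A (Suc y) / of_nat (Suc y) - A (Suc y) / of_nat (Suc (Suc y))"
      by (simp add: g_def right_diff_distrib)
    have "(\<Sum>d=1..Suc y. \<alpha> d / of_nat d) = (\<Sum>d=1..y. \<alpha> d / of_nat d) + \<alpha> (Suc y) / of_nat (Suc y)" by simp
    also have "\<dots> = A (Suc y) / of_nat (Suc (Suc y)) + (\<Sum>d<Suc y. g d)"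
      unfolding Suc 1 lessThan_Suc using 2 by simp
    finally show ?case .
  qed (simp add: A_def)
  have B0: "B \<ge> 0" using order_trans[OF norm_ge_zero B[of 0]] .
  have ts: "(\<lambda>d. B * (1 / real (Suc (d + y)) - 1 / real (Suc (Suc d + y)))) sums (B * (1 / real (Suc (0 + y)) - 0))" for y
    by (intro sums_mult telescope_sums') real_asymp
  have gb: "norm (g (d + y)) \<le> B * (1 / real (Suc (d + y)) - 1 / real (Suc (Suc d + y)))" for d y
  proof -
    have "0 \<le> 1 / real (Suc (d + y)) - 1 / real (Suc (Suc d + y))" by (simp add: field_simps)
    then show ?thesis unfolding g_def norm_mult norm_of_real A_def
      using B[of "Suc (d + y)"] B0 by (intro mult_mono) auto
  qed
  have g: "summable g"
    by (rule summable_comparison_test'[OF sums_summable[OF ts[of 0]]]) (use gb[of _ 0] in simp)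
  show ?thesis
  proof (rule that)
    fix y
    have "(\<Sum>d=1..y. \<alpha> d / of_nat d) - suminf g = A y / of_nat (Suc y) - (\<Sum>d. g (d + y))"
      unfolding abel suminf_minus_initial_segment[OF g] by simp
    also have "norm \<dots> \<le> norm (A y / of_nat (Suc y)) + norm (\<Sum>d. g (d + y))" by (rule norm_triangle_ineq4)
    also have "norm (A y / of_nat (Suc y)) \<le> B / (real y + 1)"
      unfolding norm_divide using B[of y] by (simp add: A_def divide_right_mono add.commute del: of_nat_Suc) (simp add: divide_right_mono)
    also have "norm (\<Sum>d. g (d + y)) \<le> (\<Sum>d. B * (1 / real (Suc (d + y)) - 1 / real (Suc (Suc d + y))))"
      by (rule norm_suminf_le[OF gb sums_summable[OF ts]])
    also have "\<dots> = B / (real y + 1)" using sums_unique[OF ts[of y]] by (simp add: add.commute)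
    finally show "norm ((\<Sum>d=1..y. \<alpha> d / of_nat d) - suminf g) \<le> 2 * B / (real y + 1)" by simp
  qed
qed

text \<open>Complete periods contribute zero, so a partial sum reduces to one of length below
  \<open>M\<close>. The proof sums from 0 and pays \<open>norm (\<alpha> 0)\<close> for the range
  that starts at 1.\<close>

lemma periodic_sum_bounded:
  fixes \<alpha> :: "nat \<Rightarrow> complex"
  assumes M: "M > 0" and per: "\<And>n. \<alpha> (n mod M) = \<alpha> n" and zero: "(\<Sum>n<M. \<alpha> n) = 0"
  obtains B where "\<And>y. norm (\<Sum>d=1..y. \<alpha> d) \<le> B"
proof -
  have per': "\<alpha> (n + M) = \<alpha> n" for n using per[of n] per[of "n + M"] by simp
  have shift: "(\<Sum>d<y + M. \<alpha> d) = (\<Sum>d<y. \<alpha> d)" for y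
    by (induction y) (simp_all add: zero per')
  have "(\<Sum>d<y + k * M. \<alpha> d) = (\<Sum>d<y. \<alpha> d)" for y k
  proof (induction k)
    case (Suc k)
    have "y + Suc k * M = (y + k * M) + M" by simp
    then show ?case by (simp only: shift Suc)
  qed simp
  from this[of "y mod M" "y div M" for y] have mod: "(\<Sum>d<y. \<alpha> d) = (\<Sum>d<y mod M. \<alpha> d)" for y by simp
  show ?thesis
  proof (rule that)
    fix y
    have "(\<Sum>d=1..y. \<alpha> d) = (\<Sum>d<Suc y. \<alpha> d) - \<alpha> 0"
      by (simp add: lessThan_Suc_atMost atMost_atLeast0 sum.atLeast_Suc_atMost)
    also have "norm \<dots> \<le> norm (\<Sum>d<Suc y. \<alpha> d) + norm (\<alpha> 0)" by (rule norm_triangle_ineq4)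
    also have "norm (\<Sum>d<Suc y. \<alpha> d) \<le> (\<Sum>d<Suc y mod M. norm (\<alpha> d))"
      by (subst mod) (rule norm_sum)
    also have "\<dots> \<le> (\<Sum>d<M. norm (\<alpha> d))"
      using M by (intro sum_mono2) (auto intro: less_trans)
    finally show "norm (\<Sum>d=1..y. \<alpha> d) \<le> (\<Sum>d<M. norm (\<alpha> d)) + norm (\<alpha> 0)" by simp
  qed
qed

lemma mob_coprime_periodic_tendsto:
  fixes \<alpha> :: "nat \<Rightarrow> complex"
  assumes M: "M > 0" and per: "\<And>n. \<alpha> (n mod M) = \<alpha> n" and zero: "(\<Sum>n<M. \<alpha> n) = 0"
  shows "(\<lambda>N. \<Sum>u=1..N. mob_coprime M u / of_nat u * (\<Sum>d=1..N div u. \<alpha> d / of_nat d)) \<longlonglongrightarrow> 0"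
proof -
  obtain B where B: "\<And>y. norm (\<Sum>d=1..y. \<alpha> d) \<le> B" using periodic_sum_bounded[OF assms] by blast
  obtain C where C: "\<And>y. norm ((\<Sum>d=1..y. \<alpha> d / of_nat d) - C) \<le> 2 * B / (real y + 1)"
    using sum_over_n_abel[OF B] by blast
  show ?thesis
  proof (rule axer[OF _ sum_mob_coprime_tendsto[OF M] C])
    show "norm (mob_coprime M u / of_nat u) \<le> 1 / real u" for u
      using norm_mob_coprime_le[of M u] by (simp add: norm_divide divide_right_mono)
  qed
qed

section \<open>The square-free kernel\<close>

lemma sum_divisors_flip:
  fixes F :: "nat \<Rightarrow> nat \<Rightarrow> 'a::comm_monoid_add"
  assumes "n > 0"
  shows "(\<Sum>d | d dvd n. F d (n div d)) = (\<Sum>d | d dvd n. F (n div d) d)"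
  by (rule sum.reindex_bij_witness[where i = "\<lambda>d. n div d" and j = "\<lambda>d. n div d"])
     (use assms in \<open>auto simp: div_dvd_iff_mult dvd_div_eq_mult\<close>)

lemma sqfree_kernel_eq: "n > 0 \<Longrightarrow> sqfree_kernel n = \<Prod>(prime_factors n)"
  unfolding sqfree_kernel_def by (intro prod.cong) (auto simp: in_prime_factors_iff)

lemma sqfree_kernel_1 [simp]: "sqfree_kernel (Suc 0) = 1"
  by (simp add: sqfree_kernel_eq)

lemma sqfree_kernel_pos: "n > 0 \<Longrightarrow> sqfree_kernel n > 0"
  by (auto simp: sqfree_kernel_eq in_prime_factors_iff intro!: prod_pos prime_gt_0_nat)

lemma sqfree_kernel_prime_power_mult:
  assumes "prime p" "k > 0" "\<not> p dvd n" "n > 0"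
  shows "sqfree_kernel (p ^ k * n) = p * sqfree_kernel n"
proof -
  have "x = p" if "prime x" "x dvd p ^ k" for x
    using prime_dvd_power[OF that] primes_dvd_imp_eq that assms by blast
  then have "prime_factors (p ^ k * n) = insert p (prime_factors n)"
    using assms by (auto simp: in_prime_factors_iff prime_dvd_mult_iff prime_gt_0_nat)
  moreover have "p \<notin> prime_factors n" using assms by auto
  ultimately show ?thesis using assms by (simp add: sqfree_kernel_eq prime_gt_0_nat)
qed

lemma prime_dvd_sqfree_kernel_iff:
  assumes "n > 0" "prime p"
  shows "p dvd sqfree_kernel n \<longleftrightarrow> p dvd n"
proof -
  have "p dvd \<Prod>(prime_factors n) \<longleftrightarrow> (\<exists>q\<in>prime_factors n. p dvd q)"
    using assms(2) by (simp add: prime_dvd_prod_iff)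
  also have "\<dots> \<longleftrightarrow> p dvd n"
    using assms by (auto simp: in_prime_factors_iff dest: primes_dvd_imp_eq intro!: bexI[of _ p])
  finally show ?thesis using assms by (simp add: sqfree_kernel_eq)
qed

lemma squarefree_sqfree_kernel:
  assumes "n > 0"
  shows "squarefree (sqfree_kernel n)"
  unfolding sqfree_kernel_eq[OF assms]
  by (rule squarefree_prod_coprime)
     (auto simp: in_prime_factors_iff primes_coprime intro: squarefree_prime)

lemma sqfree_kernel_squarefree:
  assumes "squarefree n"
  shows "sqfree_kernel n = n"
proof -
  have n: "n > 0" using assms by (cases n) auto
  have "n = (\<Prod>p\<in>prime_factors n. p ^ multiplicity p n)"
    using n prime_factorization_nat[of n] by simp
  also have "\<dots> = (\<Prod>p\<in>prime_factors n. p)"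
  proof (intro prod.cong refl)
    fix p assume p: "p \<in> prime_factors n"
    then have "multiplicity p n \<le> 1"
      using assms n squarefree_factorial_semiring''[of n] by auto
    moreover have "multiplicity p n > 0"
      using p n by (simp add: prime_multiplicity_gt_zero_iff in_prime_factors_iff)
    ultimately have "multiplicity p n = 1" by linarith
    then show "p ^ multiplicity p n = p" by simp
  qed
  finally show ?thesis using n by (simp add: sqfree_kernel_eq)
qed

definition squareful :: "nat \<Rightarrow> bool" where
  "squareful n \<longleftrightarrow> (\<forall>p. prime p \<longrightarrow> p dvd n \<longrightarrow> p\<^sup>2 dvd n)"

lemma squareful_prime_power_mult:
  assumes "prime p" "\<not> p dvd n"
  shows "squareful (p ^ k * n) \<longleftrightarrow> k \<noteq> 1 \<and> squareful n"
proof -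
  have cop: "coprime (p ^ j) n" for j
    using assms by (simp add: prime_imp_coprime)
  have q: "q dvd p ^ k * n \<longleftrightarrow> q dvd n" "q\<^sup>2 dvd p ^ k * n \<longleftrightarrow> q\<^sup>2 dvd n" if "prime q" "q \<noteq> p" for q
  proof -
    have "coprime q p" using that assms by (simp add: primes_coprime)
    then have "coprime q (p ^ k)" "coprime (q\<^sup>2) (p ^ k)" by simp_all
    then show "q dvd p ^ k * n \<longleftrightarrow> q dvd n" "q\<^sup>2 dvd p ^ k * n \<longleftrightarrow> q\<^sup>2 dvd n"
      by (simp_all add: coprime_dvd_mult_right_iff)
  qed
  have p: "p dvd p ^ k * n \<longleftrightarrow> k \<noteq> 0" "p\<^sup>2 dvd p ^ k * n \<longleftrightarrow> k \<ge> 2"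
  proof -
    show "p dvd p ^ k * n \<longleftrightarrow> k \<noteq> 0"
      using assms by (cases k) auto
    have "p\<^sup>2 dvd p ^ k * n \<longleftrightarrow> p\<^sup>2 dvd p ^ k"
      using cop[of 2] by (simp add: coprime_dvd_mult_left_iff)
    also have "\<dots> \<longleftrightarrow> k \<ge> 2"
      using prime_gt_1_nat[OF assms(1)] by (simp add: dvd_power_iff_le)
    finally show "p\<^sup>2 dvd p ^ k * n \<longleftrightarrow> k \<ge> 2" .
  qed
  have "squareful (p ^ k * n) \<longleftrightarrow> (p dvd p ^ k * n \<longrightarrow> p\<^sup>2 dvd p ^ k * n)
      \<and> (\<forall>q. prime q \<longrightarrow> q \<noteq> p \<longrightarrow> q dvd p ^ k * n \<longrightarrow> q\<^sup>2 dvd p ^ k * n)"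
    unfolding squareful_def using assms(1) by blast
  also have "\<dots> \<longleftrightarrow> k \<noteq> 1 \<and> (\<forall>q. prime q \<longrightarrow> q \<noteq> p \<longrightarrow> q dvd n \<longrightarrow> q\<^sup>2 dvd n)"
  proof -
    have "(p dvd p ^ k * n \<longrightarrow> p\<^sup>2 dvd p ^ k * n) \<longleftrightarrow> k \<noteq> 1" unfolding p by auto
    moreover have "(\<forall>q. prime q \<longrightarrow> q \<noteq> p \<longrightarrow> q dvd p ^ k * n \<longrightarrow> q\<^sup>2 dvd p ^ k * n) \<longleftrightarrow>
        (\<forall>q. prime q \<longrightarrow> q \<noteq> p \<longrightarrow> q dvd n \<longrightarrow> q\<^sup>2 dvd n)" using q by meson
    ultimately show ?thesis by simp
  qed
  also have "(\<forall>q. prime q \<longrightarrow> q \<noteq> p \<longrightarrow> q dvd n \<longrightarrow> q\<^sup>2 dvd n) \<longleftrightarrow> squareful n"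
    unfolding squareful_def using assms(2) by blast
  finally show ?thesis .
qed

lemma mob_prime_mult:
  assumes "prime p" "\<not> p dvd n"
  shows "mob (p * n) = - mob n"
  using assms by (simp add: mob_mult_coprime mob_prime prime_imp_coprime)

text \<open>The part of the correction factor that belongs to \<open>e\<close>: every prime of
  \<open>e\<close> contributes \<open>P (1 - P)\<close>, and expanding the second factors over
  \<open>r\<close> yields the sign \<open>mob r\<close> and the argument
  \<open>sqfree_kernel e * r\<close>. Since \<open>\<phi>\<close> need not be multiplicative, these
  factors act by multiplying its argument, and the cofactor \<open>c\<close> has to be carried
  along.\<close>

definition kernel_weight :: "(nat \<Rightarrow> complex) \<Rightarrow> nat \<Rightarrow> nat \<Rightarrow> complex" where
  "kernel_weight \<phi> e c = (if squareful e
     then \<Sum>r | r dvd sqfree_kernel e. of_int (mob r) * \<phi> (c * sqfree_kernel e * r) else 0)"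

text \<open>
  In the monoid ring of the positive integers, with \<open>P\<close> the class of the prime \<open>p\<close> and \<open>X\<close> in place of
  \<open>p^(-s)\<close>, the identity has the local factor \<open>1 + P X / (1 - X) = (1 - P (P - 1) X^2 / (1 - X)) / (1 - P X)\<close>.
\<close>
lemma sqfree_kernel_expansion:
  assumes "n > 0"
  shows "\<phi> (sqfree_kernel n) = (\<Sum>e | e dvd n. kernel_weight \<phi> e (n div e))"
  using assms
proof (induction n arbitrary: \<phi> rule: less_induct)
  case (less n)
  show ?case
  proof (cases "n = 1")
    case True
    then show ?thesis by (simp add: kernel_weight_def squareful_def)
  next
    case False
    then have "n > 1" using less.prems by simp
    then obtain p k m where *: "prime p" "k > 0" "\<not> p dvd m" "n = p ^ k * m" "m > 0" "m < n" "coprime (p ^ k) m"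
      by (rule prime_power_split)
    have p0: "p > 0" using *(1) by (rule prime_gt_0_nat)
    define h where "h = (\<lambda>i. \<phi> (p ^ i * sqfree_kernel m))"
    \<comment> \<open>The induction is general in \<open>\<phi>\<close> for this: the power of
      \<open>p\<close> is moved into the function, and \<open>m\<close> is expanded for
      \<open>c \<mapsto> \<phi> (p ^ i * c)\<close>.\<close>
    have IH: "h i = (\<Sum>y | y dvd m. kernel_weight (\<lambda>c. \<phi> (p ^ i * c)) y (m div y))" for i
      using less.IH[OF *(6,5), of "\<lambda>c. \<phi> (p ^ i * c)"] by (simp add: h_def)
    \<comment> \<open>\<open>G i\<close> collects the divisors of \<open>n\<close> with exact
      exponent \<open>i\<close> at \<open>p\<close>. Exponent 0 gives \<open>h k\<close>, exponent 1
      gives nothing since such divisors are not squareful, and the others telescope to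
      \<open>h 1 - h k\<close>; what remains is \<open>h 1\<close>.\<close>
    define G where "G = (\<lambda>i. \<Sum>y | y dvd m. kernel_weight \<phi> (p ^ i * y) (n div (p ^ i * y)))"
    have ndiv: "n div (p ^ i * y) = p ^ (k - i) * (m div y)" if "y dvd m" "i \<le> k" for i y
    proof -
      have "p ^ k = p ^ i * p ^ (k - i)" "m = y * (m div y)" using that by (simp_all flip: power_add)
      then have "p ^ k * m = (p ^ i * p ^ (k - i)) * (y * (m div y))" by (rule arg_cong2[of _ _ _ _ "(*)"])
      then have "n = (p ^ i * y) * (p ^ (k - i) * (m div y))" using *(4) by (simp only: mult_ac)
      then show ?thesis using p0 that *(5) by (metis dvd_pos_nat nat_0_less_mult_iff nonzero_mult_div_cancel_left not_gr0 zero_less_power)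
    qed
    have G0: "G 0 = h k"
      unfolding IH G_def
    proof (intro sum.cong refl)
      fix y assume "y \<in> {y. y dvd m}"
      then have y: "y dvd m" by simp
      show "kernel_weight \<phi> (p ^ 0 * y) (n div (p ^ 0 * y)) = kernel_weight (\<lambda>c. \<phi> (p ^ k * c)) y (m div y)"
        unfolding ndiv[OF y le0] by (simp add: kernel_weight_def mult.assoc)
    qed
    have G1: "G 1 = 0"
      unfolding G_def
    proof (intro sum.neutral ballI)
      fix y assume "y \<in> {y. y dvd m}"
      then have "\<not> p dvd y" using *(3) by (auto dest: dvd_trans)
      from squareful_prime_power_mult[OF *(1) this, of 1]
      show "kernel_weight \<phi> (p ^ 1 * y) (n div (p ^ 1 * y)) = 0" by (simp add: kernel_weight_def)
    qed
    have G2: "G i = h (Suc (k - i)) - h (Suc (Suc (k - i)))" if i: "2 \<le> i" "i \<le> k" for i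
      unfolding IH G_def sum_subtractf[symmetric]
    proof (intro sum.cong refl)
      fix y assume "y \<in> {y. y dvd m}"
      then have y: "y dvd m" by simp
      have py: "\<not> p dvd y" using *(3) y by (auto dest: dvd_trans)
      have y0: "y > 0" using y *(5) by (rule dvd_pos_nat[rotated])
      define c where "c = p ^ (k - i) * (m div y)"
      have ker: "sqfree_kernel (p ^ i * y) = p * sqfree_kernel y"
        using *(1) py y0 i by (intro sqfree_kernel_prime_power_mult) auto
      have pk: "\<not> p dvd sqfree_kernel y" using prime_dvd_sqfree_kernel_iff[OF y0 *(1)] py by simp
      show "kernel_weight \<phi> (p ^ i * y) (n div (p ^ i * y)) =
        kernel_weight (\<lambda>c. \<phi> (p ^ Suc (k - i) * c)) y (m div y) -
        kernel_weight (\<lambda>c. \<phi> (p ^ Suc (Suc (k - i)) * c)) y (m div y)"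
      proof (cases "squareful y")
        case False
        then have "\<not> squareful (p ^ i * y)" using squareful_prime_power_mult[OF *(1) py, of i] by simp
        then show ?thesis using False by (simp add: kernel_weight_def)
      next
        case True
        then have sq: "squareful (p ^ i * y)" using squareful_prime_power_mult[OF *(1) py, of i] i by simp
        define A where "A = (\<lambda>r. of_int (mob r) * \<phi> (c * (p * sqfree_kernel y) * r))"
        have "(\<Sum>r | r dvd p * sqfree_kernel y. A r) = (\<Sum>s | s dvd p ^ 1. \<Sum>r | r dvd sqfree_kernel y. A (s * r))"
          using sum_divisors_coprime_mult[of p "sqfree_kernel y" A]
            prime_imp_coprime[OF *(1) pk] p0 sqfree_kernel_pos[OF y0] by simp
        also have "\<dots> = (\<Sum>r | r dvd sqfree_kernel y. A r) + (\<Sum>r | r dvd sqfree_kernel y. A (p * r))"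
          unfolding sum_prime_power_divisors[OF *(1)] by simp
        also have "(\<Sum>r | r dvd sqfree_kernel y. A (p * r)) =
            - (\<Sum>r | r dvd sqfree_kernel y. of_int (mob r) * \<phi> (c * (p * sqfree_kernel y) * (p * r)))"
          unfolding sum_negf[symmetric]
        proof (intro sum.cong refl)
          fix r assume "r \<in> {r. r dvd sqfree_kernel y}"
          then have "\<not> p dvd r" using pk by (auto dest: dvd_trans)
          then show "A (p * r) = - (of_int (mob r) * \<phi> (c * (p * sqfree_kernel y) * (p * r)))"
            by (simp add: A_def mob_prime_mult[OF *(1)])
        qed
        finally show ?thesis
          unfolding ndiv[OF y i(2)] c_def[symmetric] using sq True
          by (simp add: kernel_weight_def ker A_def) (simp add: c_def mult_ac)
      qed
    qed
    have "(\<Sum>e | e dvd n. kernel_weight \<phi> e (n div e)) =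
        (\<Sum>x | x dvd p ^ k. \<Sum>y | y dvd m. kernel_weight \<phi> (x * y) (n div (x * y)))"
      unfolding *(4) using *(5,7) p0 by (intro sum_divisors_coprime_mult) auto
    also have "\<dots> = (\<Sum>i\<le>k. G i)" unfolding sum_prime_power_divisors[OF *(1)] G_def ..
    also have "\<dots> = G 0 + (\<Sum>i=1..k. G i)" by (simp add: atMost_atLeast0 sum.atLeast_Suc_atMost)
    also have "(\<Sum>i=1..k. G i) = G 1 + (\<Sum>i=2..k. G i)"
      using *(2) by (simp add: sum.atLeast_Suc_atMost numeral_2_eq_2)
    also have "(\<Sum>i=2..k. G i) = (\<Sum>i=2..k. h (Suc (k - i)) - h (Suc (Suc (k - i))))"
      by (intro sum.cong refl G2) auto
    also have "\<dots> = (\<Sum>j\<in>{1..<k}. h j - h (Suc j))"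
      by (rule sum.reindex_bij_witness[where i = "\<lambda>j. Suc (k - j)" and j = "\<lambda>i. Suc (k - i)"]) auto
    also have "\<dots> = h 1 - h k"
    proof -
      have "(\<Sum>j\<in>{1..<k}. h (Suc j) - h j) = h k - h 1"
        using *(2) by (intro sum_Suc_diff') auto
      moreover have "(\<Sum>j\<in>{1..<k}. h j - h (Suc j)) = - (\<Sum>j\<in>{1..<k}. h (Suc j) - h j)"
        unfolding sum_negf[symmetric] by simp
      ultimately show ?thesis by simp
    qed
    also have "G 0 + (G 1 + (h 1 - h k)) = h 1" unfolding G0 G1 by simp
    also have "h 1 = \<phi> (sqfree_kernel n)"
      unfolding h_def *(4) sqfree_kernel_prime_power_mult[OF *(1,2,3,5)] by simp
    finally show ?thesis by simp
  qed
qed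

section \<open>Summability over squareful numbers\<close>

lemma sum_card_divisors_le:
  "\<exists>B. \<forall>N. (\<Sum>n=1..N. real (card {d. d dvd n}) / (real n)\<^sup>2) \<le> B"
proof (intro exI allI)
  define g where "g = (\<lambda>n. 1 / (real n)\<^sup>2)"
  have s: "summable (\<lambda>n. g (Suc n))"
    using summable_Suc_powr[of "-2"] by (simp add: g_def powr_minus divide_inverse del: of_nat_Suc)
  have le: "(\<Sum>n=1..N. g n) \<le> (\<Sum>n. g (Suc n))" for N
    unfolding One_nat_def sum.atLeast1_atMost_eq by (intro sum_le_suminf s) (auto simp: g_def)
  have S: "(\<Sum>n. g (Suc n)) \<ge> 0" using le[of 0] by simp
  fix N
  \<comment> \<open>The number of divisors over \<open>n^2\<close> is the convolution of
    \<open>1 / n^2\<close> with itself, so the square of the sum of \<open>1 / n^2\<close> is a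
    bound.\<close>
  have "(\<Sum>n=1..N. real (card {d. d dvd n}) / (real n)\<^sup>2) = (\<Sum>n=1..N. \<Sum>d | d dvd n. g d * g (n div d))"
  proof (rule sum.cong[OF refl])
    fix n
    have "g d * g (n div d) = 1 / (real n)\<^sup>2" if "d dvd n" for d
      unfolding g_def of_nat_eq_mult_div[OF that] by (simp add: power_mult_distrib)
    then show "real (card {d. d dvd n}) / (real n)\<^sup>2 = (\<Sum>d | d dvd n. g d * g (n div d))" by simp
  qed
  also have "\<dots> = (\<Sum>d=1..N. g d * (\<Sum>k=1..N div d. g k))"
    unfolding sum_distrib_left by (rule sum_sum_divisors)
  also have "\<dots> \<le> (\<Sum>d=1..N. g d * (\<Sum>n. g (Suc n)))"
    by (intro sum_mono mult_left_mono le) (simp add: g_def)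
  also have "\<dots> \<le> (\<Sum>n. g (Suc n)) * (\<Sum>n. g (Suc n))"
    unfolding sum_distrib_right[symmetric] by (intro mult_right_mono le S)
  finally show "(\<Sum>n=1..N. real (card {d. d dvd n}) / (real n)\<^sup>2) \<le> \<dots>" .
qed

lemma card_divisors_mult_le:
  assumes "a > 0" "b > 0"
  shows "card {d::nat. d dvd a * b} \<le> card {d. d dvd a} * card {d. d dvd b}"
proof -
  have "{d. d dvd a * b} \<subseteq> (\<lambda>(x, y). x * y) ` ({d. d dvd a} \<times> {d. d dvd b})"
    by (auto elim!: dvd_productE)
  then have "card {d. d dvd a * b} \<le> card ((\<lambda>(x, y). x * y) ` ({d. d dvd a} \<times> {d. d dvd b}))"
    using assms by (intro card_mono) auto
  also have "\<dots> \<le> card ({d. d dvd a} \<times> {d. d dvd b})"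
    using assms by (intro card_image_le) auto
  finally show ?thesis by (simp add: card_cartesian_product)
qed

text \<open>Start from \<open>e = b * s^2\<close> with \<open>b\<close> square-free. Every prime of
  a squareful \<open>e\<close> has exponent at least 2 and hence divides \<open>s\<close>, so
  \<open>b\<close> and the kernel both divide \<open>s\<close>, and \<open>c = s div b\<close>. The
  last two conclusions give \<open>b\<close> and \<open>c\<close> as functions of \<open>e\<close>,
  which makes \<open>e \<mapsto> (b, c)\<close> available as a map for reindexing.\<close>

lemma squareful_decompose:
  assumes "squareful e" "e > 0"
  obtains b c where "e = b ^ 3 * c\<^sup>2" "b > 0" "c > 0" "sqfree_kernel e dvd b * c"
    "b = squarefree_part e" "c = square_part e div squarefree_part e"
proof -
  define b s where "b = squarefree_part e" and "s = square_part e"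
  have e: "e = b * s\<^sup>2" unfolding b_def s_def by (rule squarefree_decompose)
  have pos: "b > 0" "s > 0" using assms(2) e by (auto intro: Nat.gr0I)
  have mult: "multiplicity p e \<ge> 2" if "prime p" "p dvd e" for p
  proof -
    have "p\<^sup>2 dvd e" using that assms(1) unfolding squareful_def by blast
    then show ?thesis
      by (rule multiplicity_geI[rotated -1]) (use that assms(2) in auto)
  qed
  have sq: "squarefree n \<Longrightarrow> n > 0 \<Longrightarrow> (\<And>p. prime p \<Longrightarrow> p dvd n \<Longrightarrow> p dvd s) \<Longrightarrow> n dvd s" for n
  proof -
    assume n: "squarefree n" "n > 0" "\<And>p. prime p \<Longrightarrow> p dvd n \<Longrightarrow> p dvd s"
    show "n dvd s"
    proof (rule multiplicity_le_imp_dvd)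
      fix p :: nat assume p: "prime p"
      show "multiplicity p n \<le> multiplicity p s"
      proof (cases "p dvd n")
        case True
        then have "multiplicity p s > 0" using n(3) p pos by (simp add: prime_multiplicity_gt_zero_iff)
        moreover have "multiplicity p n \<le> 1"
          using n(1,2) p squarefree_factorial_semiring''[of n] by auto
        ultimately show ?thesis by linarith
      qed (simp add: not_dvd_imp_multiplicity_0)
    qed (use n in auto)
  qed
  have ps: "p dvd s" if "prime p" "p dvd e" for p
  proof -
    have "multiplicity p s = multiplicity p e div 2"
      unfolding s_def using that(1) by (rule prime_multiplicity_square_part)
    then have "multiplicity p s > 0" using mult[OF that] by simp
    then show ?thesis using that pos by (simp add: prime_multiplicity_gt_zero_iff)
  qed
  have bsq: "squarefree b" unfolding b_def by simp
  have "b dvd e" using e by (metis dvd_triv_left)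
  then have "b dvd s"
    using ps by (intro sq[OF bsq pos(1)]) (blast intro: dvd_trans)
  then have s: "s = b * (s div b)" by simp
  have c: "s div b > 0" using s pos by (metis mult_0_right neq0_conv)
  have "sqfree_kernel e dvd s"
    by (rule sq[OF squarefree_sqfree_kernel[OF assms(2)] sqfree_kernel_pos[OF assms(2)]])
       (use ps prime_dvd_sqfree_kernel_iff[OF assms(2)] in blast)
  then have "sqfree_kernel e dvd b * (s div b)" using s by simp
  moreover have "e = b ^ 3 * (s div b)\<^sup>2"
    using e by (subst (asm) s) (simp add: power2_eq_square power3_eq_cube mult_ac)
  moreover have "s div b = square_part e div squarefree_part e" by (simp only: b_def s_def)
  ultimately show ?thesis using that[OF _ pos(1) c _ b_def] by blast
qed

text \<open>A majorant for the contribution of \<open>kernel_weight\<close> at \<open>e\<close>,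
  divided by \<open>e\<close>: one unit for each \<open>r\<close>.\<close>

definition squareful_weight :: "nat \<Rightarrow> real" where
  "squareful_weight e = (if squareful e then real (card {r. r dvd sqfree_kernel e}) / real e else 0)"

text \<open>Let \<open>d\<close> count divisors. With \<open>e = b^3 * c^2\<close> the kernel has at
  most \<open>d(b) * d(c)\<close> divisors, and \<open>e \<ge> b^2 * c^2\<close>; the sum is bounded
  by the square of the sum of \<open>d(n) / n^2\<close>.\<close>

lemma summable_squareful_weight: "summable (\<lambda>e. squareful_weight (Suc e))"
proof -
  define g where "g = (\<lambda>n. real (card {d. d dvd n}) / (real n)\<^sup>2)"
  have gnn: "g x \<ge> 0" for x by (simp add: g_def)
  obtain S where gS: "\<And>N. (\<Sum>n=1..N. g n) \<le> S" using sum_card_divisors_le unfolding g_def by blast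
  have nn: "squareful_weight e \<ge> 0" for e by (simp add: squareful_weight_def)
  define h where "h = (\<lambda>e::nat. (squarefree_part e, square_part e div squarefree_part e))"
  have bound: "(\<Sum>e<N. squareful_weight (Suc e)) \<le> S * S" for N
  proof -
    define E where "E = {e \<in> {1..N}. squareful e}"
    have key: "h e \<in> {1..N} \<times> {1..N} \<and> squareful_weight e \<le> (case h e of (b, c) \<Rightarrow> g b * g c)
        \<and> e = (case h e of (b, c) \<Rightarrow> b ^ 3 * c\<^sup>2)" if "e \<in> E" for e
    proof -
      have sq: "squareful e" "e > 0" "e \<le> N" using that by (auto simp: E_def)
      obtain b c where bc: "e = b ^ 3 * c\<^sup>2" "b > 0" "c > 0" "sqfree_kernel e dvd b * c"
        "b = squarefree_part e" "c = square_part e div squarefree_part e"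
        by (rule squareful_decompose[OF sq(1,2)])
      have h: "h e = (b, c)" by (simp only: h_def bc(5,6))
      have "b dvd e" "c dvd e" using bc(1) by (auto simp: power2_eq_square power3_eq_cube)
      then have "b \<le> N" "c \<le> N" using sq by (auto dest: dvd_imp_le)
      moreover have "squareful_weight e \<le> g b * g c"
      proof -
        have "card {r. r dvd sqfree_kernel e} \<le> card {r. r dvd b * c}"
          using bc by (intro card_mono) (auto intro: dvd_trans)
        also have "\<dots> \<le> card {r. r dvd b} * card {r. r dvd c}" using bc by (intro card_divisors_mult_le)
        finally have "real (card {r. r dvd sqfree_kernel e}) \<le> real (card {r. r dvd b}) * real (card {r. r dvd c})"
          by (metis of_nat_le_iff of_nat_mult)
        then have "squareful_weight e \<le> real (card {r. r dvd b}) * real (card {r. r dvd c}) / real e"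
          using sq by (simp add: squareful_weight_def divide_right_mono)
        also have "\<dots> \<le> real (card {r. r dvd b}) * real (card {r. r dvd c}) / real (b\<^sup>2 * c\<^sup>2)"
          using bc(1-3) by (intro divide_left_mono) (auto intro!: mult_right_mono power_increasing simp: Suc_le_eq simp flip: of_nat_mult of_nat_power)
        finally show ?thesis by (simp add: g_def)
      qed
      ultimately show ?thesis unfolding h using bc(2,3) by (simp add: Suc_le_eq flip: bc(1))
    qed
    have inj: "inj_on h E"
      by (rule inj_on_inverseI[where g = "\<lambda>(b, c). b ^ 3 * c\<^sup>2"]) (rule sym, use key in blast)
    have img: "h ` E \<subseteq> {1..N} \<times> {1..N}" using key by blast
    have "(\<Sum>e<N. squareful_weight (Suc e)) = (\<Sum>e=1..N. squareful_weight e)"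
      by (simp add: sum.atLeast1_atMost_eq)
    also have "\<dots> = (\<Sum>e\<in>E. squareful_weight e)"
      unfolding E_def by (intro sum.mono_neutral_right) (auto simp: squareful_weight_def)
    also have "\<dots> \<le> (\<Sum>e\<in>E. case h e of (b, c) \<Rightarrow> g b * g c)" using key by (intro sum_mono) blast
    also have "\<dots> = (\<Sum>x\<in>h ` E. case x of (b, c) \<Rightarrow> g b * g c)" by (simp add: sum.reindex[OF inj])
    also have "\<dots> \<le> (\<Sum>x\<in>{1..N} \<times> {1..N}. case x of (b, c) \<Rightarrow> g b * g c)"
      by (intro sum_mono2 img) (auto intro!: mult_nonneg_nonneg gnn)
    also have "\<dots> = (\<Sum>x=1..N. g x) * (\<Sum>x=1..N. g x)"
      by (simp add: sum_product sum.cartesian_product)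
    also have "\<dots> \<le> S * S"
      using gS[of 0] by (intro mult_mono gS sum_nonneg gnn) simp
    finally show ?thesis .
  qed
  show ?thesis
    by (rule summableI_nonneg_bounded[OF nn bound])
qed

section \<open>Zero-mean functions and residue classes of the kernel\<close>

definition sqfree_transform :: "(nat \<Rightarrow> complex) \<Rightarrow> nat \<Rightarrow> complex" where
  "sqfree_transform \<phi> d = (if squarefree d then \<Sum>t | t dvd d. \<phi> t * of_int (mob (d div t)) else 0)"

text \<open>The kernel does not see exponents. If \<open>p^2\<close> divides \<open>d\<close>, the
  divisors \<open>y\<close> and \<open>p * y\<close> with \<open>y\<close> prime to \<open>p\<close>
  have opposite \<open>mob\<close>, while their cofactors in \<open>d\<close> are both still
  multiples of \<open>p\<close> and share the same kernel; so everything cancels.\<close>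

lemma eratosthenes_IPPification:
  assumes "d > 0"
  shows "eratosthenes (IPPification \<phi>) d = sqfree_transform \<phi> d"
proof (cases "squarefree d")
  case True
  then have "sqfree_kernel t = t" if "t dvd d" for t
    using that True by (metis sqfree_kernel_squarefree squarefree_mono)
  then show ?thesis using True by (simp add: eratosthenes_def IPPification_def sqfree_transform_def)
next
  case False
  then obtain p where p: "prime p" "multiplicity p d > 1"
    using squarefree_factorial_semiring''[of d] assms by (auto simp: not_le)
  define k where "k = multiplicity p d"
  have k: "k \<ge> 2" using p by (simp add: k_def)
  obtain m where m: "d = p ^ k * m" "\<not> p dvd m"
    by (rule multiplicity_decompose'[of d p]) (use p assms in \<open>auto simp: k_def\<close>)
  have m0: "m > 0" using m(1) assms by (cases m) auto
  have p0: "p > 0" using p(1) by (rule prime_gt_0_nat)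
  have cop: "coprime (p ^ k) m" using p m by (simp add: prime_imp_coprime)
  define f where "f = (\<lambda>t. of_int (mob t) * IPPification \<phi> (d div t))"
  have "eratosthenes (IPPification \<phi>) d = (\<Sum>t | t dvd d. f t)"
    unfolding eratosthenes_def f_def
    by (subst sum_divisors_flip[OF assms, symmetric]) (simp add: mult.commute)
  also have "\<dots> = (\<Sum>x | x dvd p ^ k. \<Sum>y | y dvd m. f (x * y))"
    unfolding m(1) using p0 m0 cop by (intro sum_divisors_coprime_mult) auto
  also have "\<dots> = (\<Sum>i\<le>k. \<Sum>y | y dvd m. f (p ^ i * y))" by (rule sum_prime_power_divisors[OF p(1)])
  also have "\<dots> = (\<Sum>y | y dvd m. \<Sum>i\<le>k. f (p ^ i * y))" by (rule sum.swap)
  also have "\<dots> = 0"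
  proof (rule sum.neutral, rule ballI)
    fix y assume "y \<in> {y. y dvd m}"
    then have y: "y dvd m" by simp
    have py: "\<not> p dvd y" using m(2) y by (auto dest: dvd_trans)
    have y0: "y > 0" using y m0 by (rule dvd_pos_nat[rotated])
    have my: "m div y > 0" "\<not> p dvd m div y"
      using y m0 m(2) by (auto elim!: dvdE)
    have "(\<Sum>i\<le>k. f (p ^ i * y)) = (\<Sum>i\<in>{0,1}. f (p ^ i * y))"
    proof (intro sum.mono_neutral_right)
      show "\<forall>i\<in>{..k} - {0, 1}. f (p ^ i * y) = 0"
      proof
        fix i assume "i \<in> {..k} - {0, 1}"
        then have "i \<ge> 2" by auto
        then have "mob (p ^ i * y) = 0"
          using p(1) py by (simp add: mob_mult_coprime mob_prime_power prime_imp_coprime)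
        then show "f (p ^ i * y) = 0" by (simp add: f_def)
      qed
    qed (use k in auto)
    also have "\<dots> = f y + f (p * y)" by simp
    also have "f (p * y) = - f y"
    proof -
      have "d div y = p ^ k * (m div y)" using y m(1) by (simp add: div_mult_swap)
      moreover have "d div (p * y) = p ^ (k - 1) * (m div y)"
      proof -
        have "p ^ k = p * p ^ (k - 1)" using k by (simp add: power_eq_if)
        then have "d div (p * y) = (p * (p ^ (k - 1) * m)) div (p * y)" using m(1) by (simp add: mult.assoc)
        also have "\<dots> = p ^ (k - 1) * m div y" using p0 by simp
        finally show ?thesis using y by (simp add: div_mult_swap)
      qed
      ultimately have "sqfree_kernel (d div y) = sqfree_kernel (d div (p * y))"
        using sqfree_kernel_prime_power_mult[OF p(1) _ my(2,1), of k] k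
          sqfree_kernel_prime_power_mult[OF p(1) _ my(2,1), of "k - 1"] by simp
      then show ?thesis
        using mob_prime_mult[OF p(1) py] by (simp add: f_def IPPification_def)
    qed
    finally show "(\<Sum>i\<le>k. f (p ^ i * y)) = 0" by simp
  qed
  finally show ?thesis using False by (simp add: sqfree_transform_def)
qed

lemma coprime_sqfree_kernel_iff:
  assumes "n > 0"
  shows "coprime (sqfree_kernel n) M \<longleftrightarrow> coprime n M"
  unfolding coprime_iff_no_common_prime using prime_dvd_sqfree_kernel_iff[OF assms] by simp

text \<open>When \<open>k\<close> is not prime to \<open>M\<close>, in each factorization
  \<open>d * (k div d)\<close> one factor shares a prime with \<open>M\<close>, and the
  corresponding value is 0. Otherwise the coprimality conditions are void and the sum is the
  transform.\<close>

lemma sum_mob_coprime_kernel: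
  assumes "k > 0" "M > 0" and supp: "\<And>n. \<not> coprime n M \<Longrightarrow> \<alpha> n = 0"
  shows "(\<Sum>d | d dvd k. mob_coprime M d * \<alpha> (sqfree_kernel (k div d)))
     = (if coprime k M then sqfree_transform \<alpha> k else 0)"
proof (cases "coprime k M")
  case True
  have "(\<Sum>d | d dvd k. mob_coprime M d * \<alpha> (sqfree_kernel (k div d))) =
      (\<Sum>d | d dvd k. of_int (mob d) * IPPification \<alpha> (k div d))"
    using True coprime_divisors[OF _ dvd_refl True]
    by (intro sum.cong refl) (simp add: mob_coprime_def IPPification_def)
  also have "\<dots> = eratosthenes (IPPification \<alpha>) k"
    unfolding eratosthenes_def
    by (subst (2) sum_divisors_flip[OF assms(1)]) (simp add: mult.commute)
  finally show ?thesis using True assms by (simp add: eratosthenes_IPPification)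
next
  case False
  have "mob_coprime M d * \<alpha> (sqfree_kernel (k div d)) = 0" if d: "d dvd k" for d
  proof (cases "coprime d M")
    case True
    have "k = d * (k div d)" using d by simp
    then have "\<not> coprime (k div d) M" using False True by (metis coprime_mult_left_iff)
    moreover have "k div d > 0" using d assms(1) by (auto simp: div_greater_zero_iff dvd_imp_le intro: dvd_pos_nat)
    ultimately show ?thesis using supp by (simp add: coprime_sqfree_kernel_iff)
  qed (simp add: mob_coprime_def)
  then show ?thesis using False by (simp add: sum.neutral)
qed

definition sqfree_coprime_sum :: "nat \<Rightarrow> (nat \<Rightarrow> complex) \<Rightarrow> nat \<Rightarrow> complex" where
  "sqfree_coprime_sum M \<alpha> N = (\<Sum>k=1..N. if coprime k M then sqfree_transform \<alpha> k / of_nat k else 0)"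

text \<open>The partial sum is a triple Dirichlet product: \<open>mob_coprime M u / u\<close>, a
  periodic function over \<open>d\<close>, and weights over squareful \<open>e\<close>. The first
  two, both only conditionally convergent, are kept together in \<open>T\<close>; the sum over
  \<open>e\<close> converges absolutely, so \<open>sum_div_tendsto\<close> applies to it.\<close>

lemma zero_mean_tendsto:
  fixes \<alpha> :: "nat \<Rightarrow> complex"
  assumes M: "M > 0" and per: "\<And>n. \<alpha> (n mod M) = \<alpha> n" and zero: "(\<Sum>n<M. \<alpha> n) = 0"
    and supp: "\<And>n. \<not> coprime n M \<Longrightarrow> \<alpha> n = 0"
  shows "sqfree_coprime_sum M \<alpha> \<longlonglongrightarrow> 0"
proof -
  define w where "w = (\<lambda>u. mob_coprime M u / of_nat u)"
  define b where "b = (\<lambda>t. \<alpha> (sqfree_kernel t) / of_nat t)"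
  define k where "k = (\<lambda>e d. kernel_weight \<alpha> e d / (of_nat e * of_nat d))"
  define T where "T = (\<lambda>k Y. \<Sum>u=1..Y. w u * (\<Sum>d=1..Y div u. \<alpha> (k * d) / of_nat d))"
  \<comment> \<open>\<open>T k\<close> depends on \<open>k\<close> modulo \<open>M\<close> only, so
    this finite sum dominates all of them at once. This uniformity allows the multipliers
    \<open>sqfree_kernel e * r\<close> to vary with \<open>e\<close>.\<close>
  define Ts where "Ts = (\<lambda>Y. \<Sum>k<M. norm (T k Y))"
  have T_lim: "T k \<longlonglongrightarrow> 0" for k
    unfolding T_def w_def
  proof (rule mob_coprime_periodic_tendsto[OF M])
    show "\<alpha> (k * (n mod M)) = \<alpha> (k * n)" for n
      using per[of "k * (n mod M)"] per[of "k * n"] by (simp add: mod_mult_right_eq)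
    \<comment> \<open>A unit \<open>k\<close> permutes the residues and preserves the zero mean; for
      any other \<open>k\<close> all values vanish by the support condition.\<close>
    show "(\<Sum>n<M. \<alpha> (k * n)) = 0"
    proof (cases "coprime k M")
      case True
      show ?thesis
        using sum.reindex_bij_betw[OF bij_betw_mult_mod[OF True M], of \<alpha>] by (simp add: per zero)
    next
      case False
      then have "\<alpha> (k * n) = 0" for n by (intro supp) (simp add: coprime_mult_left_iff)
      then show ?thesis by simp
    qed
  qed
  have Ts: "Ts \<longlonglongrightarrow> 0"
  proof -
    have "Ts \<longlonglongrightarrow> (\<Sum>k<M. norm (0::complex))" unfolding Ts_def by (intro tendsto_sum tendsto_norm T_lim)
    then show ?thesis by simp
  qed
  have T_le: "norm (T k Y) \<le> Ts Y" for k Y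
  proof -
    have "\<alpha> (k * d) = \<alpha> (k mod M * d)" for d
      using per[of "k * d"] per[of "k mod M * d"] by (simp add: mod_mult_left_eq)
    then have "T k Y = T (k mod M) Y" by (simp add: T_def)
    also have "norm \<dots> \<le> Ts Y"
      unfolding Ts_def using M by (intro member_le_sum) auto
    finally show ?thesis .
  qed
  define Q where "Q = (\<lambda>e Y. \<Sum>u=1..Y. w u * (\<Sum>d=1..Y div u. kernel_weight \<alpha> e d / of_nat d))"
  have Q_le: "norm (Q e Y / of_nat e) \<le> squareful_weight e * Ts Y" for e Y
  proof (cases "squareful e")
    case True
    have "Q e Y = (\<Sum>u=1..Y. \<Sum>r | r dvd sqfree_kernel e. of_int (mob r) *
        (w u * (\<Sum>d=1..Y div u. \<alpha> ((sqfree_kernel e * r) * d) / of_nat d)))"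
      unfolding Q_def
    proof (intro sum.cong refl)
      fix u assume "u \<in> {1..Y}"
      have "(\<Sum>d=1..Y div u. kernel_weight \<alpha> e d / of_nat d) =
          (\<Sum>d=1..Y div u. \<Sum>r | r dvd sqfree_kernel e. of_int (mob r) * (\<alpha> ((sqfree_kernel e * r) * d) / of_nat d))"
        using True by (simp add: kernel_weight_def sum_divide_distrib mult_ac)
      also have "\<dots> = (\<Sum>r | r dvd sqfree_kernel e. of_int (mob r) * (\<Sum>d=1..Y div u. \<alpha> ((sqfree_kernel e * r) * d) / of_nat d))"
        by (subst sum.swap) (simp add: sum_distrib_left)
      finally show "w u * (\<Sum>d=1..Y div u. kernel_weight \<alpha> e d / of_nat d) =
          (\<Sum>r | r dvd sqfree_kernel e. of_int (mob r) *
            (w u * (\<Sum>d=1..Y div u. \<alpha> ((sqfree_kernel e * r) * d) / of_nat d)))"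
        by (simp only: sum_distrib_left mult.left_commute)
    qed
    also have "\<dots> = (\<Sum>r | r dvd sqfree_kernel e. of_int (mob r) * T (sqfree_kernel e * r) Y)"
      unfolding T_def by (subst sum.swap) (simp only: sum_distrib_left)
    finally have Qe: "Q e Y = (\<Sum>r | r dvd sqfree_kernel e. of_int (mob r) * T (sqfree_kernel e * r) Y)" .
    have "norm (Q e Y) \<le> (\<Sum>r | r dvd sqfree_kernel e. Ts Y)"
      unfolding Qe
    proof (rule sum_norm_le)
      fix r
      have "norm (of_int (mob r) * T (sqfree_kernel e * r) Y) \<le> 1 * Ts Y"
        unfolding norm_mult by (intro mult_mono norm_mob_le T_le) auto
      then show "norm (of_int (mob r) * T (sqfree_kernel e * r) Y) \<le> Ts Y" by simp
    qed
    then have "norm (Q e Y) \<le> real (card {r. r dvd sqfree_kernel e}) * Ts Y" by simp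
    then have "norm (Q e Y) / real e \<le> real (card {r. r dvd sqfree_kernel e}) * Ts Y / real e"
      by (rule divide_right_mono) simp
    then show ?thesis using True by (simp add: squareful_weight_def norm_divide)
  next
    case False
    then have "Q e Y = 0" by (simp add: Q_def kernel_weight_def)
    then show ?thesis using False by (simp add: squareful_weight_def)
  qed
  have eq: "sqfree_coprime_sum M \<alpha> N = (\<Sum>e=1..N. Q e (N div e) / of_nat e)" for N
  proof -
    have "sqfree_coprime_sum M \<alpha> N = (\<Sum>n=1..N. \<Sum>d | d dvd n. w d *
        b (n div d))"
      unfolding sqfree_coprime_sum_def
    proof (intro sum.cong refl)
      fix n assume n: "n \<in> {1..N}"
      have "(if coprime n M then sqfree_transform \<alpha> n / of_nat n else 0) =
          (\<Sum>d | d dvd n. mob_coprime M d * \<alpha> (sqfree_kernel (n div d))) / of_nat n"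
        using n M supp by (subst sum_mob_coprime_kernel) auto
      also have "\<dots> = (\<Sum>d | d dvd n. w d * b (n div d))"
        unfolding sum_divide_distrib by (intro sum.cong refl) (simp add: of_nat_eq_mult_div[of _ n] w_def b_def)
      finally show "(if coprime n M then sqfree_transform \<alpha> n / of_nat n else 0) = \<dots>" .
    qed
    also have "\<dots> = (\<Sum>u=1..N. \<Sum>t=1..N div u. w u * b t)"
      by (rule sum_sum_divisors)
    also have "\<dots> = (\<Sum>u=1..N. w u * (\<Sum>t=1..N div u. b t))"
      by (simp only: sum_distrib_left)
    also have "\<dots> = (\<Sum>u=1..N. w u *
        (\<Sum>e=1..N div u. \<Sum>d=1..N div u div e. k e d))"
    proof (rule sum.cong[OF refl], rule arg_cong2[of _ _ _ _ "(*)", OF refl])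
      fix u
      have "(\<Sum>t=1..N div u. b t) =
          (\<Sum>t=1..N div u. \<Sum>e | e dvd t. k e (t div e))"
      proof (intro sum.cong refl)
        fix t assume t: "t \<in> {1..N div u}"
        have "b t = (\<Sum>e | e dvd t. kernel_weight \<alpha> e (t div e) / of_nat t)"
          unfolding b_def using t by (subst sqfree_kernel_expansion) (auto simp: sum_divide_distrib)
        also have "\<dots> = (\<Sum>e | e dvd t. k e (t div e))"
          by (intro sum.cong refl) (simp add: of_nat_eq_mult_div[of _ t] k_def)
        finally show "b t = \<dots>" .
      qed
      also have "\<dots> = (\<Sum>e=1..N div u. \<Sum>d=1..N div u div e. k e d)"
        by (rule sum_sum_divisors)
      finally show "(\<Sum>t=1..N div u. b t) = \<dots>" .
    qed
    also have "\<dots> = (\<Sum>u=1..N. \<Sum>e=1..N div u. w u *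
        (\<Sum>d=1..N div u div e. k e d))"
      by (simp only: sum_distrib_left)
    \<comment> \<open>With \<open>e\<close> outermost, the sums over \<open>u\<close> and
      \<open>d\<close> form a complete partial sum with cutoff \<open>N div e\<close>.\<close>
    also have "\<dots> = (\<Sum>e=1..N. \<Sum>u=1..N div e. w u *
        (\<Sum>d=1..N div u div e. k e d))"
      by (rule sum_div_swap)
    also have "\<dots> = (\<Sum>e=1..N. Q e (N div e) / of_nat e)"
    proof (intro sum.cong refl)
      fix e
      have "N div u div e = N div e div u" for u by (simp add: div_mult2_eq[symmetric] mult.commute)
      then show "(\<Sum>u=1..N div e. w u *
          (\<Sum>d=1..N div u div e. k e d)) = Q e (N div e) / of_nat e"
        unfolding Q_def sum_divide_distrib
        by (intro sum.cong refl) (simp add: k_def sum_divide_distrib sum_distrib_left mult_ac)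
    qed
    finally show ?thesis .
  qed
  have "(\<lambda>N. \<Sum>e=1..N. squareful_weight e * Ts (N div e)) \<longlonglongrightarrow> (\<Sum>n. squareful_weight (Suc n)) * 0"
  proof (rule sum_div_tendsto[OF _ Ts])
    have "norm (squareful_weight e) = squareful_weight e" for e by (simp add: squareful_weight_def)
    then show "summable (\<lambda>n. norm (squareful_weight (Suc n)))" using summable_squareful_weight by simp
  qed
  then have lim: "(\<lambda>N. \<Sum>e=1..N. squareful_weight e * Ts (N div e)) \<longlonglongrightarrow> 0" by simp
  show ?thesis
  proof (rule Lim_null_comparison[OF always_eventually lim], rule allI)
    fix N
    show "norm (sqfree_coprime_sum M \<alpha> N) \<le> (\<Sum>e=1..N. squareful_weight e * Ts (N div e))"
      unfolding eq by (intro sum_norm_le Q_le)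
  qed
qed

lemma sqfree_coprime_sum_cong:
  assumes "\<And>n. coprime n M \<Longrightarrow> \<alpha> n = \<beta> n"
  shows "sqfree_coprime_sum M \<alpha> = sqfree_coprime_sum M \<beta>"
proof
  fix N
  have "sqfree_transform \<alpha> k = sqfree_transform \<beta> k" if "coprime k M" for k
    using assms coprime_divisors[OF _ dvd_refl that] by (auto simp: sqfree_transform_def intro!: sum.cong)
  then show "sqfree_coprime_sum M \<alpha> N = sqfree_coprime_sum M \<beta> N"
    by (auto simp: sqfree_coprime_sum_def intro!: sum.cong)
qed

lemma sqfree_coprime_sum_diff:
  "sqfree_coprime_sum M (\<lambda>n. \<alpha> n - \<beta> n) N = sqfree_coprime_sum M \<alpha> N - sqfree_coprime_sum M \<beta> N"
  unfolding sqfree_coprime_sum_def sum_subtractf[symmetric]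
  by (intro sum.cong refl) (simp add: sqfree_transform_def left_diff_distrib sum_subtractf diff_divide_distrib)

lemma sqfree_coprime_sum_sum:
  "sqfree_coprime_sum M (\<lambda>n. \<Sum>b\<in>B. \<alpha> b n) N = (\<Sum>b\<in>B. sqfree_coprime_sum M (\<alpha> b) N)"
proof -
  have "sqfree_transform (\<lambda>n. \<Sum>b\<in>B. \<alpha> b n) k = (\<Sum>b\<in>B. sqfree_transform (\<alpha> b) k)" for k
    unfolding sqfree_transform_def by (simp add: sum_distrib_right sum.swap[of _ B])
  then show ?thesis
    unfolding sqfree_coprime_sum_def
    by (subst sum.swap) (auto intro!: sum.cong simp: sum_divide_distrib)
qed

lemma sqfree_coprime_sum_1:
  assumes "N > 0"
  shows "sqfree_coprime_sum M (\<lambda>_. 1) N = 1"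
proof -
  have "sqfree_transform (\<lambda>_. 1) k = (if k = 1 then 1 else 0)" if "k > 0" for k
  proof -
    have "(\<Sum>t | t dvd k. of_int (mob (k div t))) = (of_int (\<Sum>t | t dvd k. mob t) :: complex)"
      using sum_divisors_flip[OF that, of "\<lambda>_ t. of_int (mob t)"] by simp
    then show ?thesis using sum_mob[OF that] by (auto simp: sqfree_transform_def)
  qed
  then have "sqfree_coprime_sum M (\<lambda>_. 1) N = (\<Sum>k\<in>{1..N}. if k = 1 then 1 else 0)"
    unfolding sqfree_coprime_sum_def by (intro sum.cong) auto
  then show ?thesis using assms by simp
qed

section \<open>Equidistribution among the coprime residue classes\<close>

lemma sum_totatives_cong:
  assumes "coprime t m" "m > 0"
  shows "(\<Sum>b\<in>totatives m. if [t = b] (mod m) then 1 else 0 :: complex) = 1"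
proof (cases "m = 1")
  case True
  then show ?thesis by simp
next
  case False
  then have m: "m > 1" using assms by simp
  have "{b \<in> totatives m. [t = b] (mod m)} = {t mod m}"
  proof (intro equalityI subsetI)
    fix b assume "b \<in> {b \<in> totatives m. [t = b] (mod m)}"
    then show "b \<in> {t mod m}" using totatives_less[of b m] m by (auto simp: unique_euclidean_semiring_class.cong_def)
  next
    fix b assume "b \<in> {t mod m}"
    moreover have "t mod m > 0" using assms m by (auto intro: Nat.gr0I simp: mod_eq_0_iff_dvd dest: coprime_common_divisor_nat[of t m m])
    ultimately show "b \<in> {b \<in> totatives m. [t = b] (mod m)}"
      using assms m by (auto simp: in_totatives_iff unique_euclidean_semiring_class.cong_def intro: less_imp_le mod_less_divisor)
  qed
  then show ?thesis by (simp add: sum.inter_filter[symmetric])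
qed

text \<open>Chinese remainder theorem with \<open>c\<close> congruent to \<open>b' / b\<close>
  modulo \<open>m\<close> and to 1 modulo \<open>s\<close>: multiplication by \<open>c\<close> moves
  one class modulo \<open>m\<close> to the other and keeps coprimality to all of
  \<open>m * s\<close>.\<close>

lemma coprime_class_multiplier:
  fixes b b' m s :: nat
  assumes "coprime m s" "coprime b m" "coprime b' m"
  obtains c where "coprime c (m * s)" "[c * b = b'] (mod m)"
proof -
  obtain x where x: "[b * x = 1] (mod m)" using cong_solve_coprime_nat[OF assms(2)] by auto
  obtain c where c: "[c = x * b'] (mod m)" "[c = 1] (mod s)"
    using binary_chinese_remainder_nat[OF assms(1)] by blast
  have "coprime (b * x) m" using cong_imp_coprime[OF cong_sym[OF x]] by simp
  then have "coprime (x * b') m" using assms(3) by (simp add: coprime_mult_left_iff)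
  then have "coprime c m" using c(1) by (meson cong_imp_coprime cong_sym)
  moreover have "coprime c s" using c(2) by (meson cong_imp_coprime cong_sym coprime_1_left)
  moreover have "[c * b = b'] (mod m)"
  proof -
    have "[c * b = x * b' * b] (mod m)" using c(1) by (rule cong_scalar_right)
    also have "x * b' * b = b * x * b'" by simp
    also have "[b * x * b' = 1 * b'] (mod m)" using x by (rule cong_scalar_right)
    finally show ?thesis by simp
  qed
  ultimately show ?thesis using that by simp
qed

lemma residue_class_tendsto:
  fixes m s b :: nat
  assumes "m > 0" "s > 0" "coprime m s" "coprime b m"
  shows "sqfree_coprime_sum (m * s) (\<lambda>t. if [t = b] (mod m) then 1 else 0) \<longlonglongrightarrow> 1 / of_nat (totient m)"
proof -
  define M where "M = m * s"
  have M: "M > 0" using assms by (simp add: M_def)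
  define I where "I = (\<lambda>b t. if [t = b] (mod m) then 1 else 0 :: complex)"
  have diff: "(\<lambda>N. sqfree_coprime_sum M (I b) N - sqfree_coprime_sum M (I b') N) \<longlonglongrightarrow> 0"
    if b': "coprime b' m" for b'
  proof -
    obtain c where c: "coprime c M" "[c * b = b'] (mod m)"
      using coprime_class_multiplier[OF assms(3,4) b'] unfolding M_def by blast
    define \<beta> where "\<beta> = (\<lambda>t. if coprime t M then I b' t else 0)"
    \<comment> \<open>On \<open>t\<close> prime to \<open>M\<close> this is the difference of the
      indicators of the classes of \<open>b\<close> and \<open>b'\<close>. Written as
      \<open>\<beta> (c * t) - \<beta> t\<close> it has zero mean at sight, since multiplication by
      \<open>c\<close> permutes the residues modulo \<open>M\<close>.\<close>
    define \<alpha> where "\<alpha> = (\<lambda>t. \<beta> (c * t) - \<beta> t)"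
    have \<beta>_per: "\<beta> (t mod M) = \<beta> t" for t
    proof -
      have "[t mod M = t] (mod m)" by (simp add: M_def unique_euclidean_semiring_class.cong_def mod_mod_cancel)
      then have "I b' (t mod M) = I b' t" by (simp add: I_def unique_euclidean_semiring_class.cong_def)
      moreover have "coprime (t mod M) M \<longleftrightarrow> coprime t M" using M by simp
      ultimately show ?thesis by (simp add: \<beta>_def)
    qed
    have cm: "coprime c m" using c(1) by (simp add: M_def)
    have Ib: "I b' (c * t) = I b t" for t
    proof -
      have "[c * t = b'] (mod m) \<longleftrightarrow> [c * t = c * b] (mod m)"
        using c(2) by (meson cong_sym cong_trans)
      also have "\<dots> \<longleftrightarrow> [t = b] (mod m)" using cm by (simp add: cong_mult_lcancel_nat)
      finally show ?thesis by (simp add: I_def)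
    qed
    have "sqfree_coprime_sum M \<alpha> \<longlonglongrightarrow> 0"
    proof (rule zero_mean_tendsto[OF M])
      show "\<alpha> (n mod M) = \<alpha> n" for n
        unfolding \<alpha>_def using \<beta>_per[of "c * (n mod M)"] \<beta>_per[of "c * n"] \<beta>_per[of n]
        by (simp add: mod_mult_right_eq)
      show "\<alpha> n = 0" if "\<not> coprime n M" for n
        using that by (simp add: \<alpha>_def \<beta>_def)
      show "(\<Sum>n<M. \<alpha> n) = 0"
        using sum.reindex_bij_betw[OF bij_betw_mult_mod[OF c(1) M], of \<beta>]
        by (simp add: \<alpha>_def \<beta>_per sum_subtractf)
    qed
    moreover have "sqfree_coprime_sum M \<alpha> = sqfree_coprime_sum M (\<lambda>t. I b t - I b' t)"
      by (rule sqfree_coprime_sum_cong) (simp add: \<alpha>_def \<beta>_def c(1) Ib)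
    moreover have "sqfree_coprime_sum M (\<lambda>t. I b t - I b' t) =
        (\<lambda>N. sqfree_coprime_sum M (I b) N - sqfree_coprime_sum M (I b') N)"
      by (rule ext, rule sqfree_coprime_sum_diff)
    ultimately show ?thesis by simp
  qed
  have total: "(\<Sum>b'\<in>totatives m. sqfree_coprime_sum M (I b') N) = 1" if "N > 0" for N
  proof -
    have "(\<Sum>b'\<in>totatives m. sqfree_coprime_sum M (I b') N) = sqfree_coprime_sum M (\<lambda>t. \<Sum>b'\<in>totatives m. I b' t) N"
      by (rule sqfree_coprime_sum_sum[symmetric])
    also have "\<dots> = sqfree_coprime_sum M (\<lambda>_. 1) N"
      by (rule fun_cong[OF sqfree_coprime_sum_cong])
         (use sum_totatives_cong assms in \<open>auto simp: I_def M_def\<close>)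
    finally show ?thesis using sqfree_coprime_sum_1[OF that] by simp
  qed
  \<comment> \<open>By \<open>total\<close>, for positive \<open>N\<close> this expression is
    \<open>totient m\<close> times the sum for the class of \<open>b\<close>.\<close>
  have "(\<lambda>N. 1 + (\<Sum>b'\<in>totatives m. sqfree_coprime_sum M (I b) N - sqfree_coprime_sum M (I b') N)) \<longlonglongrightarrow>
      1 + (\<Sum>b'\<in>totatives m. 0)"
    by (intro tendsto_add tendsto_const tendsto_sum diff) (auto simp: in_totatives_iff)
  then have "(\<lambda>N. (1 + (\<Sum>b'\<in>totatives m. sqfree_coprime_sum M (I b) N - sqfree_coprime_sum M (I b') N)) / of_nat (totient m))
      \<longlonglongrightarrow> (1 + (\<Sum>b'\<in>totatives m. 0)) / of_nat (totient m)"
    using assms by (intro tendsto_divide tendsto_const) auto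
  moreover have "\<forall>\<^sub>F N in sequentially. (1 + (\<Sum>b'\<in>totatives m. sqfree_coprime_sum M (I b) N - sqfree_coprime_sum M (I b') N))
      / of_nat (totient m) = sqfree_coprime_sum M (I b) N"
    using eventually_gt_at_top[of 0]
  proof eventually_elim
    case (elim N)
    then show ?case using total[OF elim] assms by (simp add: sum_subtractf totient_def)
  qed
  ultimately have "sqfree_coprime_sum M (I b) \<longlonglongrightarrow> (1 + (\<Sum>b'\<in>totatives m. 0)) / of_nat (totient m)"
    by (rule Lim_transform_eventually)
  then show ?thesis by (simp add: M_def I_def)
qed

section \<open>Wintner coefficients\<close>

lemma squarefree_mult_coprimeD:
  fixes a b :: nat
  assumes "squarefree (a * b)"
  shows "coprime a b"
  by (rule coprimeI) (use assms in \<open>metis mult_dvd_mono power2_eq_square squarefreeD\<close>)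

lemma sum_mob_div_self:
  assumes "n > 0"
  shows "(\<Sum>d | d dvd n. of_int (mob d) / of_nat d :: complex) = of_nat (totient n) / of_nat n"
  using assms
proof (induction n rule: less_induct)
  case (less n)
  show ?case
  proof (cases "n = 1")
    case False
    then have "n > 1" using less.prems by simp
    then obtain p k m where *: "prime p" "k > 0" "\<not> p dvd m" "n = p ^ k * m" "m > 0" "m < n" "coprime (p ^ k) m"
      by (rule prime_power_split)
    have p0: "p > 0" using *(1) by (rule prime_gt_0_nat)
    have "(\<Sum>d | d dvd n. of_int (mob d) / of_nat d :: complex) =
        (\<Sum>x | x dvd p ^ k. \<Sum>y | y dvd m. of_int (mob (x * y)) / of_nat (x * y))"
      unfolding *(4) using *(5,7) p0 by (intro sum_divisors_coprime_mult) auto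
    also have "\<dots> = (\<Sum>x | x dvd p ^ k. \<Sum>y | y dvd m. (of_int (mob x) / of_nat x) * (of_int (mob y) / of_nat y))"
      by (intro sum.cong refl) (auto simp: mob_mult_coprime coprime_divisors[OF _ _ *(7)])
    also have "\<dots> = (\<Sum>x | x dvd p ^ k. of_int (mob x) / of_nat x) * (\<Sum>y | y dvd m. of_int (mob y) / of_nat y)"
      by (simp add: sum_product)
    also have "(\<Sum>x | x dvd p ^ k. of_int (mob x) / of_nat x :: complex) = (\<Sum>i\<le>k. of_int (mob (p ^ i)) / of_nat (p ^ i))"
      by (rule sum_prime_power_divisors[OF *(1)])
    also have "\<dots> = (\<Sum>i\<in>{0, 1}. of_int (mob (p ^ i)) / of_nat (p ^ i))"
      using *(1,2) by (intro sum.mono_neutral_right) (auto simp: mob_prime_power)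
    also have "\<dots> = 1 - 1 / of_nat p" using *(1) by (simp add: mob_prime)
    also have "\<dots> = of_nat (totient (p ^ k)) / of_nat (p ^ k)"
    proof -
      have "p ^ k = p * p ^ (k - 1)" using *(2) by (simp add: power_eq_if)
      then have "(of_nat (totient (p ^ k)) / of_nat (p ^ k) :: complex) =
          of_nat (p ^ (k - 1)) * of_nat (p - 1) / (of_nat p * of_nat (p ^ (k - 1)))"
        using totient_prime_power[OF *(1,2)] by (metis of_nat_mult)
      also have "\<dots> = of_nat (p - 1) / of_nat p" using p0 by simp
      also have "\<dots> = 1 - 1 / of_nat p" using p0 by (simp add: of_nat_diff diff_divide_distrib)
      finally show ?thesis by simp
    qed
    also have "(\<Sum>y | y dvd m. of_int (mob y) / of_nat y :: complex) = of_nat (totient m) / of_nat m"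
      by (rule less.IH[OF *(6,5)])
    finally show ?thesis
      unfolding *(4) by (simp add: totient_mult_coprime[OF *(7)])
  qed simp
qed

lemma sum_mob_div_multiples:
  assumes "squarefree m"
  shows "(\<Sum>x | x dvd m. if l dvd x then of_int (mob x) / of_nat x else 0 :: complex) =
    (if l dvd m then of_int (mob l) * of_nat (totient m) / (of_nat m * of_nat (totient l)) else 0)"
proof (cases "l dvd m")
  case False
  have "(\<Sum>x | x dvd m. if l dvd x then of_int (mob x) / of_nat x else 0 :: complex) = 0"
    using False by (intro sum.neutral) (auto dest: dvd_trans)
  then show ?thesis using False by simp
next
  case True
  then obtain k where m: "m = l * k" by auto
  have cop: "coprime l k" using assms unfolding m by (rule squarefree_mult_coprimeD)
  have pos: "l > 0" "k > 0" using assms m by (auto intro: Nat.gr0I)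
  have "(\<Sum>x | x dvd m. if l dvd x then of_int (mob x) / of_nat x else 0 :: complex) =
      (\<Sum>v | v dvd k. of_int (mob (l * v)) / of_nat (l * v))"
    unfolding m by (rule sum_divisors_multiples[OF pos])
  also have "\<dots> = (\<Sum>v | v dvd k. (of_int (mob l) / of_nat l) * (of_int (mob v) / of_nat v))"
    using cop by (auto intro!: sum.cong simp: mob_mult_coprime coprime_divisors[OF dvd_refl _ cop])
  also have "\<dots> = of_int (mob l) / of_nat l * (of_nat (totient k) / of_nat k)"
    unfolding sum_distrib_left[symmetric] sum_mob_div_self[OF pos(2)] ..
  also have "\<dots> = of_int (mob l) * of_nat (totient m) / (of_nat m * of_nat (totient l))"
    using pos by (simp add: m totient_mult_coprime[OF cop])
  finally show ?thesis using True by simp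
qed

lemma sqfree_transform_mult:
  assumes "coprime e k" "e > 0" "k > 0" "squarefree e"
  shows "sqfree_transform \<phi> (e * k) = (\<Sum>t | t dvd e. of_int (mob (e div t)) * sqfree_transform (\<lambda>n. \<phi> (t * n)) k)"
proof (cases "squarefree k")
  case True
  then have sq: "squarefree (e * k)" using assms by (simp add: squarefree_mult_coprime)
  have "sqfree_transform \<phi> (e * k) = (\<Sum>t | t dvd e * k. \<phi> t * of_int (mob (e * k div t)))"
    using sq by (simp add: sqfree_transform_def)
  also have "\<dots> = (\<Sum>x | x dvd e. \<Sum>y | y dvd k. \<phi> (x * y) * of_int (mob (e * k div (x * y))))"
    by (rule sum_divisors_coprime_mult[OF assms(1-3)])
  also have "\<dots> = (\<Sum>x | x dvd e. of_int (mob (e div x)) * (\<Sum>y | y dvd k. \<phi> (x * y) * of_int (mob (k div y))))"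
    unfolding sum_distrib_left
  proof (intro sum.cong refl)
    fix x y assume "x \<in> {x. x dvd e}" "y \<in> {y. y dvd k}"
    then have xy: "x dvd e" "y dvd k" by auto
    have "e * k div (x * y) = (e div x) * (k div y)" using xy by (simp add: div_mult_div_if_dvd)
    moreover have "e div x dvd e" "k div y dvd k" using xy by (metis dvd_div_mult_self dvd_triv_left)+
    then have "coprime (e div x) (k div y)" by (rule coprime_divisors[OF _ _ assms(1)])
    ultimately show "\<phi> (x * y) * of_int (mob (e * k div (x * y))) =
        of_int (mob (e div x)) * (\<phi> (x * y) * of_int (mob (k div y)))"
      by (simp add: mob_mult_coprime)
  qed
  finally show ?thesis using True by (simp add: sqfree_transform_def)
next
  case False
  then have "\<not> squarefree (e * k)" using squarefree_multD by blast
  then show ?thesis using False by (simp add: sqfree_transform_def)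
qed

text \<open>Each square-free \<open>d\<close> is uniquely \<open>e * k\<close> with \<open>e\<close>
  dividing \<open>M\<close> and \<open>k\<close> prime to \<open>M\<close>, and
  \<open>l dvd d\<close> depends only on \<open>e\<close> because \<open>l\<close> divides
  \<open>M\<close>. The outer sum is finite and its range independent of \<open>N\<close>, so limits
  may be taken term by term.\<close>

lemma sum_multiples_sqfree_transform:
  assumes M: "squarefree M" and l: "l dvd M"
  shows "(\<Sum>d=1..N. if l dvd d then sqfree_transform \<phi> d / of_nat d else 0) =
    (\<Sum>e | e dvd M. if l dvd e then (\<Sum>t | t dvd e. of_int (mob (e div t)) *
        sqfree_coprime_sum M (\<lambda>n. \<phi> (t * n)) (N div e)) / of_nat e else 0)"
proof -
  define S where "S = (\<lambda>e. \<Sum>t | t dvd e. of_int (mob (e div t)) *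
        sqfree_coprime_sum M (\<lambda>n. \<phi> (t * n)) (N div e))"
  have M0: "M > 0" using M by (auto intro: Nat.gr0I)
  define D where "D = {d \<in> {1..N}. l dvd d \<and> squarefree d}"
  define P where "P = (SIGMA e:{e. e dvd M \<and> l dvd e}. {k \<in> {1..N div e}. coprime k M \<and> squarefree k})"
  have "(\<Sum>d=1..N. if l dvd d then sqfree_transform \<phi> d / of_nat d else 0) =
      (\<Sum>d\<in>D. sqfree_transform \<phi> d / of_nat d)"
    unfolding D_def by (subst sum.inter_filter, simp) (auto intro!: sum.cong simp: sqfree_transform_def)
  also have "\<dots> = (\<Sum>(e, k)\<in>P. sqfree_transform \<phi> (e * k) / of_nat (e * k))"
  proof (rule sum.reindex_bij_witness[where i = "\<lambda>(e, k). e * k" and j = "\<lambda>d. (gcd d M, d div gcd d M)"])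
    fix d assume "d \<in> D"
    then have d: "1 \<le> d" "d \<le> N" "l dvd d" "squarefree d" by (auto simp: D_def)
    have dd: "d = gcd d M * (d div gcd d M)" by simp
    show "(case (gcd d M, d div gcd d M) of (e, k) \<Rightarrow> e * k) = d" using dd by simp
    have c1: "coprime (gcd d M) (d div gcd d M)"
      using d(4) dd by (metis squarefree_mult_coprimeD)
    have c2: "coprime (d div gcd d M) M"
    proof (rule coprimeI)
      fix c assume c: "c dvd d div gcd d M" "c dvd M"
      then have "c dvd d" using dd by (metis dvd_mult)
      then have "c dvd gcd d M" using c by simp
      then show "is_unit c" using c1 c by (meson coprime_common_divisor)
    qed
    have g0: "gcd d M > 0" using M0 by simp
    have "d div gcd d M > 0" using d(1) g0 by (metis dd mult_0_right neq0_conv not_one_le_zero)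
    moreover have "d div gcd d M \<le> N div gcd d M" using d by (intro div_le_mono)
    moreover have "squarefree (d div gcd d M)" using d(4) dd by (metis squarefree_multD(2))
    ultimately show "(gcd d M, d div gcd d M) \<in> P" using c2 d l by (simp add: P_def Suc_le_eq)
    show "(case (gcd d M, d div gcd d M) of (e, k) \<Rightarrow> sqfree_transform \<phi> (e * k) / of_nat (e * k)) =
        sqfree_transform \<phi> d / of_nat d" by (simp only: prod.case dd[symmetric])
  next
    fix x assume "x \<in> P"
    then obtain e k where x: "x = (e, k)" "e dvd M" "l dvd e" "1 \<le> k" "k \<le> N div e" "coprime k M" "squarefree k"
      by (auto simp: P_def)
    have e0: "e > 0" using x(2) M0 by (rule dvd_pos_nat[rotated])
    have ce: "coprime e k" using x by (metis coprime_commute coprime_divisors dvd_refl)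
    have "gcd (e * k) M = e"
      using x(2,6) by (simp add: gcd_mult_right_right_cancel gcd_nat.absorb1 coprime_commute gcd_mult_left_right_cancel)
    then show "(\<lambda>d. (gcd d M, d div gcd d M)) (case x of (e, k) \<Rightarrow> e * k) = x" using x e0 by simp
    have "e * k \<le> N" using x(5) e0 by (simp add: less_eq_div_iff_mult_less_eq mult.commute)
    moreover have "squarefree (e * k)" using ce x squarefree_mono[OF x(2) M] by (simp add: squarefree_mult_coprime)
    ultimately show "(case x of (e, k) \<Rightarrow> e * k) \<in> D" using x e0 by (simp add: D_def Suc_le_eq)
  qed
  also have "\<dots> = (\<Sum>e | e dvd M \<and> l dvd e. \<Sum>k | k \<in> {1..N div e} \<and> coprime k M \<and> squarefree k.
      sqfree_transform \<phi> (e * k) / of_nat (e * k))"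
    unfolding P_def using M0 by (intro sum.Sigma[symmetric]) (auto intro: finite_subset[OF _ finite_divisors_nat])
  also have "\<dots> = (\<Sum>e | e dvd M \<and> l dvd e. S e / of_nat e)"
  proof (rule sum.cong[OF refl])
    fix e assume "e \<in> {e. e dvd M \<and> l dvd e}"
    then have e: "e dvd M" by simp
    have e0: "e > 0" using e M0 by (rule dvd_pos_nat[rotated])
    have "(\<Sum>k | k \<in> {1..N div e} \<and> coprime k M \<and> squarefree k. sqfree_transform \<phi> (e * k) / of_nat (e * k)) =
        (\<Sum>k=1..N div e. \<Sum>t | t dvd e. of_int (mob (e div t)) *
          (if coprime k M then sqfree_transform (\<lambda>n. \<phi> (t * n)) k / of_nat k else 0) / of_nat e)"
    proof (rule sum.mono_neutral_cong_left)
      show "\<forall>k\<in>{1..N div e} - {k \<in> {1..N div e}. coprime k M \<and> squarefree k}.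
          (\<Sum>t | t dvd e. of_int (mob (e div t)) *
          (if coprime k M then sqfree_transform (\<lambda>n. \<phi> (t * n)) k / of_nat k else 0) / of_nat e) = 0"
        by (auto simp: sqfree_transform_def intro!: sum.neutral split: if_splits)
    next
      fix k assume "k \<in> {k \<in> {1..N div e}. coprime k M \<and> squarefree k}"
      then have k: "k > 0" "coprime k M" by auto
      have "coprime e k" using k e by (metis coprime_commute coprime_divisors dvd_refl)
      from sqfree_transform_mult[OF this e0 k(1) squarefree_mono[OF e M]]
      show "sqfree_transform \<phi> (e * k) / of_nat (e * k) = (\<Sum>t | t dvd e. of_int (mob (e div t)) *
          (if coprime k M then sqfree_transform (\<lambda>n. \<phi> (t * n)) k / of_nat k else 0) / of_nat e)"
        using k by (simp add: sum_divide_distrib mult_ac)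
    qed auto
    also have "\<dots> = S e / of_nat e"
      unfolding S_def sqfree_coprime_sum_def sum_divide_distrib sum_distrib_left by (rule sum.swap)
    finally show "(\<Sum>k | k \<in> {1..N div e} \<and> coprime k M \<and> squarefree k. sqfree_transform \<phi> (e * k) / of_nat (e * k)) = \<dots>" .
  qed
  also have "\<dots> = (\<Sum>e | e dvd M. if l dvd e then S e / of_nat e else 0)"
    using M0 sum.inter_filter[of "{e. e dvd M}"] by (simp add: Collect_conj_eq flip: sum.inter_filter)
  finally show ?thesis unfolding S_def .
qed

text \<open>A multiplier prime to \<open>m\<close> only exchanges one coprime class for another;
  with any other multiplier \<open>t * n\<close> is never prime to \<open>m\<close> and misses the
  class of \<open>b\<close> altogether.\<close>

lemma residue_class_scaled_tendsto:
  fixes m s b t :: nat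
  assumes "m > 0" "s > 0" "coprime m s" "coprime b m"
  shows "sqfree_coprime_sum (m * s) (\<lambda>n. if [t * n = b] (mod m) then 1 else 0)
      \<longlonglongrightarrow> (if coprime t m then 1 / of_nat (totient m) else 0)"
proof (cases "coprime t m")
  case True
  obtain x where x: "[t * x = 1] (mod m)" using cong_solve_coprime_nat[OF True] by auto
  have "coprime (t * x) m" using cong_imp_coprime[OF cong_sym[OF x]] by simp
  then have xb: "coprime (x * b) m" using assms(4) by simp
  have "[t * n = b] (mod m) \<longleftrightarrow> [n = x * b] (mod m)" for n
  proof -
    have "[t * (x * b) = 1 * b] (mod m)"
      using cong_scalar_right[OF x, of b] by (simp add: mult.assoc)
    then have "[t * n = b] (mod m) \<longleftrightarrow> [t * n = t * (x * b)] (mod m)"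
      by (metis cong_sym cong_trans mult_1)
    also have "\<dots> \<longleftrightarrow> [n = x * b] (mod m)" using True by (simp add: cong_mult_lcancel_nat)
    finally show ?thesis .
  qed
  then show ?thesis using residue_class_tendsto[OF assms(1-3) xb] True by simp
next
  case False
  have "\<not> [t * n = b] (mod m)" for n
  proof
    assume "[t * n = b] (mod m)"
    then have "coprime (t * n) m" using assms(4) by (metis cong_imp_coprime cong_sym)
    then show False using False by simp
  qed
  moreover have "sqfree_coprime_sum M (\<lambda>_. 0) = (\<lambda>_. 0)" for M
    by (auto simp: fun_eq_iff sqfree_coprime_sum_def sqfree_transform_def intro!: sum.neutral)
  ultimately show ?thesis using False by simp
qed

text \<open>The value does not depend on \<open>b\<close>, each class having the limit
  \<open>1 / totient m\<close>; the sum over the multiples of \<open>l\<close> dividing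
  \<open>m\<close> supplies the factor \<open>totient m\<close> that cancels it. If \<open>l\<close>
  is not square-free every term vanishes, and \<open>l\<close> cannot divide
  \<open>m\<close>.\<close>

theorem wintner_residue_class:
  fixes m l b :: nat
  assumes m: "squarefree m" and l: "l > 0" and b: "coprime b m"
  shows "wintner_term (IPPification (\<lambda>a. if [a = b] (mod m) then 1 else 0)) l sums
    (if l dvd m then of_int (mob l) / (of_nat m * of_nat (totient l)) else 0)"
proof (cases "squarefree l")
  case False
  have "\<not> l dvd m" using False m squarefree_mono by blast
  moreover have "wintner_term (IPPification \<phi>) l = (\<lambda>_. 0)" for \<phi>
    using False squarefree_mono
    by (auto simp: fun_eq_iff wintner_term_def eratosthenes_IPPification sqfree_transform_def)
  ultimately show ?thesis by simp
next
  case True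
  \<comment> \<open>\<open>M = m * s\<close> is the least common multiple of \<open>m\<close> and
    \<open>l\<close>. As \<open>l\<close> is square-free, \<open>s\<close> is prime to
    \<open>m\<close>, and every divisor of \<open>M\<close> is uniquely \<open>x * y\<close> with
    \<open>x dvd m\<close> and \<open>y dvd s\<close>.\<close>
  define s where "s = l div gcd l m"
  define M where "M = m * s"
  have m0: "m > 0" using m by (auto intro: Nat.gr0I)
  have ls: "l = gcd l m * s" by (simp add: s_def)
  have c1: "coprime (gcd l m) s" using True ls by (metis squarefree_mult_coprimeD)
  have s0: "s > 0" using ls l by (metis mult_0_right neq0_conv)
  have ms: "coprime m s"
  proof (rule coprimeI)
    fix c assume c: "c dvd m" "c dvd s"
    then have "c dvd l" using ls by (metis dvd_mult)
    then have "c dvd gcd l m" using c by simp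
    then show "is_unit c" using c1 c by (meson coprime_common_divisor)
  qed
  have "squarefree s" using True ls by (metis squarefree_multD(2))
  then have M: "squarefree M" using ms m by (simp add: M_def squarefree_mult_coprime)
  have M0: "M > 0" using m0 s0 by (simp add: M_def)
  have lM: "l dvd M"
    by (subst ls) (auto simp: M_def intro!: mult_dvd_mono)
  define \<phi> where "\<phi> = (\<lambda>a. if [a = b] (mod m) then 1 else 0 :: complex)"
  define c where "c = (1 / of_nat (totient m) :: complex)"
  define S where "S = (\<lambda>e N. \<Sum>t | t dvd e. of_int (mob (e div t)) * sqfree_coprime_sum M (\<lambda>n. \<phi> (t * n)) (N div e))"
  define L where "L = (\<lambda>e. \<Sum>t | t dvd e. of_int (mob (e div t)) * (if coprime t m then c else 0))"
  have psum: "(\<Sum>n<N. wintner_term (IPPification \<phi>) l n) =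
     (\<Sum>e | e dvd M. if l dvd e then S e N / of_nat e else 0)" for N
  proof -
    have "(\<Sum>n<N. wintner_term (IPPification \<phi>) l n) =
        (\<Sum>d=1..N. if l dvd d then sqfree_transform \<phi> d / of_nat d else 0)"
      by (simp add: wintner_term_def eratosthenes_IPPification sum.atLeast1_atMost_eq cong: if_cong)
    then show ?thesis unfolding S_def using sum_multiples_sqfree_transform[OF M lM] by simp
  qed
  have lim: "(\<lambda>N. \<Sum>n<N. wintner_term (IPPification \<phi>) l n) \<longlonglongrightarrow>
     (\<Sum>e | e dvd M. if l dvd e then L e / of_nat e else 0)"
    unfolding psum
  proof (rule tendsto_sum)
    fix e assume "e \<in> {e. e dvd M}"
    then have e0: "e > 0" using M0 by (auto intro: dvd_pos_nat)
    have "(\<lambda>N. S e N / of_nat e)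
        \<longlonglongrightarrow> L e / of_nat e"
      using e0 unfolding S_def L_def M_def \<phi>_def c_def
      by (intro tendsto_divide tendsto_sum tendsto_mult tendsto_const
          filterlim_compose[OF residue_class_scaled_tendsto[OF m0 s0 ms b] filterlim_at_top_div_const_nat]) auto
    then show "(\<lambda>N. if l dvd e then S e N / of_nat e else 0)
        \<longlonglongrightarrow> (if l dvd e then L e / of_nat e else 0)"
      by simp
  qed
  \<comment> \<open>Only \<open>t\<close> prime to \<open>m\<close> count, that is the divisors of
    \<open>y\<close>. They leave the sum of \<open>mob (y div t)\<close>, which is 0 unless
    \<open>y = 1\<close>; this is why the coefficient vanishes unless \<open>l\<close> divides
    \<open>m\<close>.\<close>
  have inner: "L (x * y) =
      (if y = 1 then c * of_int (mob x) else 0)" if x: "x dvd m" and y: "y dvd s" for x y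
  proof -
    have xy: "coprime x y" using coprime_divisors[OF x y ms] .
    have x0: "x > 0" "y > 0" using x y m0 s0 by (auto intro: dvd_pos_nat)
    have "L (x * y) = (\<Sum>t | t dvd y. c * of_int (mob x) * of_int (mob (y div t)))"
      unfolding L_def
    proof (rule sum.mono_neutral_cong_right)
      show "{t. t dvd y} \<subseteq> {t. t dvd x * y}" by auto
      show "\<forall>t\<in>{t. t dvd x * y} - {t. t dvd y}. of_int (mob (x * y div t)) * (if coprime t m then c else 0) = 0"
      proof
        fix t assume t: "t \<in> {t. t dvd x * y} - {t. t dvd y}"
        have "\<not> coprime t m"
        proof
          assume "coprime t m"
          then have "coprime t x" using x by (rule coprime_divisors[OF dvd_refl, rotated])
          then show False using t by (simp add: coprime_dvd_mult_right_iff)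
        qed
        then show "of_int (mob (x * y div t)) * (if coprime t m then c else 0) = 0" by simp
      qed
      fix t assume "t \<in> {t. t dvd y}"
      then have t: "t dvd y" by simp
      have "coprime t m" using coprime_divisors[OF dvd_refl dvd_trans[OF t y] ms] by (simp add: coprime_commute)
      moreover have "x * y div t = x * (y div t)" using t by (simp add: div_mult_swap)
      moreover have "coprime x (y div t)" using coprime_divisors[OF dvd_refl _ xy] t by (metis dvd_div_mult_self dvd_triv_left)
      ultimately show "of_int (mob (x * y div t)) * (if coprime t m then c else 0) = c * of_int (mob x) * of_int (mob (y div t))"
        by (simp add: mob_mult_coprime)
    qed (use x0 in auto)
    also have "\<dots> = c * of_int (mob x) * of_int (\<Sum>t | t dvd y. mob t)"
      using sum_divisors_flip[OF x0(2), of "\<lambda>_ t. mob t"] by (simp flip: sum_distrib_left of_int_sum)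
    finally show ?thesis using sum_mob[OF x0(2)] by simp
  qed
  have "(\<Sum>e | e dvd M. if l dvd e then L e / of_nat e else 0) =
      (\<Sum>x | x dvd m. \<Sum>y | y dvd s. if l dvd x * y then L (x * y) / of_nat (x * y) else 0)"
    unfolding M_def by (rule sum_divisors_coprime_mult[OF ms m0 s0])
  also have "\<dots> = (\<Sum>x | x dvd m. \<Sum>y | y dvd s. if y = 1 then (if l dvd x then c * of_int (mob x) / of_nat x else 0) else 0)"
  proof (intro sum.cong refl)
    fix x y assume "x \<in> {x. x dvd m}" "y \<in> {y. y dvd s}"
    then show "(if l dvd x * y then L (x * y) / of_nat (x * y) else 0) =
        (if y = 1 then (if l dvd x then c * of_int (mob x) / of_nat x else 0) else 0)"
      using inner[of x y] by (cases "y = 1") auto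
  qed
  also have "\<dots> = (\<Sum>x | x dvd m. c * (if l dvd x then of_int (mob x) / of_nat x else 0))"
    using s0 by (intro sum.cong refl) (simp add: sum.delta if_distrib cong: if_cong)
  also have "\<dots> = c * (if l dvd m then of_int (mob l) * of_nat (totient m) / (of_nat m * of_nat (totient l)) else 0)"
    unfolding sum_distrib_left[symmetric] sum_mob_div_multiples[OF m] ..
  also have "\<dots> = (if l dvd m then of_int (mob l) / (of_nat m * of_nat (totient l)) else 0)"
    using m0 by (simp add: c_def)
  finally show ?thesis using lim unfolding sums_def \<phi>_def by simp
qed

section \<open>Ramanujan sums at primes\<close>

lemma sum_roots_of_unity:
  assumes "n > 0"
  shows "(\<Sum>i=1..n. exp (2 * of_real pi * \<i> * of_nat i * of_nat m / of_nat n) :: complex) =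
    (if n dvd m then of_nat n else 0)"
proof -
  define z where "z = exp (2 * of_real pi * \<i> * of_nat m / of_nat n :: complex)"
  have pow: "exp (2 * of_real pi * \<i> * of_nat i * of_nat m / of_nat n :: complex) = z ^ i" for i
    unfolding z_def exp_of_nat_mult[symmetric] by (simp add: mult_ac)
  have "z ^ n = exp (2 * of_real pi * \<i> * of_nat m :: complex)"
    unfolding pow[of n, symmetric] by (rule arg_cong[of _ _ exp]) (use assms in \<open>simp add: field_simps\<close>)
  also have "\<dots> = 1" by (simp add: exp_eq_1 mult_ac)
  finally have zn: "z ^ n = 1" .
  have "(\<Sum>i=1..n. z ^ i) = (\<Sum>i<n. z ^ Suc i)"
    by (rule sum.reindex_bij_witness[where i = Suc and j = "\<lambda>i. i - 1"]) auto
  also have "\<dots> = z * (\<Sum>i<n. z ^ i)" by (simp add: sum_distrib_left)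
  finally have eq: "(\<Sum>i=1..n. z ^ i) = z * (\<Sum>i<n. z ^ i)" .
  show ?thesis
  proof (cases "n dvd m")
    case True
    then obtain k where "m = n * k" by auto
    then have "z = exp (2 * of_real pi * \<i> * of_nat k)"
      unfolding z_def by (intro arg_cong[of _ _ exp]) (use assms in \<open>simp add: field_simps\<close>)
    also have "\<dots> = 1" by (simp add: exp_eq_1 mult_ac)
    finally have "z = 1" .
    then show ?thesis using True by (simp add: pow)
  next
    case False
    have "z \<noteq> 1"
    proof
      assume "z = 1"
      then obtain k :: int where "2 * pi * real m / real n = of_int (2 * k) * pi"
        unfolding z_def exp_eq_1 by (auto simp: Im_divide_of_nat)
      then have "real m = of_int k * real n" using assms by (simp add: field_simps)
      then have "int m = k * int n" by (metis of_int_eq_iff of_int_mult of_int_of_nat_eq)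
      then have "int n dvd int m" by simp
      then show False using False by simp
    qed
    then have "(\<Sum>i<n. z ^ i) = 0" using geometric_sum[of z n] zn by simp
    then show ?thesis using False eq by (simp add: pow)
  qed
qed

text \<open>Kluyver's formula: \<open>coprime j l\<close> is detected by \<open>mob\<close>, and the
  inner sums over the multiples of a divisor are complete sums of roots of unity.\<close>

lemma ramanujan_sum_eq:
  assumes "l > 0"
  shows "ramanujan_sum l m = (\<Sum>d | d dvd l. of_int (mob (l div d)) * (if d dvd m then of_nat d else 0))"
proof -
  define E where "E = (\<lambda>j. exp (2 * of_real pi * \<i> * of_nat j * of_nat m / of_nat l) :: complex)"
  have cop: "(if coprime j l then 1 else 0 :: complex) = (\<Sum>d | d dvd l. if d dvd j then of_int (mob d) else 0)"
    if "j \<in> {1..l}" for j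
  proof -
    have g: "gcd j l > 0" using assms by simp
    have "(\<Sum>d | d dvd l. if d dvd j then of_int (mob d) else 0 :: complex) = (\<Sum>d | d dvd gcd j l. of_int (mob d))"
      using assms by (intro sum.mono_neutral_cong_right) auto
    also have "\<dots> = of_int (if gcd j l = 1 then 1 else 0)" using sum_mob[OF g] by (simp flip: of_int_sum)
    moreover have "gcd j l = 1 \<longleftrightarrow> coprime j l" using coprime_iff_gcd_eq_1[of j l] by blast
    ultimately show ?thesis by (cases "coprime j l") (simp_all only: if_True if_False of_int_1 of_int_0)
  qed
  have "ramanujan_sum l m = (\<Sum>j | j \<in> {1..l} \<and> coprime j l. E j)"
    unfolding ramanujan_sum_def E_def by (intro sum.cong) auto
  also have "\<dots> = (\<Sum>j=1..l. (if coprime j l then 1 else 0) * E j)"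
    by (subst sum.inter_filter, simp) (auto intro: sum.cong)
  also have "\<dots> = (\<Sum>j=1..l. \<Sum>d | d dvd l. (if d dvd j then of_int (mob d) else 0) * E j)"
    unfolding sum_distrib_right[symmetric] by (intro sum.cong refl) (simp only: cop)
  also have "\<dots> = (\<Sum>d | d dvd l. \<Sum>j=1..l. (if d dvd j then of_int (mob d) else 0) * E j)"
    by (rule sum.swap)
  also have "\<dots> = (\<Sum>d | d dvd l. of_int (mob d) * (if l div d dvd m then of_nat (l div d) else 0))"
  proof (rule sum.cong[OF refl])
    fix d assume "d \<in> {d. d dvd l}"
    then obtain n where l: "l = d * n" by auto
    have pos: "d > 0" "n > 0" using assms l by (auto intro: Nat.gr0I)
    have "(\<Sum>j=1..l. (if d dvd j then of_int (mob d) else 0) * E j) = (\<Sum>j | j \<in> {1..l} \<and> d dvd j. of_int (mob d) * E j)"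
      by (subst sum.inter_filter, simp) (auto intro: sum.cong)
    also have "\<dots> = (\<Sum>i=1..n. of_int (mob d) * E (d * i))"
      using pos by (intro sum.reindex_bij_witness[where i = "\<lambda>i. d * i" and j = "\<lambda>j. j div d"])
        (auto simp: l Suc_le_eq elim!: dvdE)
    also have "E (d * i) = exp (2 * of_real pi * \<i> * of_nat i * of_nat m / of_nat n)" for i
      unfolding E_def l by (rule arg_cong[of _ _ exp]) (use pos in \<open>simp add: field_simps\<close>)
    then have "(\<Sum>i=1..n. of_int (mob d) * E (d * i)) =
        (\<Sum>i=1..n. of_int (mob d) * exp (2 * of_real pi * \<i> * of_nat i * of_nat m / of_nat n))" by simp
    also have "\<dots> = of_int (mob d) * (if n dvd m then of_nat n else 0)"
      unfolding sum_distrib_left[symmetric] sum_roots_of_unity[OF pos(2)] ..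
    finally show "(\<Sum>j=1..l. (if d dvd j then of_int (mob d) else 0) * E j) =
        of_int (mob d) * (if l div d dvd m then of_nat (l div d) else 0)" using pos by (simp add: l)
  qed
  finally show ?thesis
    using sum_divisors_flip[OF assms, of "\<lambda>d e. of_int (mob d) * (if e dvd m then of_nat e else 0) :: complex"] by simp
qed

text \<open>In Kluyver's formula only the divisor 1 and, if \<open>p\<close> divides
  \<open>l\<close>, the divisor \<open>p\<close> remain; the latter enters with the opposite sign,
  giving \<open>mob l * (1 - p)\<close>.\<close>

lemma ramanujan_sum_prime:
  assumes "squarefree l" "prime p"
  shows "ramanujan_sum l p = of_int (mob l) * (if p dvd l then - of_nat (totient p) else 1)"
proof -
  have l: "l > 0" using assms(1) by (auto intro: Nat.gr0I)
  have p: "p > 1" using assms(2) by (rule prime_gt_1_nat)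
  have "ramanujan_sum l p = (\<Sum>d | d dvd l. of_int (mob (l div d)) * (if d dvd p then of_nat d else 0))"
    by (rule ramanujan_sum_eq[OF l])
  also have "\<dots> = (\<Sum>d\<in>(if p dvd l then {1, p} else {1}). of_int (mob (l div d)) * of_nat d)"
    using l assms(2) by (intro sum.mono_neutral_cong_right) (auto simp: prime_nat_iff split: if_splits)
  also have "\<dots> = of_int (mob l) * (if p dvd l then - of_nat (totient p) else 1)"
  proof (cases "p dvd l")
    case True
    then obtain k where k: "l = p * k" by auto
    have "coprime p k" using assms(1) unfolding k by (rule squarefree_mult_coprimeD)
    then have "mob l = - mob k" using assms(2) by (simp add: k mob_mult_coprime mob_prime)
    moreover have "l div p = k" using p k by simp
    ultimately show ?thesis using True p assms(2) by (simp add: totient_prime of_nat_diff algebra_simps)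
  qed simp
  finally show ?thesis .
qed

section \<open>Collapse of the sums over \<open>q\<close> and \<open>m\<close>\<close>

lemma sum_mob_not_dvd:
  assumes "prime p" "squarefree k"
  shows "(\<Sum>v | v dvd k. if p dvd v then 0 else mob v) = (if k = 1 \<or> k = p then 1 else 0)"
proof -
  have k0: "k > 0" using assms(2) by (auto intro: Nat.gr0I)
  have p1: "p > 1" using assms(1) by (rule prime_gt_1_nat)
  have "(\<Sum>v | v dvd k. if p dvd v then 0 else mob v) =
      (\<Sum>v | v dvd k. mob v) - (\<Sum>v | v dvd k. if p dvd v then mob v else 0)"
    unfolding sum_subtractf[symmetric] by (intro sum.cong) auto
  also have "(\<Sum>v | v dvd k. if p dvd v then mob v else 0) = (if k = p then -1 else 0)"
  proof (cases "p dvd k")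
    case True
    then obtain j where k: "k = p * j" by auto
    have cop: "coprime p j" using assms(2) unfolding k by (rule squarefree_mult_coprimeD)
    have j0: "j > 0" using k0 k by (auto intro: Nat.gr0I)
    have "(\<Sum>v | v dvd k. if p dvd v then mob v else 0) = (\<Sum>v | v dvd j. mob (p * v))"
      using p1 j0 unfolding k by (intro sum_divisors_multiples) auto
    also have "\<dots> = (\<Sum>v | v dvd j. - mob v)"
      using assms(1) by (intro sum.cong refl) (auto simp: mob_mult_coprime mob_prime coprime_divisors[OF dvd_refl _ cop])
    finally show ?thesis using sum_mob[OF j0] p1 by (simp add: sum_negf k)
  next
    case False
    then have "(\<Sum>v | v dvd k. if p dvd v then mob v else 0) = 0"
      by (intro sum.neutral) (auto dest: dvd_trans)
    then show ?thesis using False by auto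
  qed
  finally show ?thesis using sum_mob[OF k0] p1 by auto
qed

text \<open>With \<open>q = l * k\<close> the sum is \<open>mob l\<close> times a sum over the
  divisors of \<open>k\<close> prime to \<open>p\<close>, which is 1 for \<open>k = 1\<close> and
  \<open>k = p\<close> and 0 otherwise. The sign of \<open>mob q\<close> separates the two cases,
  whence the difference of two values of \<open>g_hat\<close>.\<close>

lemma sum_mob_multiples_not_dvd:
  assumes "prime p" "squarefree q" "l > 0"
  shows "mob q * (\<Sum>m | m dvd q. if l dvd m then if p dvd m then 0 else mob m else 0) =
    (if \<not> p dvd l then (if q = l then 1 else 0) - (if q = p * l then 1 else 0) else 0)"
proof (cases "l dvd q \<and> \<not> p dvd l")
  case False
  have "(\<Sum>m | m dvd q. if l dvd m then if p dvd m then 0 else mob m else 0) = 0"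
    using False by (intro sum.neutral) (auto dest: dvd_trans)
  then show ?thesis using False by auto
next
  case True
  then obtain k where q: "q = l * k" by auto
  have cop: "coprime l k" using assms(2) unfolding q by (rule squarefree_mult_coprimeD)
  have k0: "k > 0" using assms(2) q by (auto intro: Nat.gr0I)
  have sk: "squarefree k" and sl: "squarefree l" using assms(2) squarefree_multD unfolding q by blast+
  have mm: "mob l * mob l = 1" using sl by (simp add: mob_def flip: power_add)
  have "(\<Sum>m | m dvd q. if l dvd m then if p dvd m then 0 else mob m else 0) =
      (\<Sum>v | v dvd k. if p dvd l * v then 0 else mob (l * v))"
    unfolding q by (rule sum_divisors_multiples[OF assms(3) k0])
  also have "\<dots> = (\<Sum>v | v dvd k. mob l * (if p dvd v then 0 else mob v))"
    using True assms(1)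
    by (intro sum.cong refl) (auto simp: prime_dvd_mult_iff mob_mult_coprime coprime_divisors[OF dvd_refl _ cop])
  also have "\<dots> = mob l * (if k = 1 \<or> k = p then 1 else 0)"
    unfolding sum_distrib_left[symmetric] sum_mob_not_dvd[OF assms(1) sk] ..
  finally have "mob q * (\<Sum>m | m dvd q. if l dvd m then if p dvd m then 0 else mob m else 0) =
      (mob l * mob l) * mob k * (if k = 1 \<or> k = p then 1 else 0)"
    using cop by (simp add: q mob_mult_coprime)
  also have "\<dots> = (if q = l then 1 else 0) - (if q = p * l then 1 else 0)"
    unfolding mm using assms(1,3) prime_gt_1_nat[OF assms(1)] by (auto simp: q mob_prime)
  finally show ?thesis using True by simp
qed

text \<open>Convergence is asked only where \<open>c i \<noteq> 0\<close>: moduli \<open>m\<close>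
  that are not square-free occur later with coefficient \<open>mob m = 0\<close>, and
  \<open>wintner_residue_class\<close> says nothing about them.\<close>

lemma wintner_term_sums_sum:
  assumes "\<And>i. i \<in> I \<Longrightarrow> c i \<noteq> 0 \<Longrightarrow> wintner_term (F i) l sums W i"
  shows "wintner_term (\<lambda>a. \<Sum>i\<in>I. c i * F i a) l sums (\<Sum>i\<in>I. c i * W i)"
proof -
  have "eratosthenes (\<lambda>a. \<Sum>i\<in>I. c i * F i a) d = (\<Sum>i\<in>I. c i * eratosthenes (F i) d)" for d
    unfolding eratosthenes_def
    by (simp add: sum_distrib_left sum_distrib_right mult.assoc) (rule sum.swap)
  then have "wintner_term (\<lambda>a. \<Sum>i\<in>I. c i * F i a) l = (\<lambda>n. \<Sum>i\<in>I. c i * wintner_term (F i) l n)"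
    by (simp add: fun_eq_iff wintner_term_def sum_divide_distrib)
  moreover have "(\<lambda>n. c i * wintner_term (F i) l n) sums (c i * W i)" if "i \<in> I" for i
    using assms[OF that] by (cases "c i = 0") (auto intro: sums_mult)
  ultimately show ?thesis by (simp add: sums_sum)
qed

lemma g_hat_eq_0: "l > Q \<Longrightarrow> g_hat Q g l = 0"
  unfolding g_hat_def by (intro sum.neutral) (auto dest: dvd_imp_le)

text \<open>The weight \<open>m\<close> of the definition cancels the \<open>1 / m\<close> of each
  residue class. As the class itself leaves no trace, the prime \<open>p\<close> acts only through
  the condition that it does not divide \<open>m\<close>, and a pure Moebius sum remains.\<close>

lemma wintner_P_corr_sums:
  assumes l: "l > 0"
  shows "wintner_term (IPPification (P_corr f g Q N)) l sums
    (of_int (mob l) / of_nat (totient l) *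
      (\<Sum>p | prime p \<and> p \<le> N \<and> \<not> p dvd l. f p * (g_hat Q g l - g_hat Q g (p * l))))"
proof -
  \<comment> \<open>The least non-negative representative of \<open>-p\<close> modulo
    \<open>m\<close>, as a natural number, since the residue class results live on
    \<open>nat\<close>.\<close>
  define r where "r = (\<lambda>p m. nat ((- int p) mod int m))"
  define F where "F = (\<lambda>p m. IPPification (\<lambda>a. if [a = r p m] (mod m) then 1 else 0 :: complex))"
  define W where "W = (\<lambda>m. if l dvd m then of_int (mob l) / (of_nat m * of_nat (totient l)) else 0 :: complex)"
  define P where "P = {p. prime p \<and> p \<le> N}"
  have finP: "finite P" unfolding P_def by (rule finite_subset[of _ "{..N}"]) auto
  have int_r: "int (r p m) = (- int p) mod int m" if "m > 0" for p m
    using that by (simp add: r_def)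
  have cong: "[- int p = int a] (mod int m) \<longleftrightarrow> [a = r p m] (mod m)" if "m > 0" for m p a
  proof -
    have "[a = r p m] (mod m) \<longleftrightarrow> [int a = int (r p m)] (mod int m)" by (simp add: cong_int_iff)
    also have "\<dots> \<longleftrightarrow> [- int p = int a] (mod int m)"
      by (auto simp: int_r[OF that] unique_euclidean_semiring_class.cong_def)
    finally show ?thesis by simp
  qed
  have P_eq: "IPPification (P_corr f g Q N) = (\<lambda>a. \<Sum>q=1..Q. (of_int (mob q) * g_hat Q g q) *
      (\<Sum>m | m dvd q. (of_int (mob m) * of_nat m) *
        (\<Sum>p | prime p \<and> p \<le> N \<and> coprime p m. f p * F p m a)))"
    unfolding IPPification_def P_corr_def F_def
  proof (rule ext, rule sum.cong[OF refl], rule arg_cong2[of _ _ _ _ "(*)", OF refl],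
      rule sum.cong[OF refl], rule arg_cong2[of _ _ _ _ "(*)", OF refl])
    fix a q m assume "q \<in> {1..Q}" "m \<in> {m. m dvd q}"
    then have "m > 0" by (auto intro: dvd_pos_nat)
    then show "(\<Sum>p | prime p \<and> p \<le> N \<and> coprime p m \<and> [- int p = int (sqfree_kernel a)] (mod int m). f p) =
      (\<Sum>p | prime p \<and> p \<le> N \<and> coprime p m. f p * (if [sqfree_kernel a = r p m] (mod m) then 1 else 0))"
      using cong by (intro sum.mono_neutral_cong_left) (auto intro: finite_subset[of _ "{..N}"])
  qed
  have "wintner_term (IPPification (P_corr f g Q N)) l sums
      (\<Sum>q=1..Q. (of_int (mob q) * g_hat Q g q) * (\<Sum>m | m dvd q. (of_int (mob m) * of_nat m) *
        (\<Sum>p | prime p \<and> p \<le> N \<and> coprime p m. f p * W m)))"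
    unfolding P_eq
  proof (intro wintner_term_sums_sum)
    fix q m p assume "q \<in> {1..Q}" "m \<in> {m. m dvd q}" "p \<in> {p. prime p \<and> p \<le> N \<and> coprime p m}"
      "of_int (mob m) * of_nat m \<noteq> (0 :: complex)"
    then have m: "squarefree m" "m > 0" "coprime p m" by (auto simp: mob_def split: if_splits)
    then have "coprime ((- int p) mod int m) (int m)" by simp
    then have "coprime (int (r p m)) (int m)" unfolding int_r[OF m(2)] .
    then show "wintner_term (F p m) l sums W m"
      unfolding F_def W_def by (intro wintner_residue_class m l) (simp only: coprime_int_iff)
  qed
  moreover have "(\<Sum>q=1..Q. (of_int (mob q) * g_hat Q g q) * (\<Sum>m | m dvd q. (of_int (mob m) * of_nat m) *
        (\<Sum>p | prime p \<and> p \<le> N \<and> coprime p m. f p * W m))) = of_int (mob l) / of_nat (totient l) *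
      (\<Sum>p | prime p \<and> p \<le> N \<and> \<not> p dvd l. f p * (g_hat Q g l - g_hat Q g (p * l)))"
  proof -
    define K where "K = (of_int (mob l) / of_nat (totient l) :: complex)"
    define h where "h = (\<lambda>p m. if l dvd m then if p dvd m then 0 else mob m else 0)"
    define D where "D = (\<lambda>p. if p dvd l then 0 else g_hat Q g l - g_hat Q g (p * l))"
    have cop: "coprime p m \<longleftrightarrow> \<not> p dvd m" if "prime p" for p m :: nat
      using that by (metis coprime_common_divisor dvd_refl not_prime_unit prime_imp_coprime)
    have p_sum: "(\<Sum>p | prime p \<and> p \<le> N \<and> coprime p m. f p * W m) =
        (\<Sum>p\<in>P. f p * (if p dvd m then 0 else W m))" for m
      by (intro sum.mono_neutral_cong_left[OF finP]) (auto simp: P_def cop)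
    have "(\<Sum>q=1..Q. (of_int (mob q) * g_hat Q g q) * (\<Sum>m | m dvd q. (of_int (mob m) * of_nat m) *
        (\<Sum>p | prime p \<and> p \<le> N \<and> coprime p m. f p * W m))) =
      (\<Sum>q=1..Q. \<Sum>m | m dvd q. \<Sum>p\<in>P. K * (f p * (g_hat Q g q * of_int (mob q * h p m))))"
      unfolding p_sum sum_distrib_left
      by (intro sum.cong refl) (auto simp: W_def K_def h_def dest: dvd_pos_nat)
    also have "\<dots> = (\<Sum>q=1..Q. \<Sum>p\<in>P. \<Sum>m | m dvd q. K * (f p * (g_hat Q g q * of_int (mob q * h p m))))"
      by (rule sum.cong[OF refl]) (rule sum.swap)
    also have "\<dots> = (\<Sum>p\<in>P. \<Sum>q=1..Q. \<Sum>m | m dvd q. K * (f p * (g_hat Q g q * of_int (mob q * h p m))))"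
      by (rule sum.swap)
    also have "\<dots> = (\<Sum>p\<in>P. K * (f p * (\<Sum>q=1..Q. g_hat Q g q * of_int (mob q * (\<Sum>m | m dvd q. h p m)))))"
      by (simp only: sum_distrib_left of_int_sum of_int_mult)
    also have "\<dots> = (\<Sum>p\<in>P. K * (f p * D p))"
    proof (cases "squarefree l")
      case sl: True
      have "(\<Sum>q=1..Q. g_hat Q g q * of_int (mob q * (\<Sum>m | m dvd q. h p m))) = D p" if "p \<in> P" for p
      proof -
        have p: "prime p" using that by (simp add: P_def)
        have "(\<Sum>q=1..Q. g_hat Q g q * of_int (mob q * (\<Sum>m | m dvd q. h p m))) =
            (\<Sum>q=1..Q. if p dvd l then 0 else (if q = l then g_hat Q g q else 0) - (if q = p * l then g_hat Q g q else 0))"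
        proof (rule sum.cong[OF refl])
          fix q
          show "g_hat Q g q * of_int (mob q * (\<Sum>m | m dvd q. h p m)) =
            (if p dvd l then 0 else (if q = l then g_hat Q g q else 0) - (if q = p * l then g_hat Q g q else 0))"
          proof (cases "squarefree q")
            case sq: True
            show ?thesis
              unfolding h_def sum_mob_multiples_not_dvd[OF p sq l] by (auto simp: right_diff_distrib)
          next
            case False
            \<comment> \<open>For \<open>q\<close> not square-free the left side is 0 through
              \<open>mob q\<close>; so is the right side, since \<open>l\<close> and, if
              \<open>p\<close> does not divide \<open>l\<close>, also \<open>p * l\<close> are
              square-free and differ from \<open>q\<close>.\<close>
            have "squarefree (p * l)" if "\<not> p dvd l"
              using that sl p cop[OF p, of l] by (simp add: squarefree_mult_coprime squarefree_prime)
            then show ?thesis using False sl by (auto simp: mob_def)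
          qed
        qed
        \<comment> \<open>An index \<open>l\<close> or \<open>p * l\<close> beyond \<open>Q\<close>
          is missing from the sum, and \<open>g_hat\<close> is 0 there.\<close>
        also have "\<dots> = D p"
          using g_hat_eq_0[of Q l g] g_hat_eq_0[of Q "p * l" g] l prime_gt_0_nat[OF p]
          by (auto simp: D_def sum_subtractf sum.delta not_le Suc_le_eq)
        finally show ?thesis .
      qed
      then show ?thesis by simp
    qed (simp add: K_def mob_def)
    also have "\<dots> = K * (\<Sum>p\<in>P. f p * D p)" by (simp only: sum_distrib_left)
    also have "(\<Sum>p\<in>P. f p * D p) =
        (\<Sum>p | prime p \<and> p \<le> N \<and> \<not> p dvd l. f p * (g_hat Q g l - g_hat Q g (p * l)))"
      using finP by (intro sum.mono_neutral_cong_right) (auto simp: P_def D_def)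
    finally show ?thesis unfolding K_def .
  qed
  ultimately show ?thesis by simp
qed

text \<open>\<open>wintner\<close> is a \<open>suminf\<close>, which carries no information for a
  divergent series; summability is therefore part of the claim.\<close>

theorem theorem3p3:
  fixes N Q :: nat and f g :: "nat \<Rightarrow> complex" and l :: nat
  assumes "1 \<le> Q" and "Q \<le> N"
    and g_range: "\<And>d. d \<ge> 1 \<Longrightarrow> d \<notin> {1..Q} \<Longrightarrow> eratosthenes g d = 0"
    and g_hat_squarefree: "\<And>k. k \<ge> 1 \<Longrightarrow> \<not> squarefree k \<Longrightarrow> g_hat Q g k = 0"
    and f_primes: "\<And>n. n \<ge> 1 \<Longrightarrow> \<not> prime n \<Longrightarrow> f n = 0"
    and "1 \<le> l"
  shows "summable (wintner_term (IPPification (P_corr f g Q N)) l) \<and>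
         wintner (IPPification (P_corr f g Q N)) l =
           g_hat Q g l / of_nat (totient l) *
             (\<Sum>p | prime p \<and> p \<le> N. f p * ramanujan_sum l p)
         + of_int (mob l) * g_hat Q g l / of_nat (totient l) *
             (\<Sum>p | prime p \<and> p dvd l. f p * of_nat (totient p))
         - of_int (mob l) / of_nat (totient l) *
             (\<Sum>\<^sub>\<infinity>p \<in> {p. prime p \<and> \<not> p dvd l}. f p * g_hat Q g (p * l))"
proof -
  have l: "l > 0" using \<open>1 \<le> l\<close> by simp
  define G where "G = g_hat Q g l"
  define A where "A = {p. prime p \<and> p \<le> N \<and> \<not> p dvd l}"
  define B where "B = {p. prime p \<and> p \<le> N \<and> p dvd l}"
  have fin: "finite A" "finite B" unfolding A_def B_def by (auto intro: finite_subset[of _ "{..N}"])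
  \<comment> \<open>For \<open>p > N\<close> also \<open>p * l > Q\<close>, where
    \<open>g_hat\<close> vanishes, so the sum over all primes not dividing \<open>l\<close> is
    finite.\<close>
  have inf: "(\<Sum>\<^sub>\<infinity>p \<in> {p. prime p \<and> \<not> p dvd l}. f p * g_hat Q g (p * l)) = (\<Sum>p\<in>A. f p * g_hat Q g (p * l))"
  proof -
    have "(\<Sum>\<^sub>\<infinity>p \<in> {p. prime p \<and> \<not> p dvd l}. f p * g_hat Q g (p * l)) = (\<Sum>\<^sub>\<infinity>p\<in>A. f p * g_hat Q g (p * l))"
    proof (rule infsum_cong_neutral)
      fix p assume "p \<in> {p. prime p \<and> \<not> p dvd l} - A"
      then have "p > N" by (auto simp: A_def)
      then have "p * l > Q" using l \<open>Q \<le> N\<close> by (metis le_less_trans mult.right_neutral mult_le_mono2 less_le_trans Suc_leI One_nat_def)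
      then show "f p * g_hat Q g (p * l) = 0" by (simp add: g_hat_eq_0)
    qed (auto simp: A_def)
    then show ?thesis using fin by (simp add: infsum_finite)
  qed
  \<comment> \<open>For \<open>p\<close> not dividing \<open>l\<close> the Ramanujan sum is
    \<open>mob l\<close>; for \<open>p\<close> dividing \<open>l\<close> it is
    \<open>- mob l * totient p\<close>, which the second sum cancels. If \<open>G \<noteq> 0\<close>
    then \<open>l\<close> is square-free and \<open>l \<le> Q \<le> N\<close>, so all primes
    dividing \<open>l\<close> are among the \<open>p \<le> N\<close>.\<close>
  have main: "G * (\<Sum>p | prime p \<and> p \<le> N. f p * ramanujan_sum l p) +
      of_int (mob l) * G * (\<Sum>p | prime p \<and> p dvd l. f p * of_nat (totient p)) = of_int (mob l) * G * (\<Sum>p\<in>A. f p)"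
  proof (cases "G = 0")
    case False
    then have sq: "squarefree l" using g_hat_squarefree[of l] l by (auto simp: G_def)
    have "l \<le> N" using False g_hat_eq_0[of Q l g] \<open>Q \<le> N\<close> by (force simp: G_def not_le)
    then have B: "{p. prime p \<and> p dvd l} = B" using l by (auto simp: B_def dest: dvd_imp_le)
    have "{p. prime p \<and> p \<le> N} = A \<union> B" by (auto simp: A_def B_def)
    then have "(\<Sum>p | prime p \<and> p \<le> N. f p * ramanujan_sum l p) =
        (\<Sum>p\<in>A. f p * ramanujan_sum l p) + (\<Sum>p\<in>B. f p * ramanujan_sum l p)"
      using sum.union_disjoint[OF fin, of "\<lambda>p. f p * ramanujan_sum l p"] by (auto simp: A_def B_def)
    also have "(\<Sum>p\<in>A. f p * ramanujan_sum l p) = of_int (mob l) * (\<Sum>p\<in>A. f p)"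
      unfolding sum_distrib_left by (intro sum.cong refl) (auto simp: A_def ramanujan_sum_prime[OF sq])
    also have "(\<Sum>p\<in>B. f p * ramanujan_sum l p) = - (of_int (mob l) * (\<Sum>p\<in>B. f p * of_nat (totient p)))"
      unfolding sum_distrib_left sum_negf[symmetric]
      by (intro sum.cong refl) (auto simp: B_def ramanujan_sum_prime[OF sq])
    finally have eq: "(\<Sum>p | prime p \<and> p \<le> N. f p * ramanujan_sum l p) =
        of_int (mob l) * (\<Sum>p\<in>A. f p) + - (of_int (mob l) * (\<Sum>p\<in>B. f p * of_nat (totient p)))" .
    show ?thesis unfolding B eq by (simp add: algebra_simps)
  qed simp
  have sums: "wintner_term (IPPification (P_corr f g Q N)) l sums
      (of_int (mob l) / of_nat (totient l) * (\<Sum>p\<in>A. f p * (G - g_hat Q g (p * l))))"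
    using wintner_P_corr_sums[OF l] unfolding A_def G_def .
  have "of_int (mob l) / of_nat (totient l) * (\<Sum>p\<in>A. f p * (G - g_hat Q g (p * l))) =
      (of_int (mob l) * G * (\<Sum>p\<in>A. f p)) / of_nat (totient l)
        - of_int (mob l) / of_nat (totient l) * (\<Sum>p\<in>A. f p * g_hat Q g (p * l))"
  proof -
    have eq: "(\<Sum>p\<in>A. f p * (G - g_hat Q g (p * l))) = G * (\<Sum>p\<in>A. f p) - (\<Sum>p\<in>A. f p * g_hat Q g (p * l))"
      by (simp add: right_diff_distrib sum_subtractf sum_distrib_left mult.commute)
    show ?thesis unfolding eq by (simp add: right_diff_distrib mult_ac)
  qed
  also have "(of_int (mob l) * G * (\<Sum>p\<in>A. f p)) / of_nat (totient l) =
      G / of_nat (totient l) * (\<Sum>p | prime p \<and> p \<le> N. f p * ramanujan_sum l p)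
      + of_int (mob l) * G / of_nat (totient l) * (\<Sum>p | prime p \<and> p dvd l. f p * of_nat (totient p))"
    unfolding main[symmetric] by (simp add: add_divide_distrib)
  finally show ?thesis
    using sums unfolding inf G_def wintner_def by (simp add: sums_iff)
qed

end
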